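(* Let $\alpha>0$ and for a holomorphic $g(z)=\sum_{k\ge0}\hat g(k)z^k$ on the unit disk let $\sigma_n^\alpha(g):=\sum_{k=0}^n\binom{n}{k}\big/\binom{n+\alpha}{k}\,\hat g(k)z^k$. Then: (1) $\|\sigma_n^\alpha(g)-g\|_{H^1}\to0$ for all $g\in H^1$; (2) $\sigma_n^\alpha(h)\to h$ weak* in $\mathrm{BMOA}$ for all $h\in\mathrm{BMOA}$; (3) $\|\sigma_n^\alpha(f)-f\|_{\mathrm{BMOA}}\to0$ for all $f\in\mathrm{VMOA}$.
   Context: Binomial coefficients with non-integer arguments are defined via the Gamma function. $H^1$ is the Hardy space on the unit disk $\mathbb D$. $\mathrm{BMOA}$ is the space of $f\in H^2$ with $\|f\|_{\mathrm{BMOA}}:=|f(0)|+\sup_{\mathbb D}(P|f|^2-|f|^2)^{1/2}<\infty$ ($P$ the Poisson integral), and $\mathrm{VMOA}$ the closed subspace where $(P|f|^2-|f|^2)(z)\to0$ as $|z|\to1$. $\mathrm{BMOA}$ is identified (up to isomorphism) with $(H^1)^*$ via $\langle g,h\rangle=\lim_{r\to1^-}\frac1{2\pi}\int_0^{2\pi}g(re^{i\theta})h(re^{-i\theta})d\theta$; weak* refers to this duality. *)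

theory Defs
  imports "HOL-Analysis.Analysis"
begin

text \<open>Functions on the unit disk are modelled as maps complex to complex; only their
values on ball 0 1 matter.\<close>

definition unit_disk :: "complex set" where
  "unit_disk = ball 0 1"

definition taylor_coeff :: "(complex \<Rightarrow> complex) \<Rightarrow> nat \<Rightarrow> complex" where
  "taylor_coeff g k = (deriv ^^ k) g 0 / of_nat (fact k)"

definition int_mean :: "real \<Rightarrow> real \<Rightarrow> (complex \<Rightarrow> complex) \<Rightarrow> real" where
  "int_mean p r f = (1 / (2 * pi)) * integral {0..2*pi} (\<lambda>t. norm (f (of_real r * cis t)) powr p)"

definition H1 :: "(complex \<Rightarrow> complex) set" where
  "H1 = {f. f holomorphic_on unit_disk \<and> bdd_above ((\<lambda>r. int_mean 1 r f) ` {0..<1})}"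

definition H1_norm :: "(complex \<Rightarrow> complex) \<Rightarrow> real" where
  "H1_norm f = (SUP r\<in>{0..<1}. int_mean 1 r f)"

definition H2 :: "(complex \<Rightarrow> complex) set" where
  "H2 = {f. f holomorphic_on unit_disk \<and> bdd_above ((\<lambda>r. int_mean 2 r f) ` {0..<1})}"

text \<open>Poisson integral of |f|^2 (boundary values of f in H2), computed as the limit of the
Poisson integrals of |f(r .)|^2 as r tends to 1 from below.\<close>
definition poisson_abs2 :: "(complex \<Rightarrow> complex) \<Rightarrow> complex \<Rightarrow> real" where
  "poisson_abs2 f z = Lim (at_left 1) (\<lambda>r::real. (1 / (2 * pi)) *
      integral {0..2*pi} (\<lambda>t. (1 - (norm z)\<^sup>2) / (norm (cis t - z))\<^sup>2 * (norm (f (of_real r * cis t)))\<^sup>2))"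

definition garsia :: "(complex \<Rightarrow> complex) \<Rightarrow> complex \<Rightarrow> real" where
  "garsia f z = poisson_abs2 f z - (norm (f z))\<^sup>2"

definition BMOA :: "(complex \<Rightarrow> complex) set" where
  "BMOA = {f. f \<in> H2 \<and> bdd_above (garsia f ` unit_disk)}"

definition BMOA_norm :: "(complex \<Rightarrow> complex) \<Rightarrow> real" where
  "BMOA_norm f = norm (f 0) + (SUP z\<in>unit_disk. sqrt (garsia f z))"

definition VMOA :: "(complex \<Rightarrow> complex) set" where
  "VMOA = {f. f \<in> BMOA \<and>
     (\<forall>e>0. \<exists>r<1. \<forall>z. r < norm z \<and> norm z < 1 \<longrightarrow> \<bar>garsia f z\<bar> < e)}"

definition dual_pair :: "(complex \<Rightarrow> complex) \<Rightarrow> (complex \<Rightarrow> complex) \<Rightarrow> complex" where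
  "dual_pair g h = Lim (at_left 1) (\<lambda>r::real. (1 / (2 * of_real pi)) *
      integral {0..2*pi} (\<lambda>t. g (of_real r * cis t) * h (of_real r * cis (- t)) :: complex))"

text \<open>The means sigma_n^alpha; generalized binomial via gchoose (agrees with the Gamma
definition for integer lower index).\<close>
definition sigma_mean :: "real \<Rightarrow> nat \<Rightarrow> (complex \<Rightarrow> complex) \<Rightarrow> complex \<Rightarrow> complex" where
  "sigma_mean \<alpha> n g = (\<lambda>z. \<Sum>k\<le>n. of_real (real (n choose k) / ((real n + \<alpha>) gchoose k))
        * taylor_coeff g k * z ^ k)"

end

theory Submission
  imports Defs "HOL-Complex_Analysis.Complex_Analysis" "HOL-Real_Asymp.Real_Asymp"
begin

text \<open>The means are the Cesaro means of order \<open>\<alpha>\<close>: the weights are \<open>A\<^bsub>n-k\<^esub> / A\<^bsub>n\<^esub>\<close>, where \<open>A\<^bsub>j\<^esub>\<close> is the \<open>j\<close>-th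
  Taylor coefficient of \<open>(1 - z)\<^bsup>-1-\<alpha>\<^esup>\<close>. Only the nonnegative frequencies of a convolution kernel act on
  analytic functions, so after a shift by \<open>n\<close> any function whose first \<open>n + 1\<close> Taylor coefficients are
  the \<open>A\<^bsub>j\<^esub>\<close> may serve as kernel; \<open>(1 - z\<^bsup>n+1\<^esup>)\<^sup>m / (1 - z)\<^bsup>1+\<alpha>\<^esup>\<close> has \<open>L\<^sup>1\<close> norm \<open>O(n\<^sup>\<alpha>) = O(A\<^bsub>n\<^esub>)\<close>. Hence the means
  are uniformly bounded for every rotation invariant norm.

  In \<open>H\<^sup>1\<close> the polynomials are dense, because a function of \<open>H\<^sup>1\<close> is a product of two functions of
  \<open>H\<^sup>2\<close>; this settles (1). For (2), the duality inequality \<open>\<bar>\<langle>g, h\<rangle>\<bar> \<le> K \<parallel>g\<parallel>\<close> makes the radial limits that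
  define \<open>\<langle>g, h\<rangle>\<close> exist and transports the convergence from \<open>H\<^sup>1\<close>. For (3), near the circle the
  Garsia seminorm of the means is controlled by that of \<open>f\<close> on the same circle \<open>\<bar>w\<bar> = \<bar>z\<bar>\<close>, which is small,
  and on a smaller disk convergence in \<open>H\<^sup>2\<close> suffices.\<close>

section \<open>Means over the unit circle\<close>

text \<open>No boundary values are used: all integrals run over circles of radius below 1, where the
  integrands are continuous, and radius 1 is reached only through limits of numbers. The Poisson
  integral and the pairing are both defined by \<open>Lim\<close>, which says nothing until
  convergence is proved, so the existence of these limits is part of the work. For the Poisson
  integral it follows from Parseval; for the pairing the duality inequality gives only a bound, and
  existence comes out of the convergence of the means.

  The duality inequality is shaped by how subharmonicity is tested. A finite sum of products of a
  holomorphic and an antiholomorphic function has circle means that form a power series in the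
  squared radius, so one-variable monotonicity suffices. A polynomial weight stays within such
  finite sums, an exponential does not. The modulus of \<open>F\<close> is not such a sum either,
  but the squared moduli of two factors of \<open>F\<close> are, and on the chosen circle they are
  comparable to it. Zeros of \<open>F\<close> make the logarithm of its modulus infinite, which is
  why the factorization carries a slack \<open>d\<close> that is removed later.\<close>

definition cmean :: "(complex \<Rightarrow> 'a::euclidean_space) \<Rightarrow> 'a" where
  "cmean F = (1 / (2 * pi)) *\<^sub>R integral {0..2*pi} (\<lambda>t. F (cis t))"

abbreviation mean_norm :: "(complex \<Rightarrow> complex) \<Rightarrow> real \<Rightarrow> real" where
  "mean_norm f r \<equiv> cmean (\<lambda>z. norm (f (of_real r * z)))"

abbreviation mean_square :: "(complex \<Rightarrow> complex) \<Rightarrow> real \<Rightarrow> real" where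
  "mean_square f r \<equiv> cmean (\<lambda>z. (norm (f (of_real r * z)))\<^sup>2)"

abbreviation circ_continuous :: "(complex \<Rightarrow> 'a::topological_space) \<Rightarrow> bool" where
  "circ_continuous \<equiv> continuous_on (sphere 0 1)"

abbreviation torus_continuous :: "(complex \<times> complex \<Rightarrow> 'a::topological_space) \<Rightarrow> bool" where
  "torus_continuous \<equiv> continuous_on (sphere 0 1 \<times> sphere 0 1)"

lemma continuous_on_comp_cis:
  assumes "circ_continuous F"
  shows "continuous_on A (\<lambda>t. F (cis t))"
  by (rule continuous_on_compose2[OF assms]) (auto intro!: continuous_intros)

lemma integrable_comp_cis:
  fixes F :: "complex \<Rightarrow> 'a::euclidean_space"
  assumes "circ_continuous F"
  shows "(\<lambda>t. F (cis t)) integrable_on {a..b}"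
  by (intro integrable_continuous_interval continuous_on_comp_cis assms)

lemma cmean_cong:
  assumes "\<And>z. norm z = 1 \<Longrightarrow> F z = G z"
  shows "cmean F = cmean G"
  unfolding cmean_def by (simp add: assms)

lemma cmean_const [simp]: "cmean (\<lambda>_. c) = c"
  by (simp add: cmean_def)

lemma cmean_linear:
  assumes "bounded_linear L" "circ_continuous F"
  shows "cmean (\<lambda>z. L (F z)) = L (cmean F)"
  using integral_linear[OF integrable_comp_cis[OF assms(2)] assms(1), of 0 "2*pi"]
  by (simp add: cmean_def o_def linear_simps[OF assms(1)])

lemma cmean_add:
  assumes "circ_continuous F" "circ_continuous G"
  shows "cmean (\<lambda>z. F z + G z) = cmean F + cmean G"
  unfolding cmean_def
  by (simp add: integral_add[OF integrable_comp_cis[OF assms(1)] integrable_comp_cis[OF assms(2)]]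
      scaleR_right_distrib)

lemma cmean_diff:
  assumes "circ_continuous F" "circ_continuous G"
  shows "cmean (\<lambda>z. F z - G z) = cmean F - cmean G"
  unfolding cmean_def
  by (simp add: integral_diff[OF integrable_comp_cis[OF assms(1)] integrable_comp_cis[OF assms(2)]]
      scaleR_right_diff_distrib)

lemma cmean_sum:
  assumes "\<And>i. i \<in> I \<Longrightarrow> circ_continuous (F i)"
  shows "cmean (\<lambda>z. \<Sum>i\<in>I. F i z) = (\<Sum>i\<in>I. cmean (F i))"
  using assms
proof (induction I rule: infinite_finite_induct)
  case (insert x I)
  then show ?case by (simp add: cmean_add continuous_on_sum)
qed auto

lemma cmean_cmult:
  fixes F :: "complex \<Rightarrow> complex"
  assumes "circ_continuous F"
  shows "cmean (\<lambda>z. c * F z) = c * cmean F"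
  by (rule cmean_linear[OF bounded_linear_mult_right assms])

lemma cmean_real_cmult:
  fixes F :: "complex \<Rightarrow> real"
  assumes "circ_continuous F"
  shows "cmean (\<lambda>z. c * F z) = c * cmean F"
  by (rule cmean_linear[OF bounded_linear_mult_right assms])

lemma cmean_Re:
  assumes "circ_continuous F"
  shows "cmean (\<lambda>z. Re (F z)) = Re (cmean F)"
  by (rule cmean_linear[OF bounded_linear_Re assms])

lemma cmean_cnj:
  assumes "circ_continuous F"
  shows "cmean (\<lambda>z. cnj (F z)) = cnj (cmean F)"
  by (rule cmean_linear[OF bounded_linear_cnj assms])

lemma cmean_of_real:
  assumes "circ_continuous F"
  shows "cmean (\<lambda>z. complex_of_real (F z)) = of_real (cmean F)"
  by (rule cmean_linear[OF bounded_linear_of_real assms])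

lemma cmean_mono:
  fixes F G :: "complex \<Rightarrow> real"
  assumes "circ_continuous F" "circ_continuous G"
    and "\<And>z. norm z = 1 \<Longrightarrow> F z \<le> G z"
  shows "cmean F \<le> cmean G"
  unfolding cmean_def real_scaleR_def
  by (intro mult_left_mono integral_le integrable_comp_cis assms) (auto simp: assms)

lemma cmean_nonneg:
  fixes F :: "complex \<Rightarrow> real"
  assumes "circ_continuous F" "\<And>z. norm z = 1 \<Longrightarrow> F z \<ge> 0"
  shows "cmean F \<ge> 0"
  using cmean_mono[of "\<lambda>_. 0" F] assms by simp

lemma cmean_norm_le:
  fixes F :: "complex \<Rightarrow> 'a::euclidean_space"
  assumes "circ_continuous F"
  shows "norm (cmean F) \<le> cmean (\<lambda>z. norm (F z))"
proof -
  have "norm (integral {0..2*pi} (\<lambda>t. F (cis t))) \<le> integral {0..2*pi} (\<lambda>t. norm (F (cis t)))"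
    by (intro integral_norm_bound_integral integrable_comp_cis assms continuous_intros) auto
  then show ?thesis by (simp add: cmean_def divide_right_mono)
qed

text \<open>A rotation shifts the angle; the part of the shifted interval beyond
  \<open>2 * pi\<close> is carried back by periodicity.\<close>

lemma cmean_rotate:
  fixes F :: "complex \<Rightarrow> 'a::euclidean_space"
  assumes F: "circ_continuous F" and w: "norm w = 1"
  shows "cmean (\<lambda>z. F (w * z)) = cmean F"
proof -
  define s where "s = Arg2pi w"
  have s: "0 \<le> s" "s < 2 * pi" "w = cis s"
    using Arg2pi[of w] w by (auto simp: s_def cis_conv_exp is_Arg_def)
  define f where "f = (\<lambda>t. F (cis t))"
  have int: "f integrable_on {a..b}" for a b
    unfolding f_def by (rule integrable_comp_cis[OF F])
  have per: "f (t + 2 * pi) = f t" for t by (simp add: f_def cis_mult[symmetric])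
  have "integral {0..2*pi} (\<lambda>t. F (w * cis t)) = integral {0..2*pi} (\<lambda>t. f (t + s))"
    by (simp add: f_def s(3) cis_mult add.commute)
  also have "\<dots> = integral {s..2*pi+s} f"
    using integral_shift_real_ivl[of s s "2*pi+s" f] by simp
  also have "\<dots> = integral {s..2*pi} f + integral {2*pi..2*pi+s} f"
    by (rule Henstock_Kurzweil_Integration.integral_combine[symmetric]) (use s int in auto)
  also have "integral {2*pi..2*pi+s} f = integral {0..s} f"
    using integral_shift_real_ivl[of "2*pi" "2*pi" "2*pi+s" f] by (simp add: per)
  also have "integral {s..2*pi} f + integral {0..s} f = integral {0..2*pi} f"
    by (subst add.commute, rule Henstock_Kurzweil_Integration.integral_combine) (use s int in auto)
  finally show ?thesis by (simp add: cmean_def f_def)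
qed

lemma cmean_reflect:
  fixes F :: "complex \<Rightarrow> 'a::euclidean_space"
  shows "cmean (\<lambda>z. F (cnj z)) = cmean F"
proof -
  define f where "f = (\<lambda>t. F (cis t))"
  have per: "f (t + 2 * pi) = f t" for t by (simp add: f_def cis_mult[symmetric])
  have "integral {0..2*pi} (\<lambda>t. F (cnj (cis t))) = integral {0..2*pi} (\<lambda>t. f (-t))"
    by (simp add: f_def cis_cnj)
  also have "\<dots> = integral {-(2*pi)..0} f"
    using Henstock_Kurzweil_Integration.integral_reflect_real[of 0 "-(2*pi)" f] by simp
  also have "\<dots> = integral {0..2*pi} f"
    using integral_shift_real_ivl[of "0" "2*pi" "2*pi" f] per by simp
  finally show ?thesis by (simp add: cmean_def f_def)
qed

lemma cmean_swap:
  fixes F :: "complex \<Rightarrow> complex \<Rightarrow> 'a::euclidean_space"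
  assumes "torus_continuous (\<lambda>(x, y). F x y)"
  shows "cmean (\<lambda>x. cmean (F x)) = cmean (\<lambda>y. cmean (\<lambda>x. F x y))"
proof -
  have "continuous_on (cbox (0,0) (2*pi,2*pi)) (\<lambda>p. (\<lambda>(x,y). F x y) (cis (fst p), cis (snd p)))"
    by (rule continuous_on_compose2[OF assms]) (auto intro!: continuous_intros)
  then have "continuous_on (cbox (0,0) (2*pi,2*pi)) (\<lambda>(s,t). F (cis s) (cis t))"
    by (simp add: case_prod_unfold)
  from integral_swap_continuous[OF this]
  show ?thesis by (simp add: cmean_def)
qed

lemma continuous_on_cmean:
  fixes F :: "complex \<Rightarrow> complex \<Rightarrow> 'a::euclidean_space"
  assumes "continuous_on (S \<times> sphere 0 1) (\<lambda>(x, y). F x y)"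
  shows "continuous_on S (\<lambda>x. cmean (F x))"
proof -
  have "continuous_on (S \<times> cbox 0 (2*pi)) (\<lambda>p. (\<lambda>(x,y). F x y) (fst p, cis (snd p)))"
    by (rule continuous_on_compose2[OF assms]) (auto intro!: continuous_intros)
  then have "continuous_on (S \<times> cbox 0 (2*pi)) (\<lambda>(x,t). F x (cis t))"
    by (simp add: case_prod_unfold)
  from integral_continuous_on_param[OF this]
  show ?thesis unfolding cmean_def by (auto intro!: continuous_intros)
qed

lemma cmean_uniform_limit:
  fixes F :: "'b \<Rightarrow> complex \<Rightarrow> 'a::euclidean_space"
  assumes u: "uniform_limit (sphere 0 1) F G net"
    and c: "\<And>n. circ_continuous (F n)" and net: "net \<noteq> bot"
  shows "((\<lambda>n. cmean (F n)) \<longlongrightarrow> cmean G) net"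
proof -
  have u': "uniform_limit {0..2*pi} (\<lambda>n t. F n (cis t)) (\<lambda>t. G (cis t)) net"
    by (rule uniform_limit_compose'[OF u]) auto
  obtain I J where I: "\<And>n. ((\<lambda>t. F n (cis t)) has_integral I n) {0..2*pi}"
    and J: "((\<lambda>t. G (cis t)) has_integral J) {0..2*pi}" and lim: "(I \<longlongrightarrow> J) net"
    using uniform_limit_integral[OF u' continuous_on_comp_cis[OF c] net] by blast
  have "(\<lambda>n. cmean (F n)) = (\<lambda>n. (1 / (2 * pi)) *\<^sub>R I n)" "cmean G = (1 / (2 * pi)) *\<^sub>R J"
    using I J by (auto simp: cmean_def integral_unique)
  then show ?thesis using lim by (auto intro!: tendsto_intros)
qed

text \<open>The form a x^2 + 2 b x y + c y^2 is the mean of a square, hence nonnegative. At (-b, a)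
  it gives a (a c - b^2), which is void when a = 0; there the point (-(c + 1), b) leaves -(c + 2)
  b^2 and forces b = 0.\<close>

lemma cmean_Cauchy_Schwarz:
  fixes F G :: "complex \<Rightarrow> real"
  assumes F: "circ_continuous F" and G: "circ_continuous G"
  shows "(cmean (\<lambda>z. F z * G z))\<^sup>2 \<le> cmean (\<lambda>z. (F z)\<^sup>2) * cmean (\<lambda>z. (G z)\<^sup>2)"
proof -
  have cont: "circ_continuous (\<lambda>z. (F z)\<^sup>2)" "circ_continuous (\<lambda>z. (G z)\<^sup>2)"
    "circ_continuous (\<lambda>z. F z * G z)"
    "circ_continuous (\<lambda>z. x * (F z)\<^sup>2)" "circ_continuous (\<lambda>z. x * (G z)\<^sup>2)"
    "circ_continuous (\<lambda>z. x * (F z * G z))"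
    "circ_continuous (\<lambda>z. x * (F z)\<^sup>2 + y * (F z * G z))" for x y
    by (intro continuous_intros F G)+
  define a b c where "a = cmean (\<lambda>z. (F z)\<^sup>2)" and "b = cmean (\<lambda>z. F z * G z)"
    and "c = cmean (\<lambda>z. (G z)\<^sup>2)"
  have q: "0 \<le> a * x\<^sup>2 + 2 * b * x * y + c * y\<^sup>2" for x y
  proof -
    have "0 \<le> cmean (\<lambda>z. (x * F z + y * G z)\<^sup>2)"
      by (rule cmean_nonneg) (auto intro!: continuous_intros F G)
    also have "(\<lambda>z. (x * F z + y * G z)\<^sup>2)
      = (\<lambda>z. (x\<^sup>2 * (F z)\<^sup>2 + (2 * x * y) * (F z * G z)) + y\<^sup>2 * (G z)\<^sup>2)"
      by (auto simp: power2_eq_square algebra_simps)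
    also have "cmean \<dots> = x\<^sup>2 * a + (2 * x * y) * b + y\<^sup>2 * c"
      unfolding a_def b_def c_def
      by (simp only: cmean_add cmean_real_cmult cont)
    finally show ?thesis by (simp add: algebra_simps)
  qed
  have a: "a \<ge> 0" and c: "c \<ge> 0" using q[of 1 0] q[of 0 1] by auto
  have "b\<^sup>2 \<le> a * c"
  proof (cases "a = 0")
    case True
    have "b * b * (c + 2) \<le> 0"
      using q[of "-(c+1)" b] True by (simp add: power2_eq_square algebra_simps)
    then have "b * b \<le> 0" using c by (simp add: mult_le_0_iff)
    then show ?thesis using True by (simp add: power2_eq_square)
  next
    case False
    have "0 \<le> a * (a * c - b\<^sup>2)" using q[of "-b" a] by (simp add: power2_eq_square algebra_simps)
    then show ?thesis using a False by (simp add: zero_le_mult_iff)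
  qed
  then show ?thesis by (simp add: a_def b_def c_def)
qed

section \<open>Taylor coefficients and Parseval\<close>

text \<open>Cauchy's formula on the unit circle itself. Continuity up to the circle instead of
  holomorphy across it matters: the Cesaro kernel is in general only continuous at 1.\<close>

lemma cmean_cnj_power:
  assumes c: "continuous_on (cball 0 1) G" and h: "G holomorphic_on ball 0 1"
  shows "cmean (\<lambda>z. G z * cnj z ^ k) = taylor_coeff G k"
proof -
  have "((\<lambda>u. G u / (u - 0) ^ Suc k) has_contour_integral
      ((2 * pi * \<i>) / fact k * (deriv ^^ k) G 0)) (circlepath 0 1)"
    by (rule Cauchy_has_contour_integral_higher_derivative_circlepath[OF c h]) simp
  then have "((\<lambda>t. G (cis t) / cis t ^ Suc k * \<i> * cis t) has_integral
      ((2 * pi * \<i>) / fact k * (deriv ^^ k) G 0)) {0..2*pi}"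
    unfolding circlepath_def by (subst (asm) has_contour_integral_part_circlepath_iff) auto
  moreover have "G (cis t) / cis t ^ Suc k * \<i> * cis t = \<i> * (G (cis t) * cnj (cis t) ^ k)" for t
    by (simp add: cis_cnj field_simps cis_mult flip: power_mult_distrib)
  ultimately have "((\<lambda>t. \<i> * (G (cis t) * cnj (cis t) ^ k)) has_integral
      ((2 * pi * \<i>) / fact k * (deriv ^^ k) G 0)) {0..2*pi}"
    by simp
  from has_integral_mult_right[OF this, of "-\<i>"]
  have "((\<lambda>t. G (cis t) * cnj (cis t) ^ k) has_integral
      ((2 * pi) / fact k * (deriv ^^ k) G 0)) {0..2*pi}"
    by (simp add: algebra_simps)
  then show ?thesis
    by (simp add: cmean_def integral_unique taylor_coeff_def scaleR_conv_of_real)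
qed

text \<open>On the circle \<open>cnj z\<close> is the inverse of \<open>z\<close>. For
  \<open>k \<le> n\<close> the powers combine to \<open>cnj z ^ (n - k)\<close>, which extracts one
  coefficient; for \<open>k > n\<close> a positive power of \<open>z\<close> remains and the mean is
  its value 0 at the origin. So a kernel shifted by \<open>n\<close> acts on analytic functions
  through its first \<open>n + 1\<close> coefficients alone.\<close>

lemma cmean_power_cnj_power:
  assumes c: "continuous_on (cball 0 1) G" and h: "G holomorphic_on ball 0 1"
  shows "cmean (\<lambda>z. z ^ k * (G z * cnj z ^ n)) = (if k \<le> n then taylor_coeff G (n - k) else 0)"
proof -
  have 1: "z ^ j * cnj z ^ j = 1" if "norm z = 1" for z :: complex and j
    using that by (simp add: complex_norm_square[symmetric] flip: power_mult_distrib)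
  show ?thesis
  proof (cases "k \<le> n")
    case True
    have "z ^ k * (G z * cnj z ^ n) = G z * cnj z ^ (n - k)" if "norm z = 1" for z
    proof -
      have "cnj z ^ n = cnj z ^ k * cnj z ^ (n - k)" using True by (simp flip: power_add)
      then have "z ^ k * (G z * cnj z ^ n) = (z ^ k * cnj z ^ k) * (G z * cnj z ^ (n - k))"
        by (simp only: mult_ac)
      then show ?thesis using 1[OF that, of k] by simp
    qed
    then show ?thesis using True cmean_cnj_power[OF c h, of "n - k"]
      by (simp add: cmean_cong[of "\<lambda>z. z ^ k * (G z * cnj z ^ n)" "\<lambda>z. G z * cnj z ^ (n - k)"])
  next
    case False
    have "z ^ k * (G z * cnj z ^ n) = (z ^ (k - n) * G z) * cnj z ^ 0" if "norm z = 1" for z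
    proof -
      have "z ^ k = z ^ (k - n) * z ^ n" using False by (simp flip: power_add)
      then show ?thesis using 1[OF that, of n] by (simp add: mult_ac)
    qed
    then have "cmean (\<lambda>z. z ^ k * (G z * cnj z ^ n)) = cmean (\<lambda>z. (z ^ (k - n) * G z) * cnj z ^ 0)"
      by (rule cmean_cong)
    also have "\<dots> = taylor_coeff (\<lambda>z. z ^ (k - n) * G z) 0"
      by (rule cmean_cnj_power) (auto intro!: continuous_intros holomorphic_intros c h)
    finally show ?thesis using False by (simp add: taylor_coeff_def)
  qed
qed

lemma taylor_coeff_polynomial:
  "taylor_coeff (\<lambda>z. \<Sum>k\<le>n. c k * z ^ k) j = (if j \<le> n then c j else 0)"
proof -
  have "taylor_coeff (\<lambda>z. \<Sum>k\<le>n. c k * z ^ k) j = cmean (\<lambda>z. (\<Sum>k\<le>n. c k * z ^ k) * cnj z ^ j)"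
    by (rule cmean_cnj_power[symmetric]) (auto intro!: continuous_intros holomorphic_intros)
  also have "\<dots> = cmean (\<lambda>z. \<Sum>k\<le>n. c k * (z ^ k * (1 * cnj z ^ j)))"
    by (simp add: sum_distrib_right mult.assoc)
  also have "\<dots> = (\<Sum>k\<le>n. c k * cmean (\<lambda>z. z ^ k * (1 * cnj z ^ j)))"
    by (subst cmean_sum, intro continuous_intros, subst cmean_cmult, intro continuous_intros, rule refl)
  also have "\<dots> = (\<Sum>k\<le>n. c k * (if k \<le> j then taylor_coeff (\<lambda>_. 1) (j - k) else 0))"
    by (subst cmean_power_cnj_power) (auto intro!: continuous_intros holomorphic_intros)
  also have "\<dots> = (\<Sum>k\<le>n. if k = j then c k else 0)"
    by (rule sum.cong) (auto simp: taylor_coeff_def higher_deriv_const)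
  finally show ?thesis by simp
qed

section \<open>Dilations of functions on the disk and their Taylor series\<close>

lemma disk_mult_le:
  assumes "norm c < 1" "norm z \<le> 1"
  shows "norm (c * z :: complex) < 1"
  using assms mult_left_le[of "norm z" "norm c"] by (simp add: norm_mult)

lemma dilate_holomorphic:
  assumes "f holomorphic_on ball 0 1" "norm c \<le> 1"
  shows "(\<lambda>z. f (c * z)) holomorphic_on ball 0 1"
proof -
  have "(f \<circ> (\<lambda>z. c * z)) holomorphic_on ball 0 1"
  proof (rule holomorphic_on_compose_gen[OF _ assms(1)])
    have "norm (c * z) < 1" if "norm z < 1" for z
      using that assms(2) disk_mult_le[of z c] by (simp add: mult.commute)
    then show "(\<lambda>z. c * z) ` ball 0 1 \<subseteq> ball 0 1" by auto
  qed (auto intro!: holomorphic_intros)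
  then show ?thesis by (simp add: o_def)
qed

lemma dilate_continuous:
  assumes "f holomorphic_on ball 0 1" "norm c < 1"
  shows "continuous_on (cball 0 1) (\<lambda>z. f (c * z))"
  by (rule continuous_on_compose2[OF holomorphic_on_imp_continuous_on[OF assms(1)]])
     (use assms(2) disk_mult_le in \<open>auto intro!: continuous_intros\<close>)

lemma dilate_continuous_sphere:
  assumes "f holomorphic_on ball 0 1" "norm c < 1"
  shows "circ_continuous (\<lambda>z. f (c * z))"
  by (rule continuous_on_subset[OF dilate_continuous[OF assms]]) auto

lemma taylor_coeff_dilate:
  assumes "f holomorphic_on ball 0 1" "norm c \<le> 1"
  shows "taylor_coeff (\<lambda>z. f (c * z)) k = c ^ k * taylor_coeff f k"
proof -
  have "norm (c * z) < 1" if "norm z < 1" for z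
    using that assms(2) disk_mult_le[of z c] by (simp add: mult.commute)
  then have "(deriv ^^ k) (\<lambda>w. f (c * w)) 0 = c ^ k * (deriv ^^ k) f (c * 0)"
    by (intro higher_deriv_compose_linear[OF assms(1), of "ball 0 1"]) auto
  then show ?thesis by (simp add: taylor_coeff_def)
qed

lemma taylor_coeff_sums:
  assumes "f holomorphic_on ball 0 1" "norm z < 1"
  shows "(\<lambda>k. taylor_coeff f k * z ^ k) sums f z"
  using holomorphic_power_series[OF assms(1), of z] assms(2)
  by (simp add: taylor_coeff_def)

lemma taylor_coeff_abs_summable:
  assumes "f holomorphic_on ball 0 1" "norm z < 1"
  shows "summable (\<lambda>k. norm (taylor_coeff f k * z ^ k))"
proof -
  obtain s where s: "norm z < s" "s < 1" using assms(2) dense by blast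
  then have "0 < s" using norm_ge_zero[of z] by linarith
  then show ?thesis
    using taylor_coeff_sums[OF assms(1), of "of_real s"] s
    by (intro powser_insidea[of _ "of_real s"]) (auto simp: sums_iff)
qed

lemma taylor_uniform_limit:
  assumes "f holomorphic_on ball 0 1" "norm c < 1"
  shows "uniform_limit (sphere 0 1) (\<lambda>n z. \<Sum>k<n. taylor_coeff f k * c ^ k * z ^ k)
           (\<lambda>z. f (c * z)) sequentially"
proof -
  have "uniform_limit (sphere 0 1) (\<lambda>n z. \<Sum>k<n. taylor_coeff f k * c ^ k * z ^ k)
           (\<lambda>z. \<Sum>k. taylor_coeff f k * c ^ k * z ^ k) sequentially"
    by (rule Weierstrass_m_test[OF _ taylor_coeff_abs_summable[OF assms]])
       (auto simp: norm_mult norm_power)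
  moreover have "(\<Sum>k. taylor_coeff f k * c ^ k * z ^ k) = f (c * z)" if "z \<in> sphere 0 1" for z
    using taylor_coeff_sums[OF assms(1), of "c * z"] that assms(2)
    by (simp add: norm_mult power_mult_distrib sums_iff mult.assoc)
  ultimately show ?thesis by (subst (asm) uniform_limit_cong'[OF refl]) auto
qed

lemma taylor_coeff_0 [simp]: "taylor_coeff f 0 = f 0"
  by (simp add: taylor_coeff_def)

lemma taylor_coeff_deriv: "taylor_coeff (deriv f) k = of_nat (Suc k) * taylor_coeff f (Suc k)"
proof -
  have "(deriv ^^ k) (deriv f) = (deriv ^^ Suc k) f" by (simp add: funpow_swap1)
  moreover have "complex_of_nat (fact (Suc k)) = of_nat (Suc k) * of_nat (fact k)"
    by (simp only: fact_Suc of_nat_mult of_nat_id)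
  moreover have "complex_of_nat (Suc k) \<noteq> 0" by (simp del: of_nat_Suc)
  ultimately show ?thesis by (simp add: taylor_coeff_def del: funpow.simps of_nat_Suc of_nat_fact fact_Suc)
qed

lemma taylor_coeff_diff:
  assumes "f holomorphic_on ball 0 1" "g holomorphic_on ball 0 1"
  shows "taylor_coeff (\<lambda>z. f z - g z) k = taylor_coeff f k - taylor_coeff g k"
  unfolding taylor_coeff_def
  by (subst higher_deriv_diff[OF assms]) (auto simp: diff_divide_distrib)

text \<open>Only \<open>w\<close> is expanded: its Taylor series converges uniformly on the circle,
  and each of its terms picks out one coefficient of \<open>v\<close>.\<close>

lemma cmean_Parseval:
  assumes v: "v holomorphic_on ball 0 1" and w: "w holomorphic_on ball 0 1"
    and r: "0 \<le> r" "r < 1"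
  shows "(\<lambda>k. taylor_coeff v k * cnj (taylor_coeff w k) * of_real (r ^ (2 * k))) sums
           cmean (\<lambda>z. v (of_real r * z) * cnj (w (of_real r * z)))"
proof -
  let ?v = "\<lambda>z. v (of_real r * z)" and ?w = "\<lambda>z. w (of_real r * z)"
  have nr: "norm (complex_of_real r) < 1" "norm (complex_of_real r) \<le> 1" using r by auto
  have cv: "circ_continuous ?v" by (rule dilate_continuous_sphere[OF v nr(1)])
  have u: "uniform_limit (sphere 0 1) (\<lambda>n z. ?v z * cnj (\<Sum>k<n. taylor_coeff w k * of_real r ^ k * z ^ k))
           (\<lambda>z. ?v z * cnj (?w z)) sequentially"
    by (intro uniform_lim_mult uniform_limit_const
        bounded_linear.uniform_limit[OF bounded_linear_cnj] taylor_uniform_limit[OF w nr(1)]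
        compact_imp_bounded compact_continuous_image continuous_intros cv
        dilate_continuous_sphere[OF w nr(1)]) auto
  have "(\<lambda>n. cmean (\<lambda>z. ?v z * cnj (\<Sum>k<n. taylor_coeff w k * of_real r ^ k * z ^ k)))
      \<longlonglongrightarrow> cmean (\<lambda>z. ?v z * cnj (?w z))"
    by (rule cmean_uniform_limit[OF u]) (auto intro!: continuous_intros cv)
  moreover have "cmean (\<lambda>z. ?v z * cnj (\<Sum>k<n. taylor_coeff w k * of_real r ^ k * z ^ k))
      = (\<Sum>k<n. taylor_coeff v k * cnj (taylor_coeff w k) * of_real (r ^ (2 * k)))" for n
  proof -
    have "cmean (\<lambda>z. ?v z * cnj (\<Sum>k<n. taylor_coeff w k * of_real r ^ k * z ^ k))
      = cmean (\<lambda>z. \<Sum>k<n. (cnj (taylor_coeff w k) * of_real r ^ k) * (?v z * cnj z ^ k))"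
      by (simp add: sum_distrib_left mult_ac)
    also have "\<dots> = (\<Sum>k<n. (cnj (taylor_coeff w k) * of_real r ^ k) * cmean (\<lambda>z. ?v z * cnj z ^ k))"
      by (subst cmean_sum, intro continuous_intros cv, subst cmean_cmult, intro continuous_intros cv, rule refl)
    also have "\<dots> = (\<Sum>k<n. (cnj (taylor_coeff w k) * of_real r ^ k) * (of_real r ^ k * taylor_coeff v k))"
      by (subst cmean_cnj_power[OF dilate_continuous[OF v nr(1)] dilate_holomorphic[OF v nr(2)]])
         (simp add: taylor_coeff_dilate[OF v nr(2)])
    finally show ?thesis by (simp add: mult_ac power_mult power2_eq_square power_mult_distrib)
  qed
  ultimately show ?thesis by (simp add: sums_def)
qed

lemma cmean_Parseval_norm:
  assumes v: "v holomorphic_on ball 0 1" and r: "0 \<le> r" "r < 1"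
  shows "(\<lambda>k. (norm (taylor_coeff v k))\<^sup>2 * r ^ (2 * k)) sums mean_square v r"
proof -
  have "circ_continuous (\<lambda>z. (norm (v (of_real r * z)))\<^sup>2)"
    using dilate_continuous_sphere[OF v, of "of_real r"] r by (intro continuous_intros) auto
  from cmean_of_real[OF this] cmean_Parseval[OF v v r]
  have "(\<lambda>k. complex_of_real ((norm (taylor_coeff v k))\<^sup>2 * r ^ (2 * k))) sums
    complex_of_real (mean_square v r)"
    by (simp add: complex_norm_square[symmetric] del: of_real_power)
  then show ?thesis by (simp only: sums_of_real_iff)
qed

text \<open>The mean over the circle of radius \<open>sqrt x\<close> is a power series \<open>A x\<close>, and Parseval identifies
  \<open>(x A')'\<close> with the mean of the Laplacian.\<close>

lemma submean_hermitian:
  fixes v w :: "'i \<Rightarrow> complex \<Rightarrow> complex"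
  assumes fin: "finite I"
    and v: "\<And>i. i \<in> I \<Longrightarrow> v i holomorphic_on ball 0 1"
    and w: "\<And>i. i \<in> I \<Longrightarrow> w i holomorphic_on ball 0 1"
    and pos: "\<And>z. norm z < 1 \<Longrightarrow> 0 \<le> Re (\<Sum>i\<in>I. deriv (v i) z * cnj (deriv (w i) z))"
    and r: "0 \<le> r" "r < 1"
  shows "Re (\<Sum>i\<in>I. v i 0 * cnj (w i 0))
       \<le> Re (cmean (\<lambda>z. \<Sum>i\<in>I. v i (of_real r * z) * cnj (w i (of_real r * z))))"
proof -
  define c where "c k = Re (\<Sum>i\<in>I. taylor_coeff (v i) k * cnj (taylor_coeff (w i) k))" for k
  have main: "(\<lambda>k. Re (\<Sum>i\<in>I. taylor_coeff (v i) k * cnj (taylor_coeff (w i) k)) * s ^ (2 * k)) sums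
      Re (cmean (\<lambda>z. \<Sum>i\<in>I. v i (of_real s * z) * cnj (w i (of_real s * z))))"
    if s: "0 \<le> s" "s < 1" and v: "\<And>i. i \<in> I \<Longrightarrow> v i holomorphic_on ball 0 1"
    and w: "\<And>i. i \<in> I \<Longrightarrow> w i holomorphic_on ball 0 1" for s and v w :: "'i \<Rightarrow> complex \<Rightarrow> complex"
  proof -
    have ns: "norm (complex_of_real s) < 1" using s by auto
    have "(\<lambda>k. \<Sum>i\<in>I. taylor_coeff (v i) k * cnj (taylor_coeff (w i) k) * of_real (s ^ (2 * k))) sums
        (\<Sum>i\<in>I. cmean (\<lambda>z. v i (of_real s * z) * cnj (w i (of_real s * z))))"
      by (intro sums_sum cmean_Parseval v w s)
    also have "(\<Sum>i\<in>I. cmean (\<lambda>z. v i (of_real s * z) * cnj (w i (of_real s * z))))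
       = cmean (\<lambda>z. \<Sum>i\<in>I. v i (of_real s * z) * cnj (w i (of_real s * z)))"
      by (rule cmean_sum[symmetric])
         (intro continuous_intros dilate_continuous_sphere[OF _ ns] v w; assumption)
    finally have "(\<lambda>k. (\<Sum>i\<in>I. taylor_coeff (v i) k * cnj (taylor_coeff (w i) k)) * of_real (s ^ (2 * k))) sums
       cmean (\<lambda>z. \<Sum>i\<in>I. v i (of_real s * z) * cnj (w i (of_real s * z)))"
      by (simp add: sum_distrib_right)
    moreover have "Re (a * of_real x) = Re a * x" for a x by simp
    ultimately show ?thesis using sums_Re by fastforce
  qed
  define A where "A x = (\<Sum>k. c k * x ^ k)" for x :: real
  define A' where "A' x = (\<Sum>k. diffs c k * x ^ k)" for x :: real
  \<comment> \<open>\<open>E\<close> is \<open>x * A' x\<close> and \<open>B\<close> is its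
    derivative. The coefficients of \<open>B\<close> are (k + 1)^2 c (k + 1), exactly the Parseval
    coefficients for the derivatives of \<open>v i\<close> and \<open>w i\<close>.\<close>
  define E where "E x = (\<Sum>k. (real k * c k) * x ^ k)" for x :: real
  define B where "B x = (\<Sum>k. diffs (\<lambda>k. real k * c k) k * x ^ k)" for x :: real
  have c_sums: "(\<lambda>k. c k * (s\<^sup>2) ^ k) sums
      Re (cmean (\<lambda>z. \<Sum>i\<in>I. v i (of_real s * z) * cnj (w i (of_real s * z))))" if "0 \<le> s" "s < 1" for s
    using main[OF that v w] by (simp add: c_def power_mult)
  have c_summable: "summable (\<lambda>k. c k * x ^ k)" if "\<bar>x\<bar> < 1" for x
  proof -
    obtain y where y: "\<bar>x\<bar> < y" "y < 1" using \<open>\<bar>x\<bar> < 1\<close> dense by blast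
    have "summable (\<lambda>k. c k * ((sqrt y)\<^sup>2) ^ k)"
      using c_sums[of "sqrt y"] y by (auto simp: sums_iff)
    then have "summable (\<lambda>k. c k * y ^ k)" using y by simp
    from powser_inside[OF this, of x] show ?thesis using y by simp
  qed
  have dA: "(A has_real_derivative A' x) (at x)" if "\<bar>x\<bar> < 1" for x
    unfolding A_def A'_def by (rule termdiffs_strong'[of 1]) (use c_summable that in auto)
  have E_eq: "(\<lambda>k. (real k * c k) * x ^ k) sums (x * A' x)" if "\<bar>x\<bar> < 1" for x
  proof -
    have "summable (\<lambda>k. diffs c k * x ^ k)"
      by (rule termdiff_converges[of _ 1]) (use c_summable that in auto)
    then have "(\<lambda>k. x * (diffs c k * x ^ k)) sums (x * A' x)"
      by (intro sums_mult) (simp add: A'_def summable_sums)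
    then have "(\<lambda>k. (real (Suc k) * c (Suc k)) * x ^ Suc k) sums (x * A' x)"
      by (simp add: diffs_def mult_ac)
    then show ?thesis by (subst (asm) sums_Suc_iff) simp
  qed
  have E: "E x = x * A' x" if "\<bar>x\<bar> < 1" for x
    using E_eq[OF that] by (simp add: E_def sums_iff)
  have dE: "(E has_real_derivative B x) (at x)" if "\<bar>x\<bar> < 1" for x
    unfolding E_def B_def by (rule termdiffs_strong'[of 1]) (use E_eq that in \<open>auto simp: sums_iff\<close>)
  have B_pos: "B x \<ge> 0" if x: "0 \<le> x" "x < 1" for x
  proof -
    define s where "s = sqrt x"
    have s: "0 \<le> s" "s < 1" "x = s\<^sup>2" using x by (auto simp: s_def)
    have ns: "norm (complex_of_real s) < 1" using s by auto
    let ?d = "\<lambda>z. \<Sum>i\<in>I. deriv (v i) (of_real s * z) * cnj (deriv (w i) (of_real s * z))"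
    have hol: "deriv (v i) holomorphic_on ball 0 1" "deriv (w i) holomorphic_on ball 0 1" if "i \<in> I" for i
      using v[OF that] w[OF that] by (auto intro!: holomorphic_deriv)
    have "(\<lambda>k. Re (\<Sum>i\<in>I. taylor_coeff (deriv (v i)) k * cnj (taylor_coeff (deriv (w i)) k)) * s ^ (2 * k)) sums
        Re (cmean ?d)"
      by (rule main[OF s(1,2) hol])
    also have "(\<lambda>k. Re (\<Sum>i\<in>I. taylor_coeff (deriv (v i)) k * cnj (taylor_coeff (deriv (w i)) k)) * s ^ (2 * k))
       = (\<lambda>k. diffs (\<lambda>k. real k * c k) k * x ^ k)"
      unfolding taylor_coeff_deriv diffs_def c_def s(3)
      by (simp add: sum_distrib_left algebra_simps del: of_nat_Suc flip: power_mult)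
    finally have "B x = Re (cmean ?d)"
      by (simp add: B_def sums_iff)
    also have "\<dots> = cmean (\<lambda>z. Re (?d z))"
      by (rule cmean_Re[symmetric]) (intro continuous_intros dilate_continuous_sphere[OF _ ns] hol; assumption)
    also have "\<dots> \<ge> 0"
    proof (rule cmean_nonneg)
      show "circ_continuous (\<lambda>z. Re (?d z))"
        by (intro continuous_intros dilate_continuous_sphere[OF _ ns] hol; assumption)
      show "0 \<le> Re (?d z)" if "norm z = 1" for z
        by (rule pos) (use disk_mult_le[OF ns, of z] that in auto)
    qed
    finally show ?thesis .
  qed
  have E_pos: "E x \<ge> 0" if x: "0 \<le> x" "x < 1" for x
  proof -
    have "E 0 \<le> E x"
      by (rule DERIV_nonneg_imp_nondecreasing[OF x(1)]) (use dE B_pos x in \<open>fastforce\<close>)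
    then show ?thesis using E[of 0] by simp
  qed
  have A_mono: "A 0 \<le> A x" if x: "0 \<le> x" "x < 1" for x
  \<comment> \<open>\<open>E y = y * A' y\<close> gives the sign of \<open>A' y\<close> only for
    \<open>y > 0\<close>, hence the criterion on the open interval with continuity at its
    ends.\<close>
  proof (rule DERIV_nonneg_imp_increasing_open[OF x(1)])
    fix y assume y: "0 < y" "y < x"
    then have "0 \<le> A' y" using E_pos[of y] E[of y] x by (simp add: zero_le_mult_iff)
    then show "\<exists>d. (A has_real_derivative d) (at y) \<and> 0 \<le> d" using dA[of y] y x by auto
  next
    show "continuous_on {0..x} A"
      by (rule DERIV_atLeastAtMost_imp_continuous_on) (intro exI, rule dA, use x in auto)
  qed
  have "A 0 \<le> A (r\<^sup>2)" using r by (intro A_mono) (auto simp: power_less_one_iff)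
  moreover have "A 0 = Re (\<Sum>i\<in>I. v i 0 * cnj (w i 0))"
    using powser_zero[of c] by (simp add: A_def c_def)
  moreover have "A (r\<^sup>2) = Re (cmean (\<lambda>z. \<Sum>i\<in>I. v i (of_real r * z) * cnj (w i (of_real r * z))))"
    using c_sums[OF r] by (simp add: A_def sums_iff)
  ultimately show ?thesis by simp
qed

section \<open>Factorization of Hardy space functions\<close>

text \<open>The function algebra for Stone-Weierstrass. Closure under \<open>cong\<close> is built
  in because a product of two real parts is again a sum of such real parts only on the circle, where
  \<open>cnj z\<close> is the inverse of \<open>z\<close>.\<close>

inductive_set trig_functions :: "(complex \<Rightarrow> real) set" where
  base: "(\<lambda>z. Re (c * z ^ k)) \<in> trig_functions"
| add: "f \<in> trig_functions \<Longrightarrow> g \<in> trig_functions \<Longrightarrow> (\<lambda>z. f z + g z) \<in> trig_functions"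
| cong: "f \<in> trig_functions \<Longrightarrow> (\<And>z. norm z = 1 \<Longrightarrow> f z = g z) \<Longrightarrow> g \<in> trig_functions"

lemma trig_functions_eq_Re:
  assumes "f \<in> trig_functions"
  shows "\<exists>P. P holomorphic_on UNIV \<and> (\<forall>z. norm z = 1 \<longrightarrow> f z = Re (P z))"
  using assms
proof induction
  case (base c k)
  show ?case by (rule exI[of _ "\<lambda>z. c * z ^ k"]) (auto intro!: holomorphic_intros)
next
  case (add f g)
  then obtain P Q where "P holomorphic_on UNIV" "\<forall>z. norm z = 1 \<longrightarrow> f z = Re (P z)"
    "Q holomorphic_on UNIV" "\<forall>z. norm z = 1 \<longrightarrow> g z = Re (Q z)" by blast
  then show ?case by (intro exI[of _ "\<lambda>z. P z + Q z"]) (auto intro!: holomorphic_intros)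
qed auto

text \<open>Re a Re b is half of Re (a b) plus half of Re (a cnj b). The second term becomes a pure
  power of \<open>z\<close> or of \<open>cnj z\<close> on the circle, and in the latter case its
  conjugate has the same real part.\<close>

lemma trig_functions_mult_base:
  assumes "f \<in> trig_functions"
  shows "(\<lambda>z. f z * Re (d * z ^ l)) \<in> trig_functions"
  using assms
proof induction
  case (base c k)
  have unit: "z ^ j * cnj z ^ j = 1" if "norm z = 1" for z :: complex and j
    using that by (simp add: complex_norm_square[symmetric] flip: power_mult_distrib)
  have ReRe: "Re a * Re b = Re ((1/2) * (a * b)) + Re ((1/2) * (a * cnj b))" for a b
    by (simp add: field_simps)
  have split: "(1/2) * ((c * z ^ k) * cnj (d * z ^ l)) = ((1/2) * c * cnj d) * (z ^ k * cnj z ^ l)" for z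
    by (simp add: mult_ac)
  have prod: "\<exists>b m. \<forall>z. norm z = 1 \<longrightarrow> Re ((1/2) * ((c * z ^ k) * cnj (d * z ^ l))) = Re (b * z ^ m)"
  proof (cases "l \<le> k")
    case True
    have "z ^ k * cnj z ^ l = z ^ (k - l)" if "norm z = 1" for z
    proof -
      have "z ^ k = z ^ (k - l) * z ^ l" using True by (simp flip: power_add)
      then show ?thesis using unit[OF that, of l] by (simp add: mult.assoc)
    qed
    then have "\<forall>z. norm z = 1 \<longrightarrow> Re ((1/2) * ((c * z ^ k) * cnj (d * z ^ l))) = Re (((1/2) * c * cnj d) * z ^ (k - l))"
      unfolding split by simp
    then show ?thesis by blast
  next
    case False
    have "z ^ k * cnj z ^ l = cnj z ^ (l - k)" if "norm z = 1" for z
    proof -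
      have "cnj z ^ l = cnj z ^ k * cnj z ^ (l - k)" using False by (simp flip: power_add)
      then show ?thesis using unit[OF that, of k] by (simp flip: mult.assoc)
    qed
    then have "(1/2) * ((c * z ^ k) * cnj (d * z ^ l)) = cnj (((1/2) * cnj c * d) * z ^ (l - k))"
      if "norm z = 1" for z
      using that unfolding split by simp
    then have "\<forall>z. norm z = 1 \<longrightarrow> Re ((1/2) * ((c * z ^ k) * cnj (d * z ^ l))) = Re (((1/2) * cnj c * d) * z ^ (l - k))"
      by (metis complex_cnj_cnj cnj.sel(1))
    then show ?thesis by blast
  qed
  then obtain b m where b: "\<And>z. norm z = 1 \<Longrightarrow> Re ((1/2) * ((c * z ^ k) * cnj (d * z ^ l))) = Re (b * z ^ m)"
    by blast
  have "(\<lambda>z. Re (((1/2) * c * d) * z ^ (k + l)) + Re (b * z ^ m)) \<in> trig_functions"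
    by (intro trig_functions.add trig_functions.base)
  then show ?case
  proof (rule trig_functions.cong)
    fix z :: complex assume z: "norm z = 1"
    show "Re (((1/2) * c * d) * z ^ (k + l)) + Re (b * z ^ m) = Re (c * z ^ k) * Re (d * z ^ l)"
      unfolding ReRe b[OF z] by (simp add: power_add mult_ac)
  qed
next
  case (add f g)
  then show ?case using trig_functions.add by (simp add: distrib_right)
next
  case (cong f g)
  then show ?case by (auto intro: trig_functions.cong)
qed

lemma trig_functions_mult:
  assumes "g \<in> trig_functions" "f \<in> trig_functions"
  shows "(\<lambda>z. f z * g z) \<in> trig_functions"
  using assms
proof induction
  case (base c k)
  then show ?case by (rule trig_functions_mult_base)
next
  case (add f g)
  then show ?case using trig_functions.add by (simp add: distrib_left)
next
  case (cong f g)
  then show ?case by (auto intro: trig_functions.cong)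
qed

text \<open>Takes the place of solving the Dirichlet problem: the approximant comes with its
  harmonic conjugate, so its exponential is at once a zero-free holomorphic function.\<close>

lemma approx_by_Re_holomorphic:
  assumes "circ_continuous u" "e > 0"
  shows "\<exists>P. P holomorphic_on UNIV \<and> (\<forall>z. norm z = 1 \<longrightarrow> \<bar>u z - Re (P z)\<bar> < e)"
proof -
  interpret function_ring_on trig_functions "sphere 0 1"
  proof
    fix f assume "f \<in> trig_functions"
    then show "circ_continuous f"
    proof induction
      case (cong f g)
      then show ?case by (subst continuous_on_cong[OF refl, of _ g f]) auto
    qed (auto intro!: continuous_intros)
  next
    fix x y :: complex assume "x \<noteq> y"
    then have "Re (1 * x ^ 1) \<noteq> Re (1 * y ^ 1) \<or> Re (\<i> * x ^ 1) \<noteq> Re (\<i> * y ^ 1)"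
      by (auto simp: complex_eq_iff)
    then show "\<exists>f\<in>trig_functions. f x \<noteq> f y"
      by (elim disjE) (rule bexI[OF _ trig_functions.base]; assumption)+
  next
    fix c :: real
    show "(\<lambda>_. c) \<in> trig_functions"
      using trig_functions.base[of "of_real c" 0] by simp
  qed (auto intro: trig_functions.add trig_functions_mult)
  obtain g where "g \<in> trig_functions" "\<forall>x\<in>sphere 0 1. \<bar>u x - g x\<bar> < e"
    using Stone_Weierstrass_basic[OF assms] by blast
  with trig_functions_eq_Re[of g] show ?thesis by auto
qed

text \<open>A zero-free factor with prescribed modulus on a circle is \<open>exp (P / 2)\<close> with \<open>Re P\<close> close to the
  logarithm of that modulus, so no Blaschke products are needed.\<close>

lemma circle_factorization:
  assumes F: "F holomorphic_on ball 0 1" and r: "0 < r" "r < 1" and d: "d > 0"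
  obtains g E where "g holomorphic_on ball 0 1" "E holomorphic_on ball 0 1"
    "\<And>z. F z = g z * E z"
    "\<And>z. norm z = 1 \<Longrightarrow> (norm (g (of_real r * z)))\<^sup>2 \<le> norm (F (of_real r * z))"
    "\<And>z. norm z = 1 \<Longrightarrow> (norm (E (of_real r * z)))\<^sup>2 \<le> norm (F (of_real r * z)) + d"
proof -
  have nr: "norm (complex_of_real r) < 1" using r by auto
  have cF: "circ_continuous (\<lambda>z. F (of_real r * z))"
    by (rule dilate_continuous_sphere[OF F nr])
  let ?F = "\<lambda>z. norm (F (of_real r * z))"
  \<comment> \<open>The desired value ln |F| is infinite at zeros of \<open>F\<close>, so the target
    is a band between two shifted logarithms. Staying above \<open>l\<close> makes |E|^2 at least
    |F| and thus |g|^2 at most |F|; staying below \<open>h\<close> bounds |E|^2 by |F| + d.\<close>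
  define l where "l z = ln (?F z + d / 2)" for z
  define h where "h z = ln (?F z + d)" for z
  have pos: "?F z + d / 2 > 0" "?F z + d > 0" for z
    using d norm_ge_zero[of "F (of_real r * z)"] by linarith+
  have cl: "circ_continuous l" "circ_continuous h"
    unfolding l_def h_def using pos by (auto intro!: continuous_intros cF simp: less_imp_neq[symmetric])
  have "sphere (0::complex) 1 \<noteq> {}" by simp
  then obtain z0 where z0: "z0 \<in> sphere 0 1" "\<And>z. z \<in> sphere 0 1 \<Longrightarrow> h z0 - l z0 \<le> h z - l z"
    using continuous_attains_inf[of "sphere 0 1" "\<lambda>z. h z - l z"] cl
    by (metis compact_sphere continuous_on_diff)
  have gap: "h z0 - l z0 > 0" using pos[of z0] d by (simp add: h_def l_def)
  \<comment> \<open>By compactness the band has a positive minimal width, attained at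
    \<open>z0\<close>; approximating its midline to within half that width stays inside
    everywhere.\<close>
  obtain P where P: "P holomorphic_on UNIV"
      and P2: "\<And>z. norm z = 1 \<Longrightarrow> \<bar>(l z + h z) / 2 - Re (P z)\<bar> < (h z0 - l z0) / 2"
    using approx_by_Re_holomorphic[of "\<lambda>z. (l z + h z) / 2" "(h z0 - l z0) / 2"] gap cl
    by (force intro: continuous_intros)
  have bd: "l z \<le> Re (P z)" "Re (P z) \<le> h z" if "norm z = 1" for z
    using P2[OF that] z0(2)[of z] that by (auto simp: abs_if field_simps split: if_splits)
  \<comment> \<open>Division by \<open>r\<close> moves the prescribed values from the unit circle to
    the circle of radius \<open>r\<close>.\<close>
  define E where "E z = exp (P (z / of_real r) / 2)" for z
  define g where "g z = F z / E z" for z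
  let ?E = "\<lambda>z. (norm (E (of_real r * z)))\<^sup>2"
  have normE: "?E z = exp (Re (P z))" for z
    using r by (simp add: E_def power2_eq_square flip: exp_add)
  have lo: "?F z + d / 2 \<le> ?E z" if "norm z = 1" for z
  proof -
    have "exp (l z) \<le> exp (Re (P z))" using bd(1)[OF that] by simp
    then show ?thesis using pos[of z] by (simp add: normE l_def)
  qed
  have hi: "?E z \<le> ?F z + d" if "norm z = 1" for z
    using bd(2)[OF that] pos[of z] by (simp add: normE h_def ln_ge_iff)
  have "(\<lambda>z. z / of_real r) holomorphic_on UNIV"
    using r by (intro holomorphic_intros) auto
  from holomorphic_on_compose_gen[OF this P]
  have "(\<lambda>z. P (z / of_real r)) holomorphic_on UNIV" by (simp add: o_def)
  then have hE: "E holomorphic_on A" for A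
    unfolding E_def by (auto intro!: holomorphic_intros intro: holomorphic_on_subset)
  have nz: "E z \<noteq> 0" for z by (simp add: E_def)
  show ?thesis
  proof
    show "g holomorphic_on ball 0 1" unfolding g_def by (intro holomorphic_intros F hE nz)
    show "F z = g z * E z" for z using nz by (simp add: g_def)
    fix z :: complex assume z: "norm z = 1"
    show "(norm (g (of_real r * z)))\<^sup>2 \<le> ?F z"
    proof -
      have "(?F z)\<^sup>2 \<le> ?F z * ?E z"
        unfolding power2_eq_square[of "norm (F _)"] using lo[OF z] d by (intro mult_left_mono) auto
      then show ?thesis using nz[of "of_real r * z"]
        by (simp add: g_def norm_divide power_divide divide_le_eq)
    qed
    show "?E z \<le> ?F z + d" by (rule hi[OF z])
  qed (rule hE)
qed

section \<open>Consequences of bounded mean squares\<close>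

lemma cmean_norm_square_mono:
  assumes v: "v holomorphic_on ball 0 1" and r: "0 \<le> s" "s \<le> r" "r < 1"
  shows "mean_square v s \<le> mean_square v r"
  by (rule sums_le[OF _ cmean_Parseval_norm[OF v] cmean_Parseval_norm[OF v]])
     (use r in \<open>auto intro!: mult_left_mono power_mono\<close>)

lemma tendsto_at_left_le:
  fixes f :: "real \<Rightarrow> real"
  assumes "(f \<longlongrightarrow> L) (at_left 1)" "\<And>s. 0 \<le> s \<Longrightarrow> s < 1 \<Longrightarrow> f s \<le> M"
  shows "L \<le> M"
proof (rule tendsto_upperbound[OF assms(1)])
  have "\<forall>\<^sub>F s in at_left (1::real). s \<in> {0<..<1}" by (rule eventually_at_left_real) simp
  then show "\<forall>\<^sub>F s in at_left 1. f s \<le> M" by eventually_elim (use assms(2) in auto)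
qed simp

lemma sum_taylor_coeff_square_le:
  assumes v: "v holomorphic_on ball 0 1"
    and M: "\<And>s. 0 \<le> s \<Longrightarrow> s < 1 \<Longrightarrow> mean_square v s \<le> M"
    and "finite K"
  shows "(\<Sum>k\<in>K. (norm (taylor_coeff v k))\<^sup>2) \<le> M"
proof -
  let ?a = "\<lambda>k. (norm (taylor_coeff v k))\<^sup>2"
  have "((\<lambda>s. \<Sum>k\<in>K. ?a k * s ^ (2 * k)) \<longlongrightarrow>
      (\<Sum>k\<in>K. ?a k * 1 ^ (2 * k))) (at_left 1)"
    by (intro tendsto_intros)
  then have "(\<Sum>k\<in>K. ?a k * 1 ^ (2 * k)) \<le> M"
  proof (rule tendsto_at_left_le)
    fix s :: real assume s: "0 \<le> s" "s < 1"
    have sm: "(\<lambda>k. ?a k * s ^ (2 * k)) sums mean_square v s"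
      by (rule cmean_Parseval_norm[OF v s])
    have "(\<Sum>k\<in>K. ?a k * s ^ (2 * k)) \<le> (\<Sum>k. ?a k * s ^ (2 * k))"
      by (rule sum_le_suminf) (use sm s assms(3) in \<open>auto simp: sums_iff\<close>)
    also have "\<dots> \<le> M" using sm M[OF s] by (simp add: sums_iff)
    finally show "(\<Sum>k\<in>K. ?a k * s ^ (2 * k)) \<le> M" .
  qed
  then show ?thesis by simp
qed

lemma summable_taylor_coeff_square:
  assumes v: "v holomorphic_on ball 0 1"
    and M: "\<And>s. 0 \<le> s \<Longrightarrow> s < 1 \<Longrightarrow> mean_square v s \<le> M"
  shows "summable (\<lambda>k. (norm (taylor_coeff v k))\<^sup>2)"
  by (rule summableI_nonneg_bounded[of _ M], simp, rule sum_taylor_coeff_square_le[OF assms]) simp_all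

text \<open>Parseval bounds every Taylor coefficient by \<open>sqrt M\<close>, and a geometric
  series does the rest. This supplies the local boundedness for Montel's theorem.\<close>

lemma norm_bound_of_mean_square:
  assumes v: "v holomorphic_on ball 0 1"
    and M: "\<And>s. 0 \<le> s \<Longrightarrow> s < 1 \<Longrightarrow> mean_square v s \<le> M"
    and z: "norm z \<le> s" "s < 1"
  shows "norm (v z) \<le> sqrt M / (1 - s)"
proof -
  have M0: "M \<ge> 0" using sum_taylor_coeff_square_le[OF v M, of "{}"] by simp
  have a: "norm (taylor_coeff v k) \<le> sqrt M" for k
    using sum_taylor_coeff_square_le[OF v M, of "{k}"] by (simp add: real_le_rsqrt)
  have nz: "norm z < 1" using z by simp
  have sm: "summable (\<lambda>k. norm (taylor_coeff v k * z ^ k))"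
    by (rule taylor_coeff_abs_summable[OF v nz])
  have "norm (v z) \<le> (\<Sum>k. norm (taylor_coeff v k * z ^ k))"
    using summable_norm[OF sm] taylor_coeff_sums[OF v nz] by (simp add: sums_iff)
  also have "\<dots> \<le> (\<Sum>k. sqrt M * s ^ k)"
  proof (rule suminf_le[OF _ sm])
    have s: "norm s < 1" using order_trans[OF norm_ge_zero z(1)] z(2) by simp
    show "summable (\<lambda>k. sqrt M * s ^ k)"
      by (intro summable_mult summable_geometric s)
    show "norm (taylor_coeff v k * z ^ k) \<le> sqrt M * s ^ k" for k
      unfolding norm_mult norm_power by (intro mult_mono a power_mono z) (auto simp: M0)
  qed
  also have "\<dots> = sqrt M / (1 - s)"
  proof -
    have s: "norm s < 1" using order_trans[OF norm_ge_zero z(1)] z(2) by simp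
    show ?thesis by (simp add: suminf_mult[OF summable_geometric[OF s]] suminf_geometric[OF s])
  qed
  finally show ?thesis .
qed

text \<open>A circle of radius below 1 is compact in the disk, so a locally uniform limit passes
  through the mean; Montel limits thus inherit the bounds.\<close>

lemma mean_square_limit_le:
  assumes u: "\<And>K. compact K \<Longrightarrow> K \<subseteq> ball 0 1 \<Longrightarrow> uniform_limit K f g sequentially"
    and f: "\<And>n. f n holomorphic_on ball 0 1"
    and g: "g holomorphic_on ball 0 1"
    and M: "\<And>n. cmean (\<lambda>z. (norm (f n (of_real s * z)))\<^sup>2) \<le> M"
    and s: "0 \<le> s" "s < 1"
  shows "mean_square g s \<le> M"
proof -
  have ns: "norm (complex_of_real s) < 1" using s by auto
  have u1: "uniform_limit (sphere 0 1) (\<lambda>n z. f n (of_real s * z)) (\<lambda>z. g (of_real s * z)) sequentially"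
    by (rule uniform_limit_compose'[OF u[of "cball 0 s"]]) (use s in \<open>auto simp: norm_mult\<close>)
  have b: "bounded ((\<lambda>z. norm (g (of_real s * z))) ` sphere 0 1)"
    by (intro compact_imp_bounded compact_continuous_image continuous_intros dilate_continuous_sphere[OF g ns]) auto
  have "uniform_limit (sphere 0 1) (\<lambda>n z. norm (f n (of_real s * z)) * norm (f n (of_real s * z)))
        (\<lambda>z. norm (g (of_real s * z)) * norm (g (of_real s * z))) sequentially"
    by (intro uniform_lim_mult uniform_limit_norm u1 b)
  then have u2: "uniform_limit (sphere 0 1) (\<lambda>n z. (norm (f n (of_real s * z)))\<^sup>2)
        (\<lambda>z. (norm (g (of_real s * z)))\<^sup>2) sequentially"
    by (simp add: power2_eq_square)
  have "(\<lambda>n. cmean (\<lambda>z. (norm (f n (of_real s * z)))\<^sup>2)) \<longlonglongrightarrow> mean_square g s"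
    by (rule cmean_uniform_limit[OF u2]) (auto intro!: continuous_intros dilate_continuous_sphere[OF f ns])
  then show ?thesis by (rule LIMSEQ_le_const2) (use M in auto)
qed

text \<open>A factorization adapted to the circle of radius \<open>r n\<close> is rescaled to the
  unit disk. The factors have mean squares at most \<open>B + 1\<close> uniformly in
  \<open>n\<close>, where the 1 is the slack of \<open>circle_factorization\<close>, so Montel's
  theorem gives limits whose product is \<open>F\<close>.\<close>

lemma Hardy_factorization:
  assumes F: "F holomorphic_on ball 0 1"
    and B: "\<And>s. 0 \<le> s \<Longrightarrow> s < 1 \<Longrightarrow> mean_norm F s \<le> B"
  obtains u v where "u holomorphic_on ball 0 1" "v holomorphic_on ball 0 1"
    "\<And>z. norm z < 1 \<Longrightarrow> F z = u z * v z"
    "\<And>s. 0 \<le> s \<Longrightarrow> s < 1 \<Longrightarrow> mean_square u s \<le> B + 1"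
    "\<And>s. 0 \<le> s \<Longrightarrow> s < 1 \<Longrightarrow> mean_square v s \<le> B + 1"
proof -
  define r :: "nat \<Rightarrow> real" where "r n = 1 - 1 / (real n + 2)" for n
  have r: "0 < r n" "r n < 1" for n by (auto simp: r_def field_simps)
  have r_lim: "r \<longlonglongrightarrow> 1" unfolding r_def by real_asymp
  have nr: "norm (complex_of_real (r n)) < 1" "norm (complex_of_real (r n)) \<le> 1" for n
    using r[of n] by auto
  define H where "H = {f. f holomorphic_on ball 0 1 \<and>
     (\<forall>s. 0 \<le> s \<and> s < 1 \<longrightarrow> mean_square f s \<le> B + 1)}"
  have "\<exists>g E. g \<in> H \<and> E \<in> H \<and> (\<forall>z. F (of_real (r n) * z) = g z * E z)" for n
  proof -
    obtain g E where gE: "g holomorphic_on ball 0 1" "E holomorphic_on ball 0 1"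
      "\<And>z. F z = g z * E z"
      "\<And>z. norm z = 1 \<Longrightarrow> (norm (g (of_real (r n) * z)))\<^sup>2 \<le> norm (F (of_real (r n) * z))"
      "\<And>z. norm z = 1 \<Longrightarrow> (norm (E (of_real (r n) * z)))\<^sup>2 \<le> norm (F (of_real (r n) * z)) + 1"
      by (rule circle_factorization[OF F r[of n], of 1]) auto
    have "(\<lambda>z. f (of_real (r n) * z)) \<in> H" if f: "f holomorphic_on ball 0 1"
      and b: "\<And>z. norm z = 1 \<Longrightarrow> (norm (f (of_real (r n) * z)))\<^sup>2 \<le> norm (F (of_real (r n) * z)) + 1" for f
    proof -
      have "cmean (\<lambda>z. (norm (f (of_real (r n) * (of_real s * z))))\<^sup>2) \<le> B + 1" if s: "0 \<le> s" "s < 1" for s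
      proof -
        \<comment> \<open>Mean squares grow with the radius, so control on the single circle of
          radius \<open>r n\<close> is enough.\<close>
        have "cmean (\<lambda>z. (norm (f (of_real (r n * s) * z)))\<^sup>2) \<le> cmean (\<lambda>z. (norm (f (of_real (r n) * z)))\<^sup>2)"
          by (rule cmean_norm_square_mono[OF f]) (use s r[of n] in \<open>auto simp: mult_le_cancel_left2\<close>)
        also have "\<dots> \<le> cmean (\<lambda>z. norm (F (of_real (r n) * z)) + 1)"
          by (rule cmean_mono) (auto intro!: continuous_intros dilate_continuous_sphere[OF _ nr(1)] f F b)
        also have "\<dots> = cmean (\<lambda>z. norm (F (of_real (r n) * z))) + 1"
          by (subst cmean_add) (auto intro!: continuous_intros dilate_continuous_sphere[OF _ nr(1)] F)
        also have "\<dots> \<le> B + 1" using B[of "r n"] r[of n] by simp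
        finally show ?thesis by (simp add: mult.assoc)
      qed
      then show ?thesis unfolding H_def using dilate_holomorphic[OF f nr(2)] by auto
    qed
    from this[OF gE(1) add_increasing2[OF zero_le_one gE(4)]] this[OF gE(2,5)] gE(3)
    show ?thesis
      by (intro exI[of _ "\<lambda>z. g (of_real (r n) * z)"] exI[of _ "\<lambda>z. E (of_real (r n) * z)"]) simp
  qed
  then obtain g E where gE: "\<And>n. g n \<in> H" "\<And>n. E n \<in> H" "\<And>n z. F (of_real (r n) * z) = g n z * E n z"
    by metis
  have bounded: "\<exists>B. \<forall>h\<in>H. \<forall>z\<in>K. norm (h z) \<le> B" if K: "compact K" "K \<subseteq> ball 0 1" for K :: "complex set"
  proof -
    obtain s where s: "s < 1" "\<And>z. z \<in> K \<Longrightarrow> norm z \<le> s"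
    proof (cases "K = {}")
      case False
      obtain x where "x \<in> K" "\<And>y. y \<in> K \<Longrightarrow> norm y \<le> norm x"
        using continuous_attains_sup[OF K(1) False, of norm] by (auto intro: continuous_intros)
      then show ?thesis using K(2) that[of "norm x"] by auto
    qed (use that[of 0] in auto)
    have "norm (h z) \<le> sqrt (B + 1) / (1 - s)" if "h \<in> H" "z \<in> K" for h z
      using that s by (intro norm_bound_of_mean_square) (auto simp: H_def)
    then show ?thesis by blast
  qed
  have holH: "h holomorphic_on ball 0 1" if "h \<in> H" for h using that by (simp add: H_def)
  obtain u a where u: "u holomorphic_on ball 0 1" and a: "strict_mono (a :: nat \<Rightarrow> nat)"
      and u1: "\<And>x. x \<in> ball 0 1 \<Longrightarrow> (\<lambda>n. g (a n) x) \<longlonglongrightarrow> u x"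
      and u2: "\<And>K. compact K \<Longrightarrow> K \<subseteq> ball 0 1 \<Longrightarrow> uniform_limit K (g \<circ> a) u sequentially"
    by (rule Montel[OF open_ball holH bounded, of g]) (use gE(1) in blast)+
  \<comment> \<open>The second subsequence is extracted from the first, so that both factors
    converge along it.\<close>
  obtain v b where v: "v holomorphic_on ball 0 1" and b: "strict_mono (b :: nat \<Rightarrow> nat)"
      and v1: "\<And>x. x \<in> ball 0 1 \<Longrightarrow> (\<lambda>n. (E \<circ> a) (b n) x) \<longlonglongrightarrow> v x"
      and v2: "\<And>K. compact K \<Longrightarrow> K \<subseteq> ball 0 1 \<Longrightarrow> uniform_limit K ((E \<circ> a) \<circ> b) v sequentially"
    by (rule Montel[OF open_ball holH bounded, of "E \<circ> a"]) (use gE(2) in auto)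
  show ?thesis
  proof
    fix z :: complex assume z: "norm z < 1"
    have "(\<lambda>n. g (a (b n)) z * E (a (b n)) z) \<longlonglongrightarrow> u z * v z"
      using LIMSEQ_subseq_LIMSEQ[OF u1 b, of z] v1[of z] z by (intro tendsto_mult) (auto simp: o_def)
    moreover have "(\<lambda>n. F (of_real (r (a (b n))) * z)) \<longlonglongrightarrow> F (of_real 1 * z)"
    proof (rule isCont_tendsto_compose[of _ F])
      show "isCont F (of_real 1 * z)"
        using holomorphic_on_imp_continuous_on[OF F] z by (simp add: continuous_on_eq_continuous_at)
      have "(\<lambda>n. r (a (b n))) \<longlonglongrightarrow> 1"
        using LIMSEQ_subseq_LIMSEQ[OF LIMSEQ_subseq_LIMSEQ[OF r_lim a] b] by (simp add: o_def)
      then show "(\<lambda>n. of_real (r (a (b n))) * z) \<longlonglongrightarrow> of_real 1 * z" by (intro tendsto_intros)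
    qed
    ultimately show "F z = u z * v z" using LIMSEQ_unique by (simp add: gE(3)) blast
  next
    fix s :: real assume s: "0 \<le> s" "s < 1"
    show "mean_square u s \<le> B + 1"
      by (rule mean_square_limit_le[OF u2 _ u]) (use gE(1) s in \<open>auto simp: H_def\<close>)
    show "mean_square v s \<le> B + 1"
      by (rule mean_square_limit_le[OF v2 _ v]) (use gE(2) s in \<open>auto simp: H_def\<close>)
  qed (fact u v)+
qed

section \<open>Approximation by polynomials in the Hardy space \<open>H\<^sup>1\<close>\<close>

lemma mean_square_le_suminf:
  assumes v: "v holomorphic_on ball 0 1"
    and b: "summable b" "\<And>k. (norm (taylor_coeff v k))\<^sup>2 \<le> b k" and s: "0 \<le> s" "s < 1"
  shows "mean_square v s \<le> suminf b"
proof (rule sums_le[OF _ cmean_Parseval_norm[OF v s] summable_sums[OF b(1)]])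
  fix k
  have "(norm (taylor_coeff v k))\<^sup>2 * s ^ (2 * k) \<le> (norm (taylor_coeff v k))\<^sup>2 * 1"
    using s by (intro mult_left_mono power_le_one) auto
  then show "(norm (taylor_coeff v k))\<^sup>2 * s ^ (2 * k) \<le> b k" using b(2)[of k] by simp
qed

lemma taylor_coeff_poly: "taylor_coeff (poly p) k = poly.coeff p k"
  using taylor_coeff_polynomial[where n = "Polynomial.degree p" and c = "poly.coeff p" and j = k]
  by (simp add: poly_altdef[abs_def] coeff_eq_0)

lemma holomorphic_on_poly [holomorphic_intros]: "poly p holomorphic_on A"
  unfolding poly_altdef[abs_def] by (intro holomorphic_intros)

text \<open>\<open>p\<close> is a Taylor polynomial and the error is a Parseval tail. The second
  conclusion, that truncation does not increase the mean square, is needed when a product of two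
  functions is approximated.\<close>

lemma mean_square_poly_approx:
  assumes v: "v holomorphic_on ball 0 1"
    and M: "\<And>s. 0 \<le> s \<Longrightarrow> s < 1 \<Longrightarrow> mean_square v s \<le> M"
    and e: "e > 0"
  obtains p where
    "\<And>s. 0 \<le> s \<Longrightarrow> s < 1 \<Longrightarrow> cmean (\<lambda>z. (norm (v (of_real s * z) - poly p (of_real s * z)))\<^sup>2) \<le> e"
    "\<And>s. 0 \<le> s \<Longrightarrow> s < 1 \<Longrightarrow> cmean (\<lambda>z. (norm (poly p (of_real s * z)))\<^sup>2) \<le> M"
proof -
  let ?a = "\<lambda>k. (norm (taylor_coeff v k))\<^sup>2"
  have sm: "summable ?a" by (rule summable_taylor_coeff_square[OF v M])
  obtain N where N: "norm (\<Sum>k. ?a (k + N)) < e"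
    using suminf_exist_split[OF e sm] by blast
  define p where "p = (\<Sum>k<N. monom (taylor_coeff v k) k)"
  have coeff_p: "poly.coeff p k = (if k < N then taylor_coeff v k else 0)" for k
    by (simp add: p_def coeff_sum if_distrib sum.delta cong: if_cong)
  define b where "b k = (if k < N then 0 else ?a k)" for k
  have sb: "summable b"
    by (rule summable_comparison_test[OF _ sm]) (auto simp: b_def)
  have "suminf b = (\<Sum>k. b (k + N)) + (\<Sum>k<N. b k)"
    by (rule suminf_split_initial_segment[OF sb])
  also have "\<dots> \<le> e" using N by (simp add: b_def)
  finally have sum_b: "suminf b \<le> e" .
  show ?thesis
  proof
    fix s :: real assume s: "0 \<le> s" "s < 1"
    have "cmean (\<lambda>z. (norm ((\<lambda>z. v z - poly p z) (of_real s * z)))\<^sup>2) \<le> suminf b"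
      by (rule mean_square_le_suminf[OF _ sb _ s])
         (auto intro!: holomorphic_intros v simp: taylor_coeff_diff[OF v] taylor_coeff_poly coeff_p b_def holomorphic_on_poly)
    then show "cmean (\<lambda>z. (norm (v (of_real s * z) - poly p (of_real s * z)))\<^sup>2) \<le> e"
      using sum_b by simp
    have "(\<lambda>k. (norm (taylor_coeff (poly p) k))\<^sup>2 * s ^ (2 * k)) sums
        cmean (\<lambda>z. (norm (poly p (of_real s * z)))\<^sup>2)"
      by (rule cmean_Parseval_norm[OF holomorphic_on_poly s])
    then have "cmean (\<lambda>z. (norm (poly p (of_real s * z)))\<^sup>2) \<le> mean_square v s"
      by (rule sums_le[rotated, OF _ cmean_Parseval_norm[OF v s]])
         (use s in \<open>auto simp: taylor_coeff_poly coeff_p\<close>)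
    then show "cmean (\<lambda>z. (norm (poly p (of_real s * z)))\<^sup>2) \<le> M" using M[OF s] by simp
  qed
qed

lemma cmean_mult_le_sqrt:
  fixes F G :: "complex \<Rightarrow> real"
  assumes F: "circ_continuous F" and G: "circ_continuous G"
    and "cmean (\<lambda>z. (F z)\<^sup>2) \<le> A" "cmean (\<lambda>z. (G z)\<^sup>2) \<le> B"
  shows "cmean (\<lambda>z. F z * G z) \<le> sqrt (A * B)"
proof (rule real_le_rsqrt)
  have "(cmean (\<lambda>z. F z * G z))\<^sup>2 \<le> cmean (\<lambda>z. (F z)\<^sup>2) * cmean (\<lambda>z. (G z)\<^sup>2)"
    by (rule cmean_Cauchy_Schwarz[OF F G])
  also have "\<dots> \<le> A * B"
    by (intro mult_mono assms order_trans[OF cmean_nonneg assms(3)] cmean_nonneg)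
       (auto intro!: continuous_intros F G)
  finally show "(cmean (\<lambda>z. F z * G z))\<^sup>2 \<le> A * B" .
qed

text \<open>Taylor polynomials of \<open>F\<close> itself can diverge in the mean, so the factors
  are truncated instead: u v - p q = (u - p) v + p (v - q), with Cauchy-Schwarz for each
  summand.\<close>

lemma mean_poly_approx:
  assumes F: "F holomorphic_on ball 0 1"
    and B: "\<And>s. 0 \<le> s \<Longrightarrow> s < 1 \<Longrightarrow> mean_norm F s \<le> B"
    and e: "e > 0"
  obtains p where
    "\<And>s. 0 \<le> s \<Longrightarrow> s < 1 \<Longrightarrow> cmean (\<lambda>z. norm (F (of_real s * z) - poly p (of_real s * z))) \<le> e"
proof -
  obtain u v where uv: "u holomorphic_on ball 0 1" "v holomorphic_on ball 0 1"
    "\<And>z. norm z < 1 \<Longrightarrow> F z = u z * v z"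
    and Mu: "\<And>s. 0 \<le> s \<Longrightarrow> s < 1 \<Longrightarrow> mean_square u s \<le> B + 1"
    and Mv: "\<And>s. 0 \<le> s \<Longrightarrow> s < 1 \<Longrightarrow> mean_square v s \<le> B + 1"
    by (rule Hardy_factorization[OF F B]) auto
  have B0: "B \<ge> 0" using order_trans[OF norm_ge_zero[of "F 0"]] B[of 0] by simp
  \<comment> \<open>Chosen so that each Cauchy-Schwarz term \<open>sqrt (d * (B + 1))\<close> equals
    \<open>e / 2\<close>.\<close>
  define d where "d = e\<^sup>2 / (4 * (B + 1))"
  have d: "d > 0" using e B0 by (simp add: d_def)
  have sq: "sqrt (d * (B + 1)) = e / 2" "sqrt ((B + 1) * d) = e / 2"
  proof -
    have "d * (B + 1) = (e / 2)\<^sup>2" using B0 by (simp add: d_def power_divide field_simps)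
    then show "sqrt (d * (B + 1)) = e / 2" "sqrt ((B + 1) * d) = e / 2"
      using e by (simp_all add: mult.commute[of "B + 1"] del: power_divide)
  qed
  obtain p where p: "\<And>s. 0 \<le> s \<Longrightarrow> s < 1 \<Longrightarrow> cmean (\<lambda>z. (norm (u (of_real s * z) - poly p (of_real s * z)))\<^sup>2) \<le> d"
    "\<And>s. 0 \<le> s \<Longrightarrow> s < 1 \<Longrightarrow> cmean (\<lambda>z. (norm (poly p (of_real s * z)))\<^sup>2) \<le> B + 1"
    by (rule mean_square_poly_approx[OF uv(1) Mu d]) auto
  obtain q where q: "\<And>s. 0 \<le> s \<Longrightarrow> s < 1 \<Longrightarrow> cmean (\<lambda>z. (norm (v (of_real s * z) - poly q (of_real s * z)))\<^sup>2) \<le> d"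
    by (rule mean_square_poly_approx[OF uv(2) Mv d]) auto
  show ?thesis
  proof
    fix s :: real assume s: "0 \<le> s" "s < 1"
    have ns: "norm (complex_of_real s) < 1" using s by auto
    let ?U = "\<lambda>z. u (of_real s * z)" and ?V = "\<lambda>z. v (of_real s * z)"
      and ?P = "\<lambda>z. poly p (of_real s * z)" and ?Q = "\<lambda>z. poly q (of_real s * z)"
    have c: "circ_continuous ?U" "circ_continuous ?V"
      "circ_continuous ?P" "circ_continuous ?Q"
      by (intro dilate_continuous_sphere[OF _ ns] uv holomorphic_on_poly)+
    note ci = continuous_on_norm continuous_on_diff continuous_on_mult continuous_on_add c
    have "cmean (\<lambda>z. norm (F (of_real s * z) - poly (p * q) (of_real s * z)))
        = cmean (\<lambda>z. norm (?U z * ?V z - ?P z * ?Q z))"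
      by (rule cmean_cong) (use disk_mult_le[OF ns] in \<open>simp add: uv(3)\<close>)
    also have "\<dots> \<le> cmean (\<lambda>z. norm (?U z - ?P z) * norm (?V z) + norm (?P z) * norm (?V z - ?Q z))"
    proof (rule cmean_mono)
      fix z
      have "?U z * ?V z - ?P z * ?Q z = (?U z - ?P z) * ?V z + ?P z * (?V z - ?Q z)"
        by (simp add: algebra_simps)
      then show "norm (?U z * ?V z - ?P z * ?Q z)
          \<le> norm (?U z - ?P z) * norm (?V z) + norm (?P z) * norm (?V z - ?Q z)"
        by (metis norm_mult norm_triangle_ineq)
    qed (intro ci)+
    also have "\<dots> = cmean (\<lambda>z. norm (?U z - ?P z) * norm (?V z)) + cmean (\<lambda>z. norm (?P z) * norm (?V z - ?Q z))"
      by (intro cmean_add ci)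
    also have "\<dots> \<le> sqrt (d * (B + 1)) + sqrt ((B + 1) * d)"
      by (intro add_mono cmean_mult_le_sqrt ci p q Mv s)
    also have "\<dots> = e" by (simp add: sq)
    finally show "cmean (\<lambda>z. norm (F (of_real s * z) - poly (p * q) (of_real s * z))) \<le> e" .
  qed
qed

section \<open>The norms of the statement as suprema of circle means\<close>

lemma int_mean_1: "int_mean 1 r f = mean_norm f r"
  by (simp add: int_mean_def cmean_def)

lemma int_mean_2: "int_mean 2 r f = mean_square f r"
  by (simp add: int_mean_def cmean_def)

lemma H1_holomorphic: "f \<in> H1 \<Longrightarrow> f holomorphic_on ball 0 1"
  by (simp add: H1_def unit_disk_def)

lemma H1_mean_le:
  assumes "f \<in> H1" "0 \<le> s" "s < 1"
  shows "mean_norm f s \<le> H1_norm f"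
  unfolding H1_norm_def int_mean_1[symmetric]
  by (rule cSUP_upper) (use assms in \<open>auto simp: H1_def\<close>)

lemma H1_normI:
  assumes "f holomorphic_on ball 0 1"
    and "\<And>s. 0 \<le> s \<Longrightarrow> s < 1 \<Longrightarrow> mean_norm f s \<le> B"
  shows "f \<in> H1" "H1_norm f \<le> B"
  using assms by (auto simp: H1_def unit_disk_def H1_norm_def int_mean_1 intro!: bdd_aboveI[of _ B] cSUP_least)

lemma H1_norm_nonneg:
  assumes "f \<in> H1"
  shows "H1_norm f \<ge> 0"
  using order_trans[OF norm_ge_zero[of "f 0"]] H1_mean_le[OF assms, of 0] by simp

section \<open>The Cesaro kernel\<close>

definition cesaro_number :: "real \<Rightarrow> nat \<Rightarrow> real" where
  "cesaro_number \<alpha> n = pochhammer (1 + \<alpha>) n / fact n"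

lemma cesaro_number_pos: "\<alpha> > 0 \<Longrightarrow> cesaro_number \<alpha> n > 0"
  by (simp add: cesaro_number_def pochhammer_pos)

text \<open>The rising factorial of length \<open>n\<close> splits after \<open>n - k\<close>
  factors, and the remaining \<open>k\<close> factors are \<open>fact k\<close> times the
  generalized binomial coefficient.\<close>

lemma sigma_coeff_eq:
  assumes "\<alpha> > 0" "k \<le> n"
  shows "real (n choose k) / ((real n + \<alpha>) gchoose k) = cesaro_number \<alpha> (n - k) / cesaro_number \<alpha> n"
proof -
  define p q where "p = pochhammer (1 + \<alpha>) (n - k)" and "q = pochhammer (1 + \<alpha> + real (n - k)) k"
  have P: "pochhammer (1 + \<alpha>) n = p * q"
    using pochhammer_product[of "n - k" n "1 + \<alpha>"] assms(2) by (simp add: p_def q_def)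
  have g: "(real n + \<alpha>) gchoose k = q / fact k"
    using assms(2) by (simp add: gbinomial_pochhammer' of_nat_diff algebra_simps q_def)
  have b: "real (n choose k) = fact n / (fact k * fact (n - k))"
    by (rule binomial_fact[OF assms(2)])
  have "p > 0" "q > 0" using assms by (auto intro!: pochhammer_pos simp: p_def q_def)
  then show ?thesis unfolding cesaro_number_def P g b p_def[symmetric] by (simp add: field_simps)
qed

text \<open>With y = n + 1 + \<alpha> the ratio of consecutive numbers is y / (y - \<alpha>), and (1
  + 1/y)^\<alpha> \<le> exp (\<alpha>/y) \<le> y / (y - \<alpha>). Dividing by
  \<open>1 + \<alpha>\<close> makes the induction start with equality.\<close>

lemma cesaro_number_lower:
  assumes "\<alpha> > 0"
  shows "((real n + 1 + \<alpha>) / (1 + \<alpha>)) powr \<alpha> \<le> cesaro_number \<alpha> n"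
proof (induction n)
  case 0
  show ?case using assms by (simp add: cesaro_number_def)
next
  case (Suc n)
  define y where "y = real n + 1 + \<alpha>"
  have y: "y > \<alpha>" "y > 0" using assms by (auto simp: y_def)
  have "((y + 1) / y) powr \<alpha> \<le> exp (1 / y) powr \<alpha>"
    using y assms exp_ge_add_one_self[of "1 / y"] by (intro powr_mono2) (auto simp: field_simps)
  also have "\<dots> = exp (\<alpha> / y)" by (simp add: powr_def)
  also have "\<dots> \<le> y / (y - \<alpha>)"
  proof -
    have "(y - \<alpha>) / y \<le> exp (- (\<alpha> / y))"
      using exp_ge_add_one_self[of "- (\<alpha> / y)"] y by (simp add: field_simps)
    then show ?thesis using y by (simp add: exp_minus field_simps)
  qed
  finally have step: "((y + 1) / y) powr \<alpha> \<le> y / (y - \<alpha>)" .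
  have "((real (Suc n) + 1 + \<alpha>) / (1 + \<alpha>)) powr \<alpha> = (y / (1 + \<alpha>)) powr \<alpha> * ((y + 1) / y) powr \<alpha>"
  proof -
    have "real (Suc n) + 1 + \<alpha> = y + 1" "y / (1 + \<alpha>) * ((y + 1) / y) = (y + 1) / (1 + \<alpha>)"
      using y by (auto simp: y_def)
    then have "((real (Suc n) + 1 + \<alpha>) / (1 + \<alpha>)) powr \<alpha> = (y / (1 + \<alpha>) * ((y + 1) / y)) powr \<alpha>"
      by (simp only:)
    then show ?thesis using assms y by (subst (asm) powr_mult) auto
  qed
  also have "\<dots> \<le> cesaro_number \<alpha> n * (y / (y - \<alpha>))"
    using Suc cesaro_number_pos[OF assms, of n] step
    by (intro mult_mono) (auto simp: y_def)
  also have "\<dots> = cesaro_number \<alpha> (Suc n)"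
    using assms by (simp add: cesaro_number_def pochhammer_Suc y_def field_simps)
  finally show ?case .
qed

text \<open>This is \<open>(1 - z\<^sup>N)\<^sup>m / (1 - z)\<^bsup>1+\<alpha>\<^esup>\<close> with the factors arranged to be meaningful at \<open>z = 1\<close>. Its Taylor
  coefficients below \<open>N\<close> are those of \<open>(1 - z)\<^bsup>-1-\<alpha>\<^esup>\<close>, and its \<open>L\<^sup>1\<close> norm on the circle is \<open>O(N\<^sup>\<alpha>)\<close>.\<close>

definition cesaro_kernel :: "real \<Rightarrow> nat \<Rightarrow> nat \<Rightarrow> complex \<Rightarrow> complex" where
  "cesaro_kernel \<alpha> m N z = (\<Sum>i<N. z ^ i) ^ m * (1 - z) powr of_real (real m - 1 - \<alpha>)"

text \<open>In the closed disk \<open>1 - z\<close> has nonnegative real part, so the principal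
  branch is harmless; the hypothesis makes the exponent positive, which gives continuity at
  \<open>z = 1\<close>.\<close>

lemma cesaro_kernel_continuous:
  assumes "real m > 1 + \<alpha>"
  shows "continuous_on (cball 0 1) (cesaro_kernel \<alpha> m N)"
  unfolding cesaro_kernel_def
proof (intro continuous_intros)
  show "cball 0 1 \<subseteq> {z. 0 \<le> Re (1 - z) \<or> Im (1 - z) \<noteq> 0}"
    using order_trans[OF complex_Re_le_cmod] by auto
qed (use assms in auto)

lemma one_minus_notin_nonpos_Reals: "norm z < 1 \<Longrightarrow> 1 - (z::complex) \<notin> \<real>\<^sub>\<le>\<^sub>0"
  using complex_Re_le_cmod[of z] by (auto simp: complex_nonpos_Reals_iff)

lemma cesaro_kernel_holomorphic: "cesaro_kernel \<alpha> m N holomorphic_on ball 0 1"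
  unfolding cesaro_kernel_def
  by (intro holomorphic_intros) (auto simp: one_minus_notin_nonpos_Reals)

lemma taylor_coeff_power_mult:
  assumes "H holomorphic_on ball 0 1" "j < N"
  shows "taylor_coeff (\<lambda>z. z ^ N * H z) j = 0"
proof -
  have "H has_fps_expansion fps_expansion H 0"
    by (rule has_fps_expansion_fps_expansion[of "ball 0 1"]) (use assms in auto)
  then have "(\<lambda>z. z ^ N * H z) has_fps_expansion (fps_X ^ N * fps_expansion H 0)"
    by (intro fps_expansion_intros)
  from fps_nth_fps_expansion[OF this, of j] show ?thesis
    using assms(2) by (simp add: taylor_coeff_def fps_X_power_mult_nth)
qed

text \<open>The binomial series at -z: the sign (-1)^j turns the binomial coefficient of -1 -
  \<alpha> into a rising factorial of 1 + \<alpha>.\<close>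

lemma taylor_coeff_one_minus_powr:
  "taylor_coeff (\<lambda>z. (1 - z) powr of_real (- 1 - \<alpha>)) j = of_real (cesaro_number \<alpha> j)"
proof -
  have 1: "taylor_coeff (\<lambda>z. (1 + z) powr of_real (- 1 - \<alpha>)) j = (of_real (- 1 - \<alpha>) gchoose j)"
    using fps_nth_fps_expansion[OF has_fps_expansion_binomial_complex[of "of_real (- 1 - \<alpha>)"], of j]
    by (simp add: taylor_coeff_def)
  have "(\<lambda>z. (1 + z) powr of_real (- 1 - \<alpha>)) holomorphic_on ball 0 1"
    by (intro holomorphic_intros) (use one_minus_notin_nonpos_Reals[of "- z" for z] in auto)
  from taylor_coeff_dilate[OF this, of "-1" j]
  have "taylor_coeff (\<lambda>z. (1 - z) powr of_real (- 1 - \<alpha>)) j = (-1) ^ j * (of_real (- 1 - \<alpha>) gchoose j)"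
    by (simp add: 1 del: of_real_diff)
  also have "\<dots> = pochhammer (of_real (1 + \<alpha>)) j / fact j"
    by (simp add: gbinomial_pochhammer add.commute flip: power_mult_distrib mult.assoc)
  finally show ?thesis by (simp add: cesaro_number_def pochhammer_of_real[symmetric])
qed

text \<open>Inside the disk the kernel is (1 - z^N)^m times (1 - z)^(-1 - \<alpha>), and (1 - z^N)^m
  - 1 is divisible by z^N, so coefficients below \<open>N\<close> do not change.\<close>

lemma taylor_coeff_cesaro_kernel:
  assumes "j < N"
  shows "taylor_coeff (cesaro_kernel \<alpha> m N) j = of_real (cesaro_number \<alpha> j)"
proof -
  let ?B = "\<lambda>z. (1 - z) powr complex_of_real (- 1 - \<alpha>)"
  let ?H = "\<lambda>z. - (\<Sum>i<m. (1 - z ^ N) ^ i) * ?B z"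
  have B: "?B holomorphic_on ball 0 1" and H: "?H holomorphic_on ball 0 1"
    by (intro holomorphic_intros; simp add: one_minus_notin_nonpos_Reals)+
  have eq: "cesaro_kernel \<alpha> m N z - ?B z = z ^ N * ?H z" if z: "z \<in> ball 0 1" for z
  proof -
    have nz: "1 - z \<noteq> 0" using z by auto
    have "(1 - z) powr of_real (real m - 1 - \<alpha>) = (1 - z) powr (of_nat m + of_real (- 1 - \<alpha>))"
      by (simp add: algebra_simps)
    also have "\<dots> = (1 - z) ^ m * ?B z" using nz by (simp only: powr_add powr_nat) simp
    finally have "cesaro_kernel \<alpha> m N z = ((1 - z) * (\<Sum>i<N. z ^ i)) ^ m * ?B z"
      by (simp add: cesaro_kernel_def power_mult_distrib mult_ac)
    also have "(1 - z) * (\<Sum>i<N. z ^ i) = 1 - z ^ N" by (rule one_diff_power_eq[symmetric])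
    finally have 1: "cesaro_kernel \<alpha> m N z = (1 - z ^ N) ^ m * ?B z" .
    have 2: "(1 - z ^ N) ^ m = 1 - z ^ N * (\<Sum>i<m. (1 - z ^ N) ^ i)"
      using one_diff_power_eq[of "1 - z ^ N" m] by (simp add: algebra_simps)
    show ?thesis unfolding 1 2 by (simp add: algebra_simps)
  qed
  have "taylor_coeff (cesaro_kernel \<alpha> m N) j - taylor_coeff ?B j
      = taylor_coeff (\<lambda>z. cesaro_kernel \<alpha> m N z - ?B z) j"
    by (rule taylor_coeff_diff[symmetric, OF cesaro_kernel_holomorphic B])
  also have "\<dots> = taylor_coeff (\<lambda>z. z ^ N * ?H z) j"
  proof -
    have "(deriv ^^ j) (\<lambda>z. cesaro_kernel \<alpha> m N z - ?B z) 0 = (deriv ^^ j) (\<lambda>z. z ^ N * ?H z) 0"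
      by (rule higher_deriv_cong_ev[OF eventually_mono[OF eventually_nhds_in_open[of "ball 0 1"]] refl]) (use eq in auto)
    then show ?thesis by (simp add: taylor_coeff_def)
  qed
  also have "\<dots> = 0" by (rule taylor_coeff_power_mult[OF H assms])
  finally show ?thesis using taylor_coeff_one_minus_powr by simp
qed

text \<open>The Taylor series of \<open>f\<close> is integrated term by term against the shifted
  kernel; the term of index \<open>k\<close> meets kernel coefficient \<open>n - k\<close>, and
  terms beyond \<open>n\<close> vanish, so the partial means are constant once \<open>M > n\<close>.
  The index \<open>Suc n\<close> guarantees that coefficients 0 to \<open>n\<close> are the intended
  ones.\<close>

lemma cesaro_kernel_reproduces:
  assumes a: "\<alpha> > 0" and m: "real m > 1 + \<alpha>" and f: "f holomorphic_on ball 0 1" and w: "norm w < 1"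
  shows "of_real (cesaro_number \<alpha> n) * sigma_mean \<alpha> n f w
       = cmean (\<lambda>z. f (w * z) * (cesaro_kernel \<alpha> m (Suc n) z * cnj z ^ n))"
proof -
  let ?G = "cesaro_kernel \<alpha> m (Suc n)"
  let ?s = "\<lambda>M z. \<Sum>k<M. taylor_coeff f k * w ^ k * z ^ k"
  have cG: "circ_continuous (\<lambda>z. ?G z * cnj z ^ n)"
    by (intro continuous_intros continuous_on_subset[OF cesaro_kernel_continuous[OF m]]) auto
  have "uniform_limit (sphere 0 1) (\<lambda>M z. ?s M z * (?G z * cnj z ^ n))
      (\<lambda>z. f (w * z) * (?G z * cnj z ^ n)) sequentially"
    by (intro uniform_lim_mult uniform_limit_const taylor_uniform_limit[OF f w]
        compact_imp_bounded compact_continuous_image dilate_continuous_sphere[OF f w] cG) auto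
  then have lim: "(\<lambda>M. cmean (\<lambda>z. ?s M z * (?G z * cnj z ^ n))) \<longlonglongrightarrow>
      cmean (\<lambda>z. f (w * z) * (?G z * cnj z ^ n))"
    by (rule cmean_uniform_limit) (intro continuous_on_mult cG continuous_intros, simp)
  have "cmean (\<lambda>z. ?s M z * (?G z * cnj z ^ n)) = of_real (cesaro_number \<alpha> n) * sigma_mean \<alpha> n f w"
    if M: "M > n" for M
  proof -
    have "cmean (\<lambda>z. ?s M z * (?G z * cnj z ^ n))
        = cmean (\<lambda>z. \<Sum>k<M. (taylor_coeff f k * w ^ k) * (z ^ k * (?G z * cnj z ^ n)))"
      by (simp add: sum_distrib_right mult.assoc)
    also have "\<dots> = (\<Sum>k<M. (taylor_coeff f k * w ^ k) * cmean (\<lambda>z. z ^ k * (?G z * cnj z ^ n)))"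
      by (subst cmean_sum, intro continuous_on_mult cG continuous_intros,
          subst cmean_cmult, intro continuous_on_mult cG continuous_intros, rule refl)
    also have "\<dots> = (\<Sum>k<M. (taylor_coeff f k * w ^ k) * (if k \<le> n then taylor_coeff ?G (n - k) else 0))"
      by (subst cmean_power_cnj_power[OF cesaro_kernel_continuous[OF m] cesaro_kernel_holomorphic]) (rule refl)
    also have "\<dots> = (\<Sum>k\<le>n. (taylor_coeff f k * w ^ k) * of_real (cesaro_number \<alpha> (n - k)))"
      by (rule sum.mono_neutral_cong_right) (use M in \<open>auto simp: taylor_coeff_cesaro_kernel\<close>)
    also have "\<dots> = of_real (cesaro_number \<alpha> n) * sigma_mean \<alpha> n f w"
      using cesaro_number_pos[OF a, of n]
      by (auto simp: sigma_mean_def sum_distrib_left sigma_coeff_eq[OF a] intro!: sum.cong)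
    finally show ?thesis .
  qed
  then have "\<forall>\<^sub>F M in sequentially. cmean (\<lambda>z. ?s M z * (?G z * cnj z ^ n)) = of_real (cesaro_number \<alpha> n) * sigma_mean \<alpha> n f w"
    using eventually_gt_at_top[of n] by (rule eventually_mono[rotated])
  from tendsto_eventually[OF this] lim show ?thesis by (rule LIMSEQ_unique)
qed

section \<open>Size of the kernel on the circle\<close>

lemma sin_ge_half:
  fixes y :: real
  assumes "0 \<le> y" "y \<le> pi / 2"
  shows "y / 2 \<le> sin y"
proof (cases "y \<le> pi / 3")
  case True
  have "sin 0 - 0 / 2 \<le> sin y - y / 2"
  proof (rule DERIV_nonneg_imp_nondecreasing[OF assms(1)])
    fix x assume x: "0 \<le> x" "x \<le> y"
    \<comment> \<open>Up to pi/3 the cosine is at least 1/2, so sin x - x/2 increases from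
      0.\<close>
    have "cos (pi / 3) \<le> cos x" using x True by (intro cos_monotone_0_pi_le) auto
    then show "\<exists>d. ((\<lambda>x. sin x - x / 2) has_real_derivative d) (at x) \<and> 0 \<le> d"
      by (intro exI[of _ "cos x - 1 / 2"]) (auto intro!: derivative_eq_intros simp: cos_60)
  qed
  then show ?thesis by simp
next
  case False
  \<comment> \<open>Beyond pi/3 numbers decide: the sine is at least 0.85, while y/2 is at most pi/4
    < 0.81.\<close>
  have "sqrt 3 / 2 \<le> sin y"
    using sin_monotone_2pi_le[of "pi / 3" y] False assms by (simp add: sin_60)
  moreover have "y / 2 \<le> 0.81" using assms(2) pi_less_4 pi_approx by simp
  moreover have "(1.7::real) \<le> sqrt 3" by (rule real_le_rsqrt) (simp add: power2_eq_square)
  ultimately show ?thesis by simp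
qed

text \<open>The chord has length 2 |sin (t/2)|; the minimum is the angular distance to the nearer
  end of the interval.\<close>

lemma norm_one_minus_cis_ge:
  assumes "0 \<le> t" "t \<le> 2 * pi"
  shows "min t (2 * pi - t) / 2 \<le> norm (1 - cis t)"
proof -
  have eq: "norm (1 - cis t) = 2 * \<bar>sin (t / 2)\<bar>"
    using dist_exp_i_1[of t] by (simp add: cis_conv_exp norm_minus_commute)
  show ?thesis
  proof (cases "t \<le> pi")
    case True
    then show ?thesis using sin_ge_half[of "t / 2"] assms by (simp add: eq)
  next
    case False
    have "sin (pi - t / 2) = sin (t / 2)" by (simp add: sin_diff)
    then show ?thesis using sin_ge_half[of "pi - t / 2"] assms False by (simp add: eq)
  qed
qed

text \<open>The geometric sum is bounded by \<open>N\<close>, and its product with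
  \<open>1 - z\<close> by 2. These give the bounds N^(1 + \<alpha>) near 1 and |1 - z|^(-1 -
  \<alpha>) away from it; up to a factor 2 in the base, the single expression 2 N / (1 + N |1 - z|)
  replaces the minimum of the two.\<close>

lemma cesaro_kernel_pointwise:
  assumes a: "\<alpha> > 0" and m: "real m > 1 + \<alpha>" and z: "norm z = 1" and N: "N > 0"
  shows "norm (cesaro_kernel \<alpha> m N z) \<le> 2 ^ m * (2 * real N / (1 + real N * norm (1 - z))) powr (1 + \<alpha>)"
proof -
  define S x where "S = norm (\<Sum>i<N. z ^ i)" and "x = norm (1 - z)"
  have eq: "norm (cesaro_kernel \<alpha> m N z) = S ^ m * x powr (real m - 1 - \<alpha>)"
    by (simp add: cesaro_kernel_def norm_mult norm_power S_def x_def norm_powr_real_powr' del: of_real_diff)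
  have S: "0 \<le> S" "S \<le> N"
    using norm_sum[of "\<lambda>i. z ^ i" "{..<N}"] z by (auto simp: S_def norm_power)
  have Sx: "S * x \<le> 2"
  proof -
    have "S * x = norm (1 - z ^ N)"
      by (simp add: S_def x_def one_diff_power_eq norm_mult)
    also have "\<dots> \<le> 2" using norm_triangle_ineq4[of 1 "z ^ N"] z by (simp add: norm_power)
    finally show ?thesis .
  qed
  show ?thesis
  \<comment> \<open>Here the kernel vanishes: \<open>m > 0\<close> settles \<open>S = 0\<close>, and
    \<open>0 powr a = 0\<close> settles \<open>x = 0\<close>. Otherwise both bases are positive and
    the laws of \<open>powr\<close> apply.\<close>
  proof (cases "x = 0 \<or> S = 0")
    case True
    have "m > 0" using m a by (cases m) auto
    then show ?thesis using True by (auto simp: eq power_0_left)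
  next
    case False
    then have x: "x > 0" and S0: "S > 0" using S by (auto simp: x_def)
    let ?y = "x powr (real m - 1 - \<alpha>)" and ?b = "(2 * real N / (1 + real N * x)) powr (1 + \<alpha>)"
    have d: "1 + real N * x > 0" using x by (simp add: add_pos_nonneg)
    have 1: "S ^ m * ?y \<le> 2 ^ m * real N powr (1 + \<alpha>)"
    proof -
      have "S ^ m = S powr (real m - 1 - \<alpha>) * S powr (1 + \<alpha>)"
        using S0 by (simp flip: powr_add add: powr_realpow)
      then have "S ^ m * ?y = (S * x) powr (real m - 1 - \<alpha>) * S powr (1 + \<alpha>)"
        using S0 x by (simp add: powr_mult mult_ac)
      also have "\<dots> \<le> 2 powr (real m - 1 - \<alpha>) * real N powr (1 + \<alpha>)"
        using m a S Sx x by (intro mult_mono powr_mono2) auto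
      also have "\<dots> \<le> 2 powr real m * real N powr (1 + \<alpha>)"
        using a by (intro mult_right_mono powr_mono) auto
      finally show ?thesis by (simp add: powr_realpow)
    qed
    have 2: "S ^ m * ?y \<le> 2 ^ m * (1 / x) powr (1 + \<alpha>)"
    proof -
      have "?y = x powr real m * x powr - (1 + \<alpha>)"
        by (simp add: powr_add[symmetric] algebra_simps)
      also have "\<dots> = x ^ m * (1 / x) powr (1 + \<alpha>)"
        using x by (simp only: powr_realpow powr_minus_divide powr_divide) simp
      finally have "S ^ m * ?y = (S * x) ^ m * (1 / x) powr (1 + \<alpha>)"
        by (simp add: power_mult_distrib)
      also have "\<dots> \<le> 2 ^ m * (1 / x) powr (1 + \<alpha>)"
        using Sx S0 x by (intro mult_right_mono power_mono) auto
      finally show ?thesis .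
    qed
    show ?thesis
    proof (cases "real N * x \<le> 1")
      case True
      have "real N \<le> 2 * real N / (1 + real N * x)"
        using True N d by (simp add: pos_le_divide_eq)
      then have "real N powr (1 + \<alpha>) \<le> ?b"
        using a by (intro powr_mono2) auto
      then show ?thesis using 1 unfolding eq x_def[symmetric]
        by (rule_tac order_trans[OF 1]) simp
    next
      case False
      have "1 / x \<le> 2 * real N / (1 + real N * x)"
        using False x d by (simp add: divide_simps mult_ac)
      then have "(1 / x) powr (1 + \<alpha>) \<le> ?b"
        using a x by (intro powr_mono2) auto
      then show ?thesis unfolding eq x_def[symmetric]
        by (rule_tac order_trans[OF 2]) simp
    qed
  qed
qed

lemma cesaro_kernel_L1:
  assumes a: "\<alpha> > 0" and m: "real m > 1 + \<alpha>"
  obtains C where "C > 0"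
    "\<And>n. cmean (\<lambda>z. norm (cesaro_kernel \<alpha> m (Suc n) z)) \<le> C * cesaro_number \<alpha> n"
proof
  \<comment> \<open>\<open>2 ^ m\<close> comes from the pointwise bound, the 8 is twice the 4 in
    \<open>bound\<close> since both ends of the interval contribute, and \<open>2 * pi\<close>
    normalizes the mean.\<close>
  define K where "K = 2 ^ m * (8 * 2 powr \<alpha> / \<alpha>) / (2 * pi)"
  show "K * (1 + \<alpha>) powr \<alpha> > 0" using a by (simp add: K_def)
  fix n
  define N where "N = real (Suc n)"
  have N: "N > 0" by (simp add: N_def)
  \<comment> \<open>The majorant with the chord replaced by half the arc. As 1 + \<alpha> exceeds 1,
    its antiderivative \<open>\<Psi>\<close> is again a negative power, and the integral has order
    N^\<alpha> rather than the order N^(1 + \<alpha>) of the maximum.\<close>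
  define \<psi> where "\<psi> t = (2 * N / (1 + N * (t / 2))) powr (1 + \<alpha>)" for t
  define \<Psi> where "\<Psi> t = - (2 / (N * \<alpha>)) * (2 * N) powr (1 + \<alpha>) * (1 + N * (t / 2)) powr - \<alpha>" for t
  have d\<Psi>: "(\<Psi> has_real_derivative \<psi> t) (at t)" if "t \<ge> 0" for t
  proof -
    have p: "1 + N * (t / 2) > 0" using that N by (simp add: add_pos_nonneg)
    have "(\<Psi> has_real_derivative (- (2 / (N * \<alpha>)) * (2 * N) powr (1 + \<alpha>) *
        (- \<alpha> * (1 + N * (t / 2)) powr (- \<alpha> - 1) * (N / 2)))) (at t)"
      unfolding \<Psi>_def using p by (auto intro!: derivative_eq_intros)
    also have "- (2 / (N * \<alpha>)) * (2 * N) powr (1 + \<alpha>) *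
        (- \<alpha> * (1 + N * (t / 2)) powr (- \<alpha> - 1) * (N / 2)) = \<psi> t"
    proof -
      have "- \<alpha> - 1 = - (1 + \<alpha>)" by simp
      then have "\<psi> t = (2 * N) powr (1 + \<alpha>) * (1 + N * (t / 2)) powr (- \<alpha> - 1)"
        using p N by (simp only: \<psi>_def powr_divide powr_minus_divide) simp
      then show ?thesis using a N by (simp add: field_simps)
    qed
    finally show ?thesis .
  qed
  have i1: "(\<psi> has_integral (\<Psi> (2*pi) - \<Psi> 0)) {0..2*pi}"
    by (rule fundamental_theorem_of_calculus)
       (auto simp flip: has_real_derivative_iff_has_vector_derivative
          intro: has_field_derivative_at_within d\<Psi>)
  have i2: "((\<lambda>t. \<psi> (2*pi - t)) has_integral (- \<Psi> (2*pi - 2*pi) - - \<Psi> (2*pi - 0))) {0..2*pi}"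
  proof (rule fundamental_theorem_of_calculus)
    fix t :: real assume t: "t \<in> {0..2*pi}"
    have "((\<lambda>t. - \<Psi> (2*pi - t)) has_real_derivative - (\<psi> (2*pi - t) * (-1))) (at t)"
      by (intro DERIV_minus DERIV_chain2[of \<Psi>] d\<Psi>) (use t in \<open>auto intro!: derivative_eq_intros\<close>)
    then show "((\<lambda>t. - \<Psi> (2*pi - t)) has_vector_derivative \<psi> (2*pi - t)) (at t within {0..2*pi})"
      by (auto simp flip: has_real_derivative_iff_has_vector_derivative intro: has_field_derivative_at_within)
  qed simp
  have bound: "\<Psi> (2*pi) - \<Psi> 0 \<le> 4 * 2 powr \<alpha> / \<alpha> * N powr \<alpha>"
  proof -
    have "\<Psi> (2*pi) \<le> 0" using a N by (simp add: \<Psi>_def)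
    moreover have "- \<Psi> 0 = 4 * 2 powr \<alpha> / \<alpha> * N powr \<alpha>"
      using a N by (simp add: \<Psi>_def powr_add powr_mult field_simps)
    ultimately show ?thesis by simp
  qed
  let ?k = "\<lambda>z. norm (cesaro_kernel \<alpha> m (Suc n) z)"
  have cont: "circ_continuous (\<lambda>z. ?k z)"
    by (intro continuous_intros continuous_on_subset[OF cesaro_kernel_continuous[OF m]]) auto
  have "integral {0..2*pi} (\<lambda>t. ?k (cis t))
     \<le> integral {0..2*pi} (\<lambda>t. 2 ^ m * (\<psi> t + \<psi> (2*pi - t)))"
  proof (rule integral_le[OF integrable_comp_cis[OF cont]])
    show "(\<lambda>t. 2 ^ m * (\<psi> t + \<psi> (2*pi - t))) integrable_on {0..2*pi}"
      using has_integral_mult_right[OF has_integral_add[OF i1 i2]] by blast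
    fix t assume t: "t \<in> {0..2*pi}"
    have mono: "(2 * N / (1 + N * norm (1 - cis t))) powr (1 + \<alpha>) \<le> \<psi> s"
      if "s / 2 \<le> norm (1 - cis t)" "0 \<le> s" for s
      unfolding \<psi>_def using that N a
      by (intro powr_mono2 divide_left_mono add_left_mono mult_left_mono) (auto intro!: mult_pos_pos add_pos_nonneg)
    \<comment> \<open>Only the nearer end is needed; adding the other, nonnegative term removes the
      case distinction from the integral.\<close>
    have "(2 * N / (1 + N * norm (1 - cis t))) powr (1 + \<alpha>) \<le> \<psi> t + \<psi> (2*pi - t)"
    proof (cases "t \<le> 2*pi - t")
      case True
      have "0 \<le> \<psi> (2*pi - t)" by (simp add: \<psi>_def)
      then show ?thesis using mono[of t] norm_one_minus_cis_ge[of t] t True by simp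
    next
      case False
      have "0 \<le> \<psi> t" by (simp add: \<psi>_def)
      then show ?thesis using mono[of "2*pi - t"] norm_one_minus_cis_ge[of t] t False by simp
    qed
    then have le: "2 ^ m * (2 * N / (1 + N * norm (1 - cis t))) powr (1 + \<alpha>) \<le> 2 ^ m * (\<psi> t + \<psi> (2*pi - t))"
      by (intro mult_left_mono) auto
    show "?k (cis t) \<le> 2 ^ m * (\<psi> t + \<psi> (2*pi - t))"
      by (rule order_trans[OF cesaro_kernel_pointwise[OF a m] le[unfolded N_def]]) simp_all
  qed
  also have "\<dots> = 2 ^ m * (2 * (\<Psi> (2*pi) - \<Psi> 0))"
    using integral_unique[OF has_integral_mult_right[OF has_integral_add[OF i1 i2], of "2 ^ m"]]
    by (simp add: algebra_simps)
  also have "\<dots> \<le> 2 ^ m * (2 * (4 * 2 powr \<alpha> / \<alpha> * N powr \<alpha>))"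
    using bound by (intro mult_left_mono) auto
  finally have "(1 / (2 * pi)) * integral {0..2*pi} (\<lambda>t. ?k (cis t))
      \<le> (1 / (2 * pi)) * (2 ^ m * (2 * (4 * 2 powr \<alpha> / \<alpha> * N powr \<alpha>)))"
    by (rule mult_left_mono) simp
  also have "\<dots> = K * N powr \<alpha>" by (simp add: K_def field_simps)
  finally have "cmean (\<lambda>z. ?k z) \<le> K * N powr \<alpha>"
    by (simp add: cmean_def)
  also have "\<dots> \<le> K * ((1 + \<alpha>) powr \<alpha> * cesaro_number \<alpha> n)"
  proof (rule mult_left_mono)
    have "N powr \<alpha> \<le> (real n + 1 + \<alpha>) powr \<alpha>"
      using a by (intro powr_mono2) (auto simp: N_def)
    also have "\<dots> = (1 + \<alpha>) powr \<alpha> * ((real n + 1 + \<alpha>) / (1 + \<alpha>)) powr \<alpha>"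
      using a by (simp add: powr_divide)
    also have "\<dots> \<le> (1 + \<alpha>) powr \<alpha> * cesaro_number \<alpha> n"
      using cesaro_number_lower[OF a, of n] by (intro mult_left_mono) auto
    finally show "N powr \<alpha> \<le> (1 + \<alpha>) powr \<alpha> * cesaro_number \<alpha> n" .
    show "K \<ge> 0" using a by (simp add: K_def)
  qed
  finally show "cmean (\<lambda>z. ?k z) \<le> K * (1 + \<alpha>) powr \<alpha> * cesaro_number \<alpha> n"
    by (simp add: mult.assoc)
qed

section \<open>Poisson integrals and the Garsia seminorm\<close>

definition poisson_kernel :: "complex \<Rightarrow> complex \<Rightarrow> real" where
  "poisson_kernel z w = (1 - (norm z)\<^sup>2) / (norm (w - z))\<^sup>2"

abbreviation poisson_mean :: "(complex \<Rightarrow> complex) \<Rightarrow> real \<Rightarrow> complex \<Rightarrow> real" where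
  "poisson_mean f s z \<equiv> cmean (\<lambda>w. poisson_kernel z w * (norm (f (of_real s * w)))\<^sup>2)"

lemma cauchy_kernel_nonzero:
  assumes "norm z < 1" "norm w \<le> 1"
  shows "1 - z * cnj w \<noteq> 0" "1 - cnj z * w \<noteq> 0"
  using disk_mult_le[of z "cnj w"] disk_mult_le[of "cnj z" w] assms by auto

lemma continuous_on_cauchy_kernel:
  "norm z < 1 \<Longrightarrow> circ_continuous (\<lambda>w. 1 / (1 - z * cnj w))"
  by (intro continuous_intros) (use cauchy_kernel_nonzero in auto)

text \<open>With q = 1 - z cnj w one has |w - z| = |q|, so the Poisson kernel is expressed by the
  Cauchy kernel 1/q, which has a geometric series in \<open>z * cnj w\<close>.\<close>

lemma poisson_kernel_eq:
  assumes z: "norm z < 1" and w: "norm w = 1"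
  shows "poisson_kernel z w = 2 * Re (1 / (1 - z * cnj w)) - 1"
proof -
  define q where "q = 1 - z * cnj w"
  have q: "q \<noteq> 0" using cauchy_kernel_nonzero[of z w] z w by (simp add: q_def)
  have "w * cnj w = 1" using w by (simp add: complex_norm_square[symmetric])
  then have "w - z = w * q" by (simp add: q_def algebra_simps)
  then have 1: "norm (w - z) = norm q" using w by (simp add: norm_mult)
  have "norm z = norm (1 - q)" using w by (simp add: q_def norm_mult)
  then have 2: "1 - (norm z)\<^sup>2 = 2 * Re q - (norm q)\<^sup>2"
    by (simp add: cmod_power2) (simp add: power2_eq_square algebra_simps)
  have "Re (1 / q) = Re q / (norm q)\<^sup>2" by (simp add: Re_divide cmod_power2)
  then show ?thesis unfolding poisson_kernel_def 1 2 q_def[symmetric] using q by (simp add: diff_divide_distrib)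
qed

lemma poisson_kernel_nonneg: "norm z < 1 \<Longrightarrow> poisson_kernel z w \<ge> 0"
  by (simp add: poisson_kernel_def power_le_one)

lemma poisson_kernel_le:
  assumes z: "norm z < 1" and w: "norm w = 1"
  shows "poisson_kernel z w \<le> (1 + norm z) / (1 - norm z)"
proof -
  have "1 - norm z \<le> norm (w - z)" using norm_triangle_ineq2[of w z] w by simp
  then have "(1 - norm z)\<^sup>2 \<le> (norm (w - z))\<^sup>2" using z by (intro power_mono) auto
  then have "poisson_kernel z w \<le> (1 - (norm z)\<^sup>2) / (1 - norm z)\<^sup>2"
    unfolding poisson_kernel_def using z by (intro divide_left_mono mult_pos_pos) (auto simp: power_le_one)
  also have "\<dots> = (1 + norm z) / (1 - norm z)"
    using z by (simp add: power2_eq_square divide_simps) (simp add: algebra_simps)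
  finally show ?thesis .
qed

lemma poisson_kernel_rotate:
  assumes "norm u = 1"
  shows "poisson_kernel (u * z) (u * w) = poisson_kernel z w"
  unfolding poisson_kernel_def using assms by (simp add: norm_mult flip: right_diff_distrib)

lemma continuous_on_poisson_kernel:
  "norm z < 1 \<Longrightarrow> circ_continuous (poisson_kernel z)"
  unfolding poisson_kernel_def by (intro continuous_intros) auto

text \<open>The kernel is 1/q plus cnj z w / (1 - cnj z w). The first part is Cauchy's formula; the
  second times \<open>G\<close> is holomorphic and vanishes at 0, so its mean is 0.\<close>

lemma poisson_reproduces:
  assumes c: "continuous_on (cball 0 1) G" and h: "G holomorphic_on ball 0 1" and z: "norm z < 1"
  shows "cmean (\<lambda>w. of_real (poisson_kernel z w) * G w) = G z"
proof -
  have cG: "circ_continuous G" by (rule continuous_on_subset[OF c]) auto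
  have "((\<lambda>u. G u / (u - z)) has_contour_integral (2 * of_real pi * \<i> * G z)) (circlepath 0 1)"
    by (rule Cauchy_integral_circlepath[OF c h]) (use z in simp)
  then have "((\<lambda>t. G (cis t) / (cis t - z) * \<i> * cis t) has_integral (2 * of_real pi * \<i> * G z)) {0..2*pi}"
    unfolding circlepath_def by (subst (asm) has_contour_integral_part_circlepath_iff) auto
  moreover have "G (cis t) / (cis t - z) * \<i> * cis t = \<i> * (G (cis t) * (1 / (1 - z * cnj (cis t))))" for t
  proof -
    have 1: "cis t * cnj (cis t) = 1" by (simp add: cis_cnj cis_mult)
    then have "cis t - z = cis t * (1 - z * cnj (cis t))" by (simp add: algebra_simps)
    then show ?thesis using cauchy_kernel_nonzero(1)[of z "cis t"] z by (simp add: divide_simps)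
  qed
  ultimately have "((\<lambda>t. \<i> * (G (cis t) * (1 / (1 - z * cnj (cis t))))) has_integral (2 * of_real pi * \<i> * G z)) {0..2*pi}"
    by simp
  from has_integral_mult_right[OF this, of "-\<i>"]
  have "((\<lambda>t. G (cis t) * (1 / (1 - z * cnj (cis t)))) has_integral (2 * pi * G z)) {0..2*pi}"
    by (simp add: algebra_simps)
  then have 1: "cmean (\<lambda>w. G w * (1 / (1 - z * cnj w))) = G z"
    by (simp add: cmean_def integral_unique scaleR_conv_of_real)
  have nz: "1 - cnj z * w \<noteq> 0" if "norm w \<le> 1" for w using cauchy_kernel_nonzero z that by blast
  let ?k = "\<lambda>w. cnj z * w * G w / (1 - cnj z * w)"
  have cH: "continuous_on (cball 0 1) (\<lambda>w. ?k w)"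
    by (intro continuous_intros c) (use nz in auto)
  then have cH': "circ_continuous (\<lambda>w. ?k w)"
    by (rule continuous_on_subset) auto
  have 2: "cmean (\<lambda>w. (?k w) * cnj w ^ 0) = 0"
    by (subst cmean_cnj_power[OF cH]) (use nz in \<open>auto intro!: holomorphic_intros h\<close>)
  have "cmean (\<lambda>w. of_real (poisson_kernel z w) * G w)
      = cmean (\<lambda>w. G w * (1 / (1 - z * cnj w)) + ?k w)"
  proof (rule cmean_cong)
    fix w :: complex assume w: "norm w = 1"
    define q where "q = 1 - z * cnj w"
    have q: "q \<noteq> 0" "cnj q = 1 - cnj z * w" using cauchy_kernel_nonzero[of z w] z w by (auto simp: q_def)
    have "complex_of_real (poisson_kernel z w) = 1 / q + cnj (1 / q) - 1"
      unfolding poisson_kernel_eq[OF z w] q_def[symmetric] complex_add_cnj by simp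
    also have "\<dots> = 1 / q + (1 - cnj q) / cnj q" using q(1) by (simp add: diff_divide_distrib)
    finally show "of_real (poisson_kernel z w) * G w = G w * (1 / (1 - z * cnj w)) + ?k w"
      unfolding q(2) q_def[symmetric] by (simp add: algebra_simps)
  qed
  also have "\<dots> = G z"
    using 1 2 by (subst cmean_add[OF continuous_on_mult[OF cG continuous_on_cauchy_kernel[OF z]] cH']) simp
  finally show ?thesis .
qed

lemma cmean_poisson_kernel:
  assumes "norm z < 1"
  shows "cmean (poisson_kernel z) = 1"
proof -
  have "complex_of_real (cmean (poisson_kernel z)) = cmean (\<lambda>w. of_real (poisson_kernel z w) * 1)"
    by (simp add: cmean_of_real[OF continuous_on_poisson_kernel[OF assms]])
  also have "\<dots> = 1" by (rule poisson_reproduces) (use assms in auto)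
  finally show ?thesis by simp
qed

section \<open>Poisson integrals as the radius tends to 1\<close>

lemma eventually_at_left_1: "\<forall>\<^sub>F s in at_left (1::real). 0 < s \<and> s < 1"
  using eventually_at_left_real[of 0 1] by (auto elim: eventually_mono)

lemma tannery_at_left:
  fixes a :: "nat \<Rightarrow> real \<Rightarrow> 'a::{real_normed_algebra, banach}"
  assumes "\<And>k. (a k \<longlongrightarrow> b k) (at_left 1)" "\<And>k s. 0 < s \<Longrightarrow> s < 1 \<Longrightarrow> norm (a k s) \<le> M k" "summable M"
  shows "summable (\<lambda>k. norm (b k))" "((\<lambda>s. suminf (\<lambda>k. a k s)) \<longlongrightarrow> suminf b) (at_left 1)"
proof -
  have "\<forall>\<^sub>F x in at_top \<times>\<^sub>F at_left 1. True \<and> 0 < snd x \<and> snd x < (1::real)"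
    by (rule eventually_prodI[OF _ eventually_at_left_1]) simp
  then have "eventually (\<lambda>(k, s). norm (a k s) \<le> M k) (at_top \<times>\<^sub>F at_left 1)"
    by (rule eventually_mono) (use assms(2) in auto)
  from tannerys_theorem[OF assms(1) this assms(3)]
  show "summable (\<lambda>k. norm (b k))" "((\<lambda>s. suminf (\<lambda>k. a k s)) \<longlongrightarrow> suminf b) (at_left 1)" by auto
qed

text \<open>The sum of the squared coefficients of \<open>v\<close> and \<open>w\<close> dominates
  the products of coefficients, so the limit may be taken inside the series.\<close>

lemma Parseval_limit:
  assumes v: "v holomorphic_on ball 0 1" and w: "w holomorphic_on ball 0 1"
    and Mv: "\<And>s. 0 \<le> s \<Longrightarrow> s < 1 \<Longrightarrow> mean_square v s \<le> M"
    and Mw: "\<And>s. 0 \<le> s \<Longrightarrow> s < 1 \<Longrightarrow> mean_square w s \<le> M"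
  shows "((\<lambda>s. cmean (\<lambda>z. v (of_real s * z) * cnj (w (of_real s * z)))) \<longlongrightarrow>
           (\<Sum>k. taylor_coeff v k * cnj (taylor_coeff w k))) (at_left 1)"
proof -
  let ?d = "\<lambda>k. (norm (taylor_coeff v k))\<^sup>2 + (norm (taylor_coeff w k))\<^sup>2"
  let ?c = "\<lambda>k. taylor_coeff v k * cnj (taylor_coeff w k)"
  have "((\<lambda>s. \<Sum>k. ?c k * of_real (s ^ (2 * k))) \<longlongrightarrow> (\<Sum>k. ?c k)) (at_left 1)"
  proof (rule tannery_at_left)
    show "summable (\<lambda>k. ?d k)"
      by (intro summable_add summable_taylor_coeff_square[OF v Mv] summable_taylor_coeff_square[OF w Mw])
    fix k
    have "((\<lambda>s. ?c k * of_real (s ^ (2 * k))) \<longlongrightarrow> ?c k * of_real (1 ^ (2 * k))) (at_left 1)"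
      by (intro tendsto_intros)
    then show "((\<lambda>s. ?c k * of_real (s ^ (2 * k))) \<longlongrightarrow> ?c k) (at_left 1)" by simp
    fix s :: real assume s: "0 < s" "s < 1"
    have "norm (?c k * of_real (s ^ (2 * k))) \<le> norm (taylor_coeff v k) * norm (taylor_coeff w k) * 1"
      unfolding norm_mult using s by (intro mult_mono) (auto simp: norm_power power_le_one)
    also have "\<dots> \<le> ?d k"
    proof -
      have "0 \<le> (norm (taylor_coeff v k) - norm (taylor_coeff w k))\<^sup>2" by simp
      moreover have "0 \<le> norm (taylor_coeff v k) * norm (taylor_coeff w k)" by simp
      ultimately show ?thesis unfolding power2_diff by linarith
    qed
    finally show "norm (?c k * of_real (s ^ (2 * k))) \<le> ?d k" .
  qed
  moreover have "\<forall>\<^sub>F s in at_left 1. (\<Sum>k. ?c k * of_real (s ^ (2 * k))) = cmean (\<lambda>z. v (of_real s * z) * cnj (w (of_real s * z)))"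
    using eventually_at_left_1
  proof eventually_elim
    case (elim s)
    then show ?case using cmean_Parseval[OF v w, of s] by (simp add: sums_iff)
  qed
  ultimately show ?thesis by (rule Lim_transform_eventually)
qed

text \<open>The Poisson integral is determined by the Fourier coefficients
  \<open>\<beta> m s\<close> of |f|^2 on the circle of radius \<open>s\<close>. These are bounded by
  \<open>M\<close> and converge, so the limit is the real part of the power series \<open>W\<close>.
  That holomorphic \<open>W\<close> is what the duality argument later needs.\<close>

lemma Poisson_integral_limit:
  assumes f: "f holomorphic_on ball 0 1"
    and M: "\<And>s. 0 \<le> s \<Longrightarrow> s < 1 \<Longrightarrow> mean_square f s \<le> M"
  obtains W where "W holomorphic_on ball 0 1"
    "\<And>r. r < 1 \<Longrightarrow> uniform_limit (cball 0 r)
       (poisson_mean f) (\<lambda>z. Re (W z)) (at_left 1)"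
proof -
  define \<beta> where "\<beta> m s = cmean (\<lambda>w. of_real ((norm (f (of_real s * w)))\<^sup>2) * cnj w ^ m)" for m and s :: real
  have cf: "circ_continuous (\<lambda>w. f (of_real s * w))" if "0 < s" "s < 1" for s
    by (rule dilate_continuous_sphere[OF f]) (use that in auto)
  note ci = continuous_on_mult continuous_on_of_real continuous_on_power continuous_on_norm continuous_on_cnj continuous_on_id
    continuous_on_const
  have \<beta>_le: "norm (\<beta> m s) \<le> M" if s: "0 < s" "s < 1" for m s
  proof -
    have "norm (\<beta> m s) \<le> cmean (\<lambda>w. norm (complex_of_real ((norm (f (of_real s * w)))\<^sup>2) * cnj w ^ m))"
      unfolding \<beta>_def by (intro cmean_norm_le ci cf s)
    also have "\<dots> = cmean (\<lambda>w. (norm (f (of_real s * w)))\<^sup>2)"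
      by (rule cmean_cong) (simp add: norm_mult norm_power)
    finally show ?thesis using M[of s] s by simp
  qed
  have "\<exists>b. (\<beta> m \<longlongrightarrow> b) (at_left 1)" for m
  proof -
    \<comment> \<open>Up to the factor s^m, \<open>\<beta> m s\<close> is the mean of
      \<open>f\<close> against the conjugate of z^m f, a pair to which \<open>Parseval_limit\<close>
      applies.\<close>
    let ?w = "\<lambda>z. z ^ m * f z"
    have hw: "?w holomorphic_on ball 0 1" by (intro holomorphic_intros f)
    have "cmean (\<lambda>z. (norm (?w (of_real s * z)))\<^sup>2) \<le> M" if s: "0 \<le> s" "s < 1" for s
    proof -
      have "cmean (\<lambda>z. (norm (?w (of_real s * z)))\<^sup>2) \<le> mean_square f s"
      proof (rule cmean_mono)
        fix z :: complex assume "norm z = 1"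
        then have "norm ((of_real s * z) ^ m) \<le> 1"
          using s by (simp add: norm_power norm_mult power_le_one)
        then show "(norm (?w (of_real s * z)))\<^sup>2 \<le> (norm (f (of_real s * z)))\<^sup>2"
          unfolding norm_mult by (intro power_mono mult_left_le_one_le) auto
      qed (intro ci dilate_continuous_sphere[OF f] dilate_continuous_sphere[OF hw]; use s in simp)+
      then show ?thesis using M[OF s] by simp
    qed
    from Parseval_limit[OF f hw M this] obtain L where
      L: "((\<lambda>s. cmean (\<lambda>z. f (of_real s * z) * cnj (?w (of_real s * z)))) \<longlongrightarrow> L) (at_left 1)" by blast
    have "((\<lambda>s. cmean (\<lambda>z. f (of_real s * z) * cnj (?w (of_real s * z))) / of_real s ^ m) \<longlongrightarrow> L / of_real 1 ^ m) (at_left 1)"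
      by (intro tendsto_divide[OF L] tendsto_intros) simp
    moreover have "\<forall>\<^sub>F s in at_left 1. cmean (\<lambda>z. f (of_real s * z) * cnj (?w (of_real s * z))) / of_real s ^ m = \<beta> m s"
      using eventually_at_left_1
    proof eventually_elim
      case (elim s)
      have "cmean (\<lambda>z. f (of_real s * z) * cnj (?w (of_real s * z)))
          = cmean (\<lambda>z. of_real s ^ m * (of_real ((norm (f (of_real s * z)))\<^sup>2) * cnj z ^ m))"
        by (rule cmean_cong) (simp only: complex_norm_square complex_cnj_mult complex_cnj_power complex_cnj_complex_of_real power_mult_distrib mult_ac)
      also have "\<dots> = of_real s ^ m * \<beta> m s"
        unfolding \<beta>_def by (intro cmean_cmult ci cf) (use elim in auto)
      finally show ?case using elim by simp
    qed
    ultimately show ?thesis using Lim_transform_eventually by blast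
  qed
  then obtain b where b: "\<And>m. (\<beta> m \<longlongrightarrow> b m) (at_left 1)" by metis
  have b_le: "norm (b m) \<le> M" for m
    by (rule tendsto_upperbound[OF tendsto_norm[OF b] eventually_mono[OF eventually_at_left_1]]) (use \<beta>_le in auto)
  have summ: "summable (\<lambda>m. norm (z ^ m * a m))" if "norm z < 1" "\<And>m. norm (a m) \<le> M'" for z :: complex and a M'
  proof (rule summable_comparison_test[OF _ summable_mult[OF summable_geometric, of "norm z" M']])
    show "\<exists>N. \<forall>m\<ge>N. norm (norm (z ^ m * a m)) \<le> M' * norm z ^ m"
      using that(2) by (auto simp: norm_mult norm_power mult.commute[of M'] intro!: mult_left_mono)
  qed (use that in auto)
  define W where "W z = 2 * (\<Sum>m. z ^ m * b m) - b 0" for z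
  have "(\<lambda>z. \<Sum>m. z ^ m * b m) holomorphic_on ball 0 1"
  proof (rule power_series_holomorphic)
    fix w :: complex assume "w \<in> ball 0 1"
    then show "(\<lambda>n. b n * (w - 0) ^ n) sums (\<Sum>m. w ^ m * b m)"
      using summable_norm_cancel[OF summ[of w b M]] b_le by (simp add: mult.commute summable_sums)
  qed
  then have hW: "W holomorphic_on ball 0 1" unfolding W_def by (intro holomorphic_intros)
  have P: "poisson_mean f s z = Re (2 * (\<Sum>m. z ^ m * \<beta> m s) - \<beta> 0 s)"
    if z: "norm z < 1" and s: "0 < s" "s < 1" for z s
  proof -
    let ?u = "\<lambda>w. complex_of_real ((norm (f (of_real s * w)))\<^sup>2)"
    have cu: "circ_continuous ?u" by (intro ci cf s)
    have "uniform_limit (sphere 0 1) (\<lambda>n w. \<Sum>m<n. (z * cnj w) ^ m) (\<lambda>w. \<Sum>m. (z * cnj w) ^ m) sequentially"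
      by (rule Weierstrass_m_test[OF _ summable_geometric[of "norm z"]]) (use z in \<open>auto simp: norm_mult norm_power\<close>)
    moreover have "(\<Sum>m. (z * cnj w) ^ m) = 1 / (1 - z * cnj w)" if "w \<in> sphere 0 1" for w
      using disk_mult_le[OF z, of "cnj w"] that by (intro suminf_geometric) simp
    ultimately have "uniform_limit (sphere 0 1) (\<lambda>n w. \<Sum>m<n. (z * cnj w) ^ m) (\<lambda>w. 1 / (1 - z * cnj w)) sequentially"
      by (subst (asm) uniform_limit_cong'[OF refl]) auto
    then have "uniform_limit (sphere 0 1) (\<lambda>n w. (\<Sum>m<n. (z * cnj w) ^ m) * ?u w) (\<lambda>w. (1 / (1 - z * cnj w)) * ?u w) sequentially"
      by (intro uniform_lim_mult uniform_limit_const compact_imp_bounded compact_continuous_image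
          continuous_on_cauchy_kernel z cu) auto
    then have "(\<lambda>n. cmean (\<lambda>w. (\<Sum>m<n. (z * cnj w) ^ m) * ?u w)) \<longlonglongrightarrow> cmean (\<lambda>w. (1 / (1 - z * cnj w)) * ?u w)"
      by (rule cmean_uniform_limit) (intro continuous_on_mult cu continuous_intros, simp)
    moreover have "cmean (\<lambda>w. (\<Sum>m<n. (z * cnj w) ^ m) * ?u w) = (\<Sum>m<n. z ^ m * \<beta> m s)" for n
    proof -
      have "cmean (\<lambda>w. (\<Sum>m<n. (z * cnj w) ^ m) * ?u w) = cmean (\<lambda>w. \<Sum>m<n. z ^ m * (?u w * cnj w ^ m))"
        by (rule cmean_cong) (simp add: sum_distrib_right sum_distrib_left power_mult_distrib mult_ac)
      also have "\<dots> = (\<Sum>m<n. z ^ m * \<beta> m s)"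
        unfolding \<beta>_def by (subst cmean_sum, intro ci cu, subst cmean_cmult, intro ci cu, rule refl)
      finally show ?thesis .
    qed
    ultimately have 1: "(\<Sum>m. z ^ m * \<beta> m s) = cmean (\<lambda>w. (1 / (1 - z * cnj w)) * ?u w)"
      by (auto simp: sums_def[symmetric] sums_iff)
    have "Re (2 * (\<Sum>m. z ^ m * \<beta> m s) - \<beta> 0 s)
        = Re (cmean (\<lambda>w. 2 * ((1 / (1 - z * cnj w)) * ?u w) - ?u w))"
      unfolding 1 by (subst cmean_diff, intro ci continuous_on_cauchy_kernel z cu, rule cu,
        subst cmean_cmult, intro ci continuous_on_cauchy_kernel z cu) (simp add: \<beta>_def)
    also have "\<dots> = cmean (\<lambda>w. Re (2 * ((1 / (1 - z * cnj w)) * ?u w) - ?u w))"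
      by (rule cmean_Re[symmetric]) (intro ci continuous_on_diff continuous_on_cauchy_kernel z cu)
    also have "\<dots> = poisson_mean f s z"
    proof (rule cmean_cong)
      have "Re (2 * (a * complex_of_real x) - complex_of_real x) = (2 * Re a - 1) * x" for a x
        by (simp add: algebra_simps)
      then show "Re (2 * ((1 / (1 - z * cnj w)) * ?u w) - ?u w) = poisson_kernel z w * (norm (f (of_real s * w)))\<^sup>2"
        if "norm w = 1" for w
        by (simp only: poisson_kernel_eq[OF z that])
    qed
    finally show ?thesis by simp
  qed
  have "uniform_limit (cball 0 r)
       (poisson_mean f) (\<lambda>z. Re (W z)) (at_left 1)"
    if r: "r < 1" for r
  proof (cases "0 \<le> r")
    case True
    \<comment> \<open>Replacing |z| by \<open>r\<close> gives one error bound for the whole disk,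
      which tends to 0 by dominated convergence.\<close>
    define \<epsilon> where "\<epsilon> s = 2 * (\<Sum>m. r ^ m * norm (\<beta> m s - b m)) + norm (\<beta> 0 s - b 0)" for s
    have dif: "norm (\<beta> m s - b m) \<le> 2 * M" if "0 < s" "s < 1" for m s
      using norm_triangle_ineq4[of "\<beta> m s" "b m"] \<beta>_le[OF that, of m] b_le[of m] by simp
    have sr: "summable (\<lambda>m. r ^ m * (2 * M))"
      using True r by (intro summable_mult2 summable_geometric) auto
    have bd: "norm (r ^ m * norm (\<beta> m s - b m)) \<le> r ^ m * (2 * M)" if "0 < s" "s < 1" for m s
      using dif[OF that] True by (simp add: abs_mult mult_left_mono)
    have "((\<lambda>s. norm (\<beta> m s - b m)) \<longlongrightarrow> norm (b m - b m)) (at_left 1)" for m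
      by (intro tendsto_intros b)
    then have z0: "((\<lambda>s. norm (\<beta> m s - b m)) \<longlongrightarrow> 0) (at_left 1)" for m by simp
    have "((\<lambda>s. \<Sum>m. r ^ m * norm (\<beta> m s - b m)) \<longlongrightarrow> (\<Sum>m. r ^ m * 0)) (at_left 1)"
      by (rule tannery_at_left(2)[OF _ bd sr]) (intro tendsto_mult tendsto_const z0)
    from tendsto_add[OF tendsto_mult[OF tendsto_const[of 2] this] z0[of 0]]
    have \<epsilon>: "(\<epsilon> \<longlongrightarrow> 0) (at_left 1)" by (simp add: \<epsilon>_def[abs_def])
    have le: "\<bar>poisson_mean f s z - Re (W z)\<bar> \<le> \<epsilon> s"
      if z: "z \<in> cball 0 r" and s: "0 < s" "s < 1" for z s
    proof -
      have nz: "norm z < 1" "norm z \<le> r" using z r by auto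
      have sm: "summable (\<lambda>m. norm (z ^ m * (\<beta> m s - b m)))" by (rule summ[OF nz(1) dif[OF s]])
      have s1: "summable (\<lambda>m. z ^ m * \<beta> m s)" by (rule summable_norm_cancel[OF summ[OF nz(1) \<beta>_le[OF s]]])
      have s2: "summable (\<lambda>m. z ^ m * b m)" by (rule summable_norm_cancel[OF summ[OF nz(1) b_le]])
      have "(\<Sum>m. z ^ m * \<beta> m s) - (\<Sum>m. z ^ m * b m) = (\<Sum>m. z ^ m * (\<beta> m s - b m))"
        by (simp add: suminf_diff[OF s1 s2] right_diff_distrib)
      then have "2 * (\<Sum>m. z ^ m * \<beta> m s) - \<beta> 0 s - W z = 2 * (\<Sum>m. z ^ m * (\<beta> m s - b m)) - (\<beta> 0 s - b 0)"
        by (simp add: W_def algebra_simps)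
      then have "\<bar>Re (2 * (\<Sum>m. z ^ m * \<beta> m s) - \<beta> 0 s) - Re (W z)\<bar> \<le> norm (2 * (\<Sum>m. z ^ m * (\<beta> m s - b m)) - (\<beta> 0 s - b 0))"
        by (metis abs_Re_le_cmod minus_complex.sel(1))
      also have "\<dots> \<le> 2 * norm (\<Sum>m. z ^ m * (\<beta> m s - b m)) + norm (\<beta> 0 s - b 0)"
        using norm_triangle_ineq4[of "2 * (\<Sum>m. z ^ m * (\<beta> m s - b m))" "\<beta> 0 s - b 0"] by (simp add: norm_mult)
      also have "norm (\<Sum>m. z ^ m * (\<beta> m s - b m)) \<le> (\<Sum>m. norm (z ^ m * (\<beta> m s - b m)))"
        by (rule summable_norm[OF sm])
      also have "\<dots> \<le> (\<Sum>m. r ^ m * norm (\<beta> m s - b m))"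
      proof (rule suminf_le[OF _ sm])
        show "norm (z ^ m * (\<beta> m s - b m)) \<le> r ^ m * norm (\<beta> m s - b m)" for m
          unfolding norm_mult norm_power using nz by (intro mult_right_mono power_mono) auto
        show "summable (\<lambda>m. r ^ m * norm (\<beta> m s - b m))"
          by (rule summable_comparison_test[OF _ sr]) (use bd[OF s] in auto)
      qed
      finally show ?thesis unfolding P[OF nz(1) s] by (simp add: \<epsilon>_def)
    qed
    show ?thesis
    proof (rule uniform_limitI)
      fix e :: real assume "e > 0"
      then have "\<forall>\<^sub>F s in at_left 1. \<epsilon> s < e" by (rule order_tendstoD(2)[OF \<epsilon>])
      with eventually_at_left_1
      show "\<forall>\<^sub>F s in at_left 1. \<forall>z\<in>cball 0 r. dist (poisson_mean f s z) (Re (W z)) < e"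
        by eventually_elim (use le in \<open>force simp: dist_real_def\<close>)
    qed
  qed (simp add: uniform_limit_iff)
  then show ?thesis using that hW by blast
qed

text \<open>The variance of w -> f(s w) under the probability density
  \<open>poisson_kernel z\<close>. Built from increments, it is visibly nonnegative and passes
  through convolutions; its limit as s -> 1 is \<open>garsia f z\<close>.\<close>

definition poisson_variance :: "real \<Rightarrow> (complex \<Rightarrow> complex) \<Rightarrow> complex \<Rightarrow> real" where
  "poisson_variance s f z =
     cmean (\<lambda>w. poisson_kernel z w * (norm (f (of_real s * w) - f (of_real s * z)))\<^sup>2)"

lemma continuous_on_poisson_variance_integrand:
  assumes "f holomorphic_on ball 0 1" "norm z < 1" "0 \<le> s" "s < 1"
  shows "circ_continuous (\<lambda>w. poisson_kernel z w * (norm (f (of_real s * w) - a))\<^sup>2)"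
  using assms by (intro continuous_intros continuous_on_poisson_kernel dilate_continuous_sphere) auto

lemma poisson_variance_nonneg:
  assumes "f holomorphic_on ball 0 1" "norm z < 1" "0 \<le> s" "s < 1"
  shows "poisson_variance s f z \<ge> 0"
  unfolding poisson_variance_def
  by (intro cmean_nonneg continuous_on_poisson_variance_integrand assms mult_nonneg_nonneg poisson_kernel_nonneg) auto

text \<open>Expanding the square, the cross term is evaluated by \<open>poisson_reproduces\<close>
  and the constant term by total mass 1.\<close>

lemma poisson_variance_eq:
  assumes f: "f holomorphic_on ball 0 1" and z: "norm z < 1" and s: "0 \<le> s" "s < 1"
  shows "poisson_variance s f z
       = poisson_mean f s z - (norm (f (of_real s * z)))\<^sup>2"
proof -
  let ?f = "\<lambda>w. f (of_real s * w)" and ?b = "f (of_real s * z)"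
  have ns: "norm (complex_of_real s) < 1" "norm (complex_of_real s) \<le> 1" using s by auto
  have cf: "circ_continuous ?f" by (rule dilate_continuous_sphere[OF f ns(1)])
  note ci = continuous_intros continuous_on_poisson_kernel z cf
  have rep: "cmean (\<lambda>w. of_real (poisson_kernel z w) * ?f w) = ?b"
    by (rule poisson_reproduces[OF dilate_continuous[OF f ns(1)] dilate_holomorphic[OF f ns(2)] z])
  let ?h = "\<lambda>w. Re (cnj ?b * (of_real (poisson_kernel z w) * ?f w))"
  have "cmean (\<lambda>w. ?h w) = Re (cnj ?b * ?b)"
    by (subst cmean_Re, intro ci, subst cmean_cmult, intro ci) (simp add: rep)
  moreover have "Re (cnj ?b * ?b) = (norm ?b)\<^sup>2"
    unfolding cmod_power2 by (simp add: power2_eq_square)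
  ultimately have 1: "cmean (\<lambda>w. ?h w) = (norm ?b)\<^sup>2"
    by (simp only:)
  have "poisson_variance s f z = cmean (\<lambda>w. (poisson_kernel z w * (norm (?f w))\<^sup>2
      - 2 * ?h w) + (norm ?b)\<^sup>2 * poisson_kernel z w)"
    unfolding poisson_variance_def cmod_power2 by (rule cmean_cong) (simp add: power2_eq_square algebra_simps)
  also have "\<dots> = (cmean (\<lambda>w. poisson_kernel z w * (norm (?f w))\<^sup>2) - 2 * (norm ?b)\<^sup>2) + (norm ?b)\<^sup>2 * 1"
  proof -
    have c: "circ_continuous (\<lambda>w. poisson_kernel z w * (norm (?f w))\<^sup>2)"
      "circ_continuous (\<lambda>w. ?h w)"
      "circ_continuous (\<lambda>w. 2 * ?h w)"
      "circ_continuous (\<lambda>w. poisson_kernel z w * (norm (?f w))\<^sup>2 - 2 * ?h w)"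
      "circ_continuous (\<lambda>w. (norm ?b)\<^sup>2 * poisson_kernel z w)"
      by (intro ci)+
    show ?thesis
      by (simp only: cmean_add[OF c(4,5)] cmean_diff[OF c(1,3)] cmean_real_cmult[OF c(2)] 1
          cmean_real_cmult[OF continuous_on_poisson_kernel[OF z]] cmean_poisson_kernel[OF z])
  qed
  finally show ?thesis by simp
qed

text \<open>Rotation carries the base point to another point of the same circle. Hence the
  convolution bounds need \<open>f\<close> only on |w| = |z|, which is what transfers smallness near
  the boundary.\<close>

lemma poisson_variance_rotate:
  assumes f: "f holomorphic_on ball 0 1" and z: "norm z < 1" and s: "0 \<le> s" "s < 1" and u: "norm u = 1"
  shows "cmean (\<lambda>w. poisson_kernel z w * (norm (f (of_real s * (u * w)) - f (of_real s * (u * z))))\<^sup>2)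
       = poisson_variance s f (u * z)"
proof -
  have uz: "norm (u * z) < 1" using u z by (simp add: norm_mult)
  let ?D = "\<lambda>w. (norm (f (of_real s * (u * w)) - f (of_real s * (u * z))))\<^sup>2"
  have "cmean (\<lambda>w. poisson_kernel z w * ?D w)
      = cmean (\<lambda>w. poisson_kernel (u * z) (u * w) * ?D w)"
    by (simp add: poisson_kernel_rotate[OF u])
  also have "\<dots> = poisson_variance s f (u * z)"
    unfolding poisson_variance_def
    by (rule cmean_rotate[OF continuous_on_poisson_variance_integrand[OF f uz s] u])
  finally show ?thesis .
qed

section \<open>From Poisson variances to the Garsia quantity\<close>

lemma H2_holomorphic: "f \<in> H2 \<Longrightarrow> f holomorphic_on ball 0 1"
  by (simp add: H2_def unit_disk_def)

lemma H2_bound: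
  assumes "f \<in> H2"
  obtains M where "\<And>s. 0 \<le> s \<Longrightarrow> s < 1 \<Longrightarrow> mean_square f s \<le> M"
proof -
  obtain M where "\<forall>s\<in>{0..<1}. mean_square f s \<le> M"
    using assms by (auto simp: H2_def int_mean_2 bdd_above_def)
  then show ?thesis by (intro that[of M]) auto
qed

lemma H2_I:
  assumes "f holomorphic_on ball 0 1"
    "\<And>s. 0 \<le> s \<Longrightarrow> s < 1 \<Longrightarrow> mean_square f s \<le> M"
  shows "f \<in> H2"
  using assms by (auto simp: H2_def unit_disk_def int_mean_2 intro!: bdd_aboveI[of _ M])

text \<open>Convergence gives the \<open>Lim\<close> in the definition its meaning. The
  representation by a holomorphic \<open>W\<close> is kept, so that |f|^2 plus
  \<open>garsia f\<close> is known to be harmonic.\<close>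

lemma poisson_abs2_eq:
  assumes "f \<in> H2"
  obtains W where "W holomorphic_on ball 0 1" "\<And>z. norm z < 1 \<Longrightarrow> poisson_abs2 f z = Re (W z)"
    "\<And>r. r < 1 \<Longrightarrow> uniform_limit (cball 0 r)
       (poisson_mean f) (poisson_abs2 f) (at_left 1)"
proof -
  obtain M where "\<And>s. 0 \<le> s \<Longrightarrow> s < 1 \<Longrightarrow> mean_square f s \<le> M"
    using H2_bound[OF assms] by blast
  then obtain W where W: "W holomorphic_on ball 0 1"
    and lim: "\<And>r. r < 1 \<Longrightarrow> uniform_limit (cball 0 r)
       (poisson_mean f) (\<lambda>z. Re (W z)) (at_left 1)"
    using Poisson_integral_limit[OF H2_holomorphic[OF assms]] by blast
  have eq: "poisson_abs2 f z = Re (W z)" if "norm z < 1" for z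
  proof -
    have "((\<lambda>s. poisson_mean f s z) \<longlongrightarrow> Re (W z)) (at_left 1)"
      by (rule tendsto_uniform_limitI[OF lim[OF that]]) simp
    from tendsto_Lim[OF _ this] show ?thesis
      by (simp add: poisson_abs2_def cmean_def poisson_kernel_def)
  qed
  show ?thesis
  proof (rule that[OF W eq])
    fix r :: real assume r: "r < 1"
    show "uniform_limit (cball 0 r)
       (poisson_mean f) (poisson_abs2 f) (at_left 1)"
      using lim[OF r] by (rule uniform_limit_cong'[THEN iffD1, rotated 2]) (use eq r in auto)
  qed
qed

lemma dilate_uniform_limit:
  assumes f: "f holomorphic_on ball 0 1" and r: "r < 1"
  shows "uniform_limit (cball 0 r) (\<lambda>s z. f (of_real s * z)) f (at_left 1)"
proof (rule uniform_limitI)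
  fix e :: real assume e: "e > 0"
  have "continuous_on (cball 0 r) f"
    by (rule continuous_on_subset[OF holomorphic_on_imp_continuous_on[OF f]]) (use r in auto)
  from compact_uniformly_continuous[OF this compact_cball] e
  obtain d where d: "d > 0" "\<And>x y. x \<in> cball 0 r \<Longrightarrow> y \<in> cball 0 r \<Longrightarrow> dist y x < d \<Longrightarrow> dist (f y) (f x) < e"
    unfolding uniformly_continuous_on_def by metis
  have "\<forall>\<^sub>F s in at_left (1::real). 1 - d < s"
    using eventually_at_left_real[of "1 - d" 1] d(1) by (auto elim: eventually_mono)
  with eventually_at_left_1 show "\<forall>\<^sub>F s in at_left 1. \<forall>z\<in>cball 0 r. dist (f (of_real s * z)) (f z) < e"
  proof eventually_elim
    case (elim s)
    show ?case
    proof
      fix z :: complex assume z: "z \<in> cball 0 r"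
      have sz: "norm (of_real s * z) \<le> norm z" using elim by (simp add: norm_mult mult_left_le_one_le)
      have "of_real s * z - z = of_real (s - 1) * z" by (simp add: algebra_simps)
      then have "dist (of_real s * z) z = (1 - s) * norm z"
        using elim by (simp only: dist_norm norm_mult norm_of_real) simp
      also have "\<dots> \<le> (1 - s) * 1" using elim z r by (intro mult_left_mono) auto
      finally show "dist (f (of_real s * z)) (f z) < e" using d(2)[of z "of_real s * z"] z sz elim by auto
    qed
  qed
qed

lemma garsia_uniform_limit:
  assumes f: "f \<in> H2" and r: "r < 1"
  shows "uniform_limit (cball 0 r) (\<lambda>s z. poisson_variance s f z) (garsia f) (at_left 1)"
proof -
  note hf = H2_holomorphic[OF f]
  have "continuous_on (cball 0 r) f"
    by (rule continuous_on_subset[OF holomorphic_on_imp_continuous_on[OF hf]]) (use r in auto)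
  then have b: "bounded ((\<lambda>z. norm (f z)) ` cball 0 r)"
    by (intro compact_imp_bounded compact_continuous_image continuous_intros) auto
  have "uniform_limit (cball 0 r) (\<lambda>s z. norm (f (of_real s * z)) * norm (f (of_real s * z)))
      (\<lambda>z. norm (f z) * norm (f z)) (at_left 1)"
    by (intro uniform_lim_mult uniform_limit_norm dilate_uniform_limit[OF hf r] b)
  then have 1: "uniform_limit (cball 0 r) (\<lambda>s z. (norm (f (of_real s * z)))\<^sup>2) (\<lambda>z. (norm (f z))\<^sup>2) (at_left 1)"
    by (simp add: power2_eq_square)
  obtain W where W: "W holomorphic_on ball 0 1" "\<And>z. norm z < 1 \<Longrightarrow> poisson_abs2 f z = Re (W z)"
    "\<And>r. r < 1 \<Longrightarrow> uniform_limit (cball 0 r)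
       (poisson_mean f) (poisson_abs2 f) (at_left 1)"
    using poisson_abs2_eq[OF f] by blast
  have 2: "uniform_limit (cball 0 r) (\<lambda>s z. poisson_mean f s z - (norm (f (of_real s * z)))\<^sup>2)
     (garsia f) (at_left 1)"
    unfolding garsia_def[abs_def] by (intro uniform_limit_minus W r 1)
  show ?thesis
  proof (rule uniform_limitI)
    fix e :: real assume "e > 0"
    from uniform_limitD[OF 2 this] eventually_at_left_1
    show "\<forall>\<^sub>F s in at_left 1. \<forall>z\<in>cball 0 r. dist (poisson_variance s f z) (garsia f z) < e"
      by eventually_elim (use r in \<open>auto simp: poisson_variance_eq[OF hf]\<close>)
  qed
qed

lemma garsia_limit:
  assumes "f \<in> H2" "norm z < 1"
  shows "((\<lambda>s. poisson_variance s f z) \<longlongrightarrow> garsia f z) (at_left 1)"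
  by (rule tendsto_uniform_limitI[OF garsia_uniform_limit[OF assms]]) simp

lemma garsia_eq:
  assumes "f \<in> H2"
  obtains W where "W holomorphic_on ball 0 1"
    "\<And>z. norm z < 1 \<Longrightarrow> garsia f z = Re (W z) - (norm (f z))\<^sup>2"
  using poisson_abs2_eq[OF assms] unfolding garsia_def by metis

lemma garsia_nonneg:
  assumes "f \<in> H2" "norm z < 1"
  shows "garsia f z \<ge> 0"
  by (rule tendsto_lowerbound[OF garsia_limit[OF assms] eventually_mono[OF eventually_at_left_1]])
     (use poisson_variance_nonneg[OF H2_holomorphic[OF assms(1)] assms(2)] in auto)

text \<open>|f(z)|^2 is dropped and the kernel bounded by its maximum. The factor blows up at the
  circle, so this serves the smaller disk, where the VMOA condition gives no smallness.\<close>

lemma garsia_le_mean_square: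
  assumes f: "f \<in> H2" and z: "norm z < 1"
    and M: "\<And>s. 0 \<le> s \<Longrightarrow> s < 1 \<Longrightarrow> mean_square f s \<le> M"
  shows "garsia f z \<le> (1 + norm z) / (1 - norm z) * M"
proof (rule tendsto_at_left_le[OF garsia_limit[OF f z]])
  fix s :: real assume s: "0 \<le> s" "s < 1"
  note hf = H2_holomorphic[OF f]
  have cf: "circ_continuous (\<lambda>w. f (of_real s * w))"
    by (rule dilate_continuous_sphere[OF hf]) (use s in auto)
  have "poisson_variance s f z \<le> poisson_mean f s z"
    by (simp add: poisson_variance_eq[OF hf z s])
  also have "\<dots> \<le> cmean (\<lambda>w. (1 + norm z) / (1 - norm z) * (norm (f (of_real s * w)))\<^sup>2)"
    by (intro cmean_mono mult_right_mono poisson_kernel_le z)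
       (use z in \<open>auto intro!: continuous_intros continuous_on_poisson_kernel cf\<close>)
  also have "\<dots> = (1 + norm z) / (1 - norm z) * cmean (\<lambda>w. (norm (f (of_real s * w)))\<^sup>2)"
    by (intro cmean_real_cmult continuous_intros cf)
  also have "\<dots> \<le> (1 + norm z) / (1 - norm z) * M"
    using z by (intro mult_left_mono M s) auto
  finally show "poisson_variance s f z \<le> (1 + norm z) / (1 - norm z) * M" .
qed

lemma norm_diff_square_le: "(norm (a - b))\<^sup>2 \<le> 2 * (norm a)\<^sup>2 + 2 * (norm (b :: complex))\<^sup>2"
proof -
  have "(norm (a - b))\<^sup>2 \<le> (norm a + norm b)\<^sup>2" by (intro power_mono norm_triangle_ineq4) auto
  moreover have "0 \<le> (norm a - norm b)\<^sup>2" by simp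
  ultimately show ?thesis unfolding power2_sum power2_diff by linarith
qed

lemma H2_diff:
  assumes f: "f \<in> H2" and g: "g \<in> H2"
  shows "(\<lambda>z. f z - g z) \<in> H2"
proof -
  obtain M where M: "\<And>s. 0 \<le> s \<Longrightarrow> s < 1 \<Longrightarrow> mean_square f s \<le> M"
    using H2_bound[OF f] by blast
  obtain L where L: "\<And>s. 0 \<le> s \<Longrightarrow> s < 1 \<Longrightarrow> mean_square g s \<le> L"
    using H2_bound[OF g] by blast
  show ?thesis
  proof (rule H2_I)
    show "(\<lambda>z. f z - g z) holomorphic_on ball 0 1" by (intro holomorphic_intros H2_holomorphic f g)
    fix s :: real assume s: "0 \<le> s" "s < 1"
    have c: "circ_continuous (\<lambda>w. f (of_real s * w))" "circ_continuous (\<lambda>w. g (of_real s * w))"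
      using s by (auto intro!: dilate_continuous_sphere H2_holomorphic f g)
    have "cmean (\<lambda>z. (norm (f (of_real s * z) - g (of_real s * z)))\<^sup>2)
        \<le> cmean (\<lambda>z. 2 * (norm (f (of_real s * z)))\<^sup>2 + 2 * (norm (g (of_real s * z)))\<^sup>2)"
      by (intro cmean_mono norm_diff_square_le continuous_intros c)
    also have "\<dots> = 2 * mean_square f s + 2 * mean_square g s"
      by (subst cmean_add, intro continuous_intros c, intro continuous_intros c,
          subst cmean_real_cmult, intro continuous_intros c, subst cmean_real_cmult, intro continuous_intros c, rule refl)
    also have "\<dots> \<le> 2 * M + 2 * L" using M[OF s] L[OF s] by simp
    finally show "cmean (\<lambda>z. (norm (f (of_real s * z) - g (of_real s * z)))\<^sup>2) \<le> 2 * M + 2 * L" .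
  qed
qed

lemma garsia_diff_le:
  assumes f: "f \<in> H2" and g: "g \<in> H2" and z: "norm z < 1"
  shows "garsia (\<lambda>z. f z - g z) z \<le> 2 * garsia f z + 2 * garsia g z"
proof (rule tendsto_le[OF _ _ garsia_limit[OF H2_diff[OF f g] z]])
  show "((\<lambda>s. 2 * poisson_variance s f z + 2 * poisson_variance s g z) \<longlongrightarrow> 2 * garsia f z + 2 * garsia g z) (at_left 1)"
    by (intro tendsto_intros garsia_limit f g z)
  show "\<forall>\<^sub>F s in at_left 1. poisson_variance s (\<lambda>z. f z - g z) z \<le> 2 * poisson_variance s f z + 2 * poisson_variance s g z"
    using eventually_at_left_1
  proof eventually_elim
    case (elim s)
    then have s: "0 \<le> s" "s < 1" by auto
    let ?F = "\<lambda>w. poisson_kernel z w * (norm (f (of_real s * w) - f (of_real s * z)))\<^sup>2"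
    let ?G = "\<lambda>w. poisson_kernel z w * (norm (g (of_real s * w) - g (of_real s * z)))\<^sup>2"
    let ?D = "\<lambda>w. (norm (f (of_real s * w) - g (of_real s * w) - (f (of_real s * z) - g (of_real s * z))))\<^sup>2"
    have c: "circ_continuous ?F" "circ_continuous ?G"
      by (intro continuous_on_poisson_variance_integrand H2_holomorphic f g z s)+
    have "poisson_variance s (\<lambda>z. f z - g z) z \<le> cmean (\<lambda>w. 2 * ?F w + 2 * ?G w)"
      unfolding poisson_variance_def
    proof (rule cmean_mono)
      show "circ_continuous (\<lambda>w. poisson_kernel z w *
          ?D w)"
        by (rule continuous_on_poisson_variance_integrand[OF H2_holomorphic[OF H2_diff[OF f g]] z s])
      show "circ_continuous (\<lambda>w. 2 * ?F w + 2 * ?G w)" by (intro continuous_intros c)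
      fix w
      have "?D w
          \<le> 2 * (norm (f (of_real s * w) - f (of_real s * z)))\<^sup>2 + 2 * (norm (g (of_real s * w) - g (of_real s * z)))\<^sup>2"
        using norm_diff_square_le[of "f (of_real s * w) - f (of_real s * z)" "g (of_real s * w) - g (of_real s * z)"]
        by (simp add: algebra_simps)
      from mult_left_mono[OF this poisson_kernel_nonneg[OF z, of w]]
      show "poisson_kernel z w * ?D w
         \<le> 2 * ?F w + 2 * ?G w" by (simp add: algebra_simps)
    qed
    also have "\<dots> = 2 * poisson_variance s f z + 2 * poisson_variance s g z"
      unfolding poisson_variance_def
      by (subst cmean_add, intro continuous_intros c, intro continuous_intros c,
          subst cmean_real_cmult, rule c, subst cmean_real_cmult, rule c, rule refl)
    finally show ?case .
  qed
qed simp

section \<open>Convolution operators\<close>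

lemma continuous_on_sphere_times:
  assumes f: "f holomorphic_on ball 0 1" and s: "0 \<le> s" "s < 1"
  shows "torus_continuous (\<lambda>(x, y). f (of_real s * (x * y)))"
proof -
  have "torus_continuous (\<lambda>p. f (of_real s * (fst p * snd p)))"
    by (rule continuous_on_compose2[OF holomorphic_on_imp_continuous_on[OF f]])
       (use s in \<open>auto intro!: continuous_intros simp: norm_mult\<close>)
  then show ?thesis by (simp add: case_prod_unfold)
qed

lemma continuous_on_fst_snd:
  assumes "continuous_on S f"
  shows "continuous_on (S \<times> T) (\<lambda>(x, y). f x)" "continuous_on (T \<times> S) (\<lambda>(x, y). f y)"
proof -
  have "continuous_on (S \<times> T) (\<lambda>p. f (fst p))" "continuous_on (T \<times> S) (\<lambda>p. f (snd p))"
    by (rule continuous_on_compose2[OF assms]; auto intro!: continuous_intros)+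
  then show "continuous_on (S \<times> T) (\<lambda>(x, y). f x)" "continuous_on (T \<times> S) (\<lambda>(x, y). f y)"
    by (simp_all add: case_prod_unfold)
qed

text \<open>Convolution on the circle group, later instantiated with the normalized Cesaro kernel.
  The estimates see \<open>\<kappa>\<close> only through \<open>C\<close>, which makes them uniform
  in the order of the mean.\<close>

locale convolution =
  fixes \<kappa> :: "complex \<Rightarrow> complex" and C :: real and f g :: "complex \<Rightarrow> complex"
  assumes cont: "circ_continuous \<kappa>" and L1: "cmean (\<lambda>u. norm (\<kappa> u)) \<le> C"
    and f: "f holomorphic_on ball 0 1" and g: "g holomorphic_on ball 0 1"
    and conv: "\<And>w. norm w < 1 \<Longrightarrow> g w = cmean (\<lambda>u. f (w * u) * \<kappa> u)"
begin

lemma C_nonneg: "C \<ge> 0"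
  using L1 cmean_nonneg[of "\<lambda>u. norm (\<kappa> u)"] cont by (fastforce intro: continuous_intros)

lemma cont2:
  assumes "0 \<le> s" "s < 1"
  shows "torus_continuous (\<lambda>p. f (of_real s * (fst p * snd p)))"
    "torus_continuous (\<lambda>p. \<kappa> (fst p))"
    "torus_continuous (\<lambda>p. \<kappa> (snd p))"
  using continuous_on_sphere_times[OF f assms] continuous_on_fst_snd[OF cont, of "sphere 0 1"]
  by (simp_all add: case_prod_unfold)

text \<open>Young's inequality on one circle: exchange the two means, then use rotation invariance
  of the inner one.\<close>

lemma mean_le:
  assumes s: "0 \<le> s" "s < 1" and B: "mean_norm f s \<le> B"
  shows "mean_norm g s \<le> C * B"
proof -
  have ns: "norm (complex_of_real s) < 1" using s by auto
  have cf: "circ_continuous (\<lambda>z. f (of_real s * z))" by (rule dilate_continuous_sphere[OF f ns])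
  have c2: "torus_continuous (\<lambda>(z, u). norm (f (of_real s * (z * u))) * norm (\<kappa> u))"
    unfolding case_prod_unfold by (intro continuous_intros cont2[OF s])
  have cz: "circ_continuous (\<lambda>u. f (of_real s * (z * u)))" if "norm z = 1" for z
    using dilate_continuous_sphere[OF f, of "of_real s * z"] that ns by (simp add: norm_mult mult.assoc)
  have "mean_norm g s \<le> cmean (\<lambda>z. cmean (\<lambda>u. norm (f (of_real s * (z * u))) * norm (\<kappa> u)))"
  proof (rule cmean_mono)
    show "circ_continuous (\<lambda>z. norm (g (of_real s * z)))"
      by (intro continuous_intros dilate_continuous_sphere[OF g ns])
    show "circ_continuous (\<lambda>z. cmean (\<lambda>u. norm (f (of_real s * (z * u))) * norm (\<kappa> u)))"
      by (rule continuous_on_cmean[OF c2])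
    fix z :: complex assume z: "norm z = 1"
    have "norm (g (of_real s * z)) \<le> cmean (\<lambda>u. norm (f (of_real s * z * u) * \<kappa> u))"
      using cmean_norm_le[OF continuous_on_mult[OF cz[OF z] cont]] conv[of "of_real s * z"] z ns
      by (simp add: norm_mult mult.assoc)
    then show "norm (g (of_real s * z)) \<le> cmean (\<lambda>u. norm (f (of_real s * (z * u))) * norm (\<kappa> u))"
      by (simp add: norm_mult mult.assoc)
  qed
  also have "\<dots> = cmean (\<lambda>u. cmean (\<lambda>z. norm (f (of_real s * (z * u))) * norm (\<kappa> u)))"
    by (rule cmean_swap[OF c2])
  also have "\<dots> = cmean (\<lambda>u. mean_norm f s * norm (\<kappa> u))"
  proof (rule cmean_cong)
    fix u :: complex assume u: "norm u = 1"
    have "cmean (\<lambda>z. norm (\<kappa> u) * norm (f (of_real s * (z * u)))) = norm (\<kappa> u) * cmean (\<lambda>z. norm (f (of_real s * (z * u))))"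
      by (intro cmean_real_cmult continuous_intros) (use cz[OF u] in \<open>simp add: mult.commute\<close>)
    also have "cmean (\<lambda>z. norm (f (of_real s * (z * u)))) = mean_norm f s"
      using cmean_rotate[OF continuous_on_norm[OF cf] u] by (simp add: mult_ac)
    finally show "cmean (\<lambda>z. norm (f (of_real s * (z * u))) * norm (\<kappa> u)) = mean_norm f s * norm (\<kappa> u)"
      by (simp add: mult.commute)
  qed
  also have "\<dots> = mean_norm f s * cmean (\<lambda>u. norm (\<kappa> u))"
    by (intro cmean_real_cmult continuous_intros cont)
  also have "\<dots> \<le> B * C"
  proof (rule mult_mono[OF B L1])
    show "0 \<le> B" by (rule order_trans[OF cmean_nonneg B]) (auto intro!: continuous_intros cf)
  qed (auto intro!: continuous_intros cmean_nonneg cont)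
  finally show ?thesis by (simp add: mult.commute)
qed

text \<open>Cauchy--Schwarz with respect to the measure \<open>\<bar>\<kappa>\<bar>\<close> replaces Minkowski's integral inequality.\<close>

lemma poisson_variance_le:
  assumes s: "0 \<le> s" "s < 1" and z: "norm z < 1"
    and S: "\<And>w. norm w = norm z \<Longrightarrow> poisson_variance s f w \<le> S"
  shows "poisson_variance s g z \<le> C * C * S"
proof -
  have ns: "norm (complex_of_real s) < 1" using s by auto
  have sw: "norm (of_real s * w) < 1" if "norm w \<le> 1" for w :: complex using disk_mult_le[OF ns that] .
  have cz: "circ_continuous (\<lambda>u. f (of_real s * (w * u)))" if "norm w \<le> 1" for w :: complex
    using dilate_continuous_sphere[OF f sw[OF that]] by (simp add: mult.assoc)
  let ?D = "\<lambda>w u. f (of_real s * (w * u)) - f (of_real s * (z * u))"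
  let ?J = "\<lambda>w u. poisson_kernel z w * ((norm (?D w u))\<^sup>2 * norm (\<kappa> u))"
  have cD: "torus_continuous (\<lambda>p. ?D (fst p) (snd p))"
    using continuous_on_fst_snd(2)[OF cz, of z "sphere 0 1"] z
    by (intro continuous_intros cont2[OF s]) (auto simp: case_prod_unfold)
  have cP: "torus_continuous (\<lambda>p. poisson_kernel z (fst p))"
    using continuous_on_fst_snd(1)[OF continuous_on_poisson_kernel[OF z], of "sphere 0 1"] by (simp add: case_prod_unfold)
  have c2: "torus_continuous (\<lambda>(w, u). ?J w u)"
    unfolding case_prod_unfold by (intro continuous_intros cD cP cont2[OF s])
  have key: "(norm (g (of_real s * w) - g (of_real s * z)))\<^sup>2 \<le> C * cmean (\<lambda>u. (norm (?D w u))\<^sup>2 * norm (\<kappa> u))"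
    if w: "norm w = 1" for w
  proof -
    have cDw: "circ_continuous (?D w)" by (intro continuous_intros cz) (use w z in auto)
    have "g (of_real s * w) - g (of_real s * z)
        = cmean (\<lambda>u. f (of_real s * (w * u)) * \<kappa> u - f (of_real s * (z * u)) * \<kappa> u)"
      using conv[OF sw, of w] conv[OF sw, of z] w z
      by (subst cmean_diff) (auto intro!: continuous_on_mult cz cont simp: mult.assoc)
    also have "\<dots> = cmean (\<lambda>u. ?D w u * \<kappa> u)" by (simp add: left_diff_distrib)
    finally have "norm (g (of_real s * w) - g (of_real s * z)) \<le> cmean (\<lambda>u. norm (?D w u * \<kappa> u))"
      using cmean_norm_le[OF continuous_on_mult[OF cDw cont]] by simp
    \<comment> \<open>|\<kappa>| is split into two square roots; one stays with the increment, the
      other contributes a factor at most \<open>C\<close>.\<close>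
    also have "\<dots> = cmean (\<lambda>u. (norm (?D w u) * sqrt (norm (\<kappa> u))) * sqrt (norm (\<kappa> u)))"
      by (simp add: norm_mult mult.assoc)
    finally have "(norm (g (of_real s * w) - g (of_real s * z)))\<^sup>2
        \<le> (cmean (\<lambda>u. (norm (?D w u) * sqrt (norm (\<kappa> u))) * sqrt (norm (\<kappa> u))))\<^sup>2"
      by (intro power_mono) auto
    also have "\<dots> \<le> cmean (\<lambda>u. (norm (?D w u) * sqrt (norm (\<kappa> u)))\<^sup>2) * cmean (\<lambda>u. (sqrt (norm (\<kappa> u)))\<^sup>2)"
      by (intro cmean_Cauchy_Schwarz continuous_on_mult continuous_on_norm continuous_on_real_sqrt cDw cont)
    also have "\<dots> = cmean (\<lambda>u. (norm (?D w u))\<^sup>2 * norm (\<kappa> u)) * cmean (\<lambda>u. norm (\<kappa> u))"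
      by (simp add: power_mult_distrib)
    also have "\<dots> \<le> cmean (\<lambda>u. (norm (?D w u))\<^sup>2 * norm (\<kappa> u)) * C"
      by (intro mult_left_mono L1 cmean_nonneg continuous_on_mult continuous_on_norm continuous_on_power cDw cont) auto
    finally show ?thesis by (simp add: mult.commute)
  qed
  have cin: "circ_continuous (\<lambda>w. cmean (\<lambda>u. ?J w u))"
    by (rule continuous_on_cmean[OF c2])
  have "poisson_variance s g z \<le> cmean (\<lambda>w. C * cmean (\<lambda>u. ?J w u))"
    unfolding poisson_variance_def
  proof (rule cmean_mono[OF continuous_on_poisson_variance_integrand[OF g z s]])
    show "circ_continuous (\<lambda>w. C * cmean (\<lambda>u. ?J w u))"
      by (intro continuous_on_mult continuous_on_const cin)
    fix w :: complex assume w: "norm w = 1"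
    have "cmean (\<lambda>u. ?J w u)
        = poisson_kernel z w * cmean (\<lambda>u. (norm (?D w u))\<^sup>2 * norm (\<kappa> u))"
      by (intro cmean_real_cmult continuous_intros cz cont) (use w z in auto)
    then show "poisson_kernel z w * (norm (g (of_real s * w) - g (of_real s * z)))\<^sup>2
        \<le> C * cmean (\<lambda>u. ?J w u)"
      using mult_left_mono[OF key[OF w] poisson_kernel_nonneg[OF z, of w]] by (simp add: mult_ac)
  qed
  also have "\<dots> = C * cmean (\<lambda>w. cmean (\<lambda>u. ?J w u))"
    by (rule cmean_real_cmult[OF cin])
  finally have le: "poisson_variance s g z
      \<le> C * cmean (\<lambda>w. cmean (\<lambda>u. ?J w u))" .
  \<comment> \<open>After the exchange, the inner mean for fixed \<open>u\<close> is |\<kappa> u|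
    times the variance of \<open>f\<close> at \<open>u * z\<close>, where \<open>S\<close> applies
    because |u z| = |z|. The outer mean yields the second factor \<open>C\<close>.\<close>
  have "cmean (\<lambda>w. cmean (\<lambda>u. ?J w u))
      = cmean (\<lambda>u. cmean (\<lambda>w. ?J w u))"
    by (rule cmean_swap[OF c2])
  also have "\<dots> \<le> cmean (\<lambda>u. S * norm (\<kappa> u))"
  proof (rule cmean_mono)
    have "torus_continuous (\<lambda>(u, w). ?J w u)"
    proof -
      have "torus_continuous (\<lambda>p. (\<lambda>(w, u). ?J w u) (snd p, fst p))"
        by (rule continuous_on_compose2[OF c2]) (auto intro!: continuous_intros)
      then show ?thesis by (simp add: case_prod_unfold)
    qed
    then show "circ_continuous (\<lambda>u. cmean (\<lambda>w. ?J w u))"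
      by (rule continuous_on_cmean)
    show "circ_continuous (\<lambda>u. S * norm (\<kappa> u))" by (intro continuous_intros cont)
    fix u :: complex assume u: "norm u = 1"
    have "cmean (\<lambda>w. ?J w u)
        = cmean (\<lambda>w. norm (\<kappa> u) * (poisson_kernel z w * (norm (f (of_real s * (u * w)) - f (of_real s * (u * z))))\<^sup>2))"
      by (simp add: mult_ac)
    also have "\<dots> = norm (\<kappa> u) * cmean (\<lambda>w. poisson_kernel z w * (norm (f (of_real s * (u * w)) - f (of_real s * (u * z))))\<^sup>2)"
      by (intro cmean_real_cmult continuous_intros continuous_on_poisson_kernel z cz) (use u in auto)
    also have "\<dots> = norm (\<kappa> u) * poisson_variance s f (u * z)"
      by (simp add: poisson_variance_rotate[OF f z s u])
    also have "\<dots> \<le> norm (\<kappa> u) * S"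
      using u by (intro mult_left_mono S) (auto simp: norm_mult)
    finally show "cmean (\<lambda>w. ?J w u) \<le> S * norm (\<kappa> u)"
      by (simp add: mult.commute)
  qed
  also have "cmean (\<lambda>u. S * norm (\<kappa> u)) = S * cmean (\<lambda>u. norm (\<kappa> u))"
    by (intro cmean_real_cmult continuous_intros cont)
  also have "\<dots> \<le> S * C"
    using order_trans[OF poisson_variance_nonneg[OF f z s] S] by (intro mult_left_mono L1) auto
  finally have "cmean (\<lambda>w. cmean (\<lambda>u. ?J w u)) \<le> S * C" .
  from order_trans[OF le mult_left_mono[OF this C_nonneg]] show ?thesis by (simp add: mult_ac)
qed

text \<open>\<open>S\<close> bounds the limits and not the variances at a given radius. Uniform
  convergence makes one \<open>s\<close> good for all points of the circle up to \<open>e\<close>,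
  and \<open>e\<close> is then removed.\<close>

lemma garsia_le:
  assumes fH: "f \<in> H2" and gH: "g \<in> H2" and z: "norm z < 1"
    and S: "\<And>w. norm w = norm z \<Longrightarrow> garsia f w \<le> S"
  shows "garsia g z \<le> C * C * S"
proof -
  have "garsia g z \<le> C * C * (S + e)" if e: "e > 0" for e
  proof (rule tendsto_upperbound[OF garsia_limit[OF gH z]])
    from uniform_limitD[OF garsia_uniform_limit[OF fH z] e] eventually_at_left_1
    show "\<forall>\<^sub>F s in at_left 1. poisson_variance s g z \<le> C * C * (S + e)"
    proof eventually_elim
      case (elim s)
      show ?case
      proof (rule poisson_variance_le[OF _ _ z])
        fix w :: complex assume w: "norm w = norm z"
        then have "dist (poisson_variance s f w) (garsia f w) < e" using elim by simp
        then show "poisson_variance s f w \<le> S + e" using S[OF w] by (simp add: dist_real_def)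
      qed (use elim in auto)
    qed
  qed simp
  show ?thesis
  proof (rule field_le_epsilon)
    fix d :: real assume d: "d > 0"
    \<comment> \<open>The added 1 keeps the denominator positive even if \<open>C\<close> is
      0.\<close>
    have p: "C * C + 1 > 0" using C_nonneg by (simp add: add_nonneg_pos)
    have "garsia g z \<le> C * C * (S + d / (C * C + 1))"
      using \<open>\<And>e. e > 0 \<Longrightarrow> garsia g z \<le> C * C * (S + e)\<close> d p by simp
    also have "C * C * (d / (C * C + 1)) \<le> d"
      using d p by (simp add: divide_le_eq algebra_simps)
    then have "C * C * (S + d / (C * C + 1)) \<le> C * C * S + d" by (simp add: distrib_left)
    finally show "garsia g z \<le> C * C * S + d" .
  qed
qed

end

section \<open>The duality inequality\<close>

text \<open>The list form allows terms of different shape to be written out and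
  concatenated.\<close>

lemma submean_list:
  fixes L :: "((complex \<Rightarrow> complex) \<times> (complex \<Rightarrow> complex)) list"
  assumes hol: "\<And>v w. (v, w) \<in> set L \<Longrightarrow> v holomorphic_on ball 0 1 \<and> w holomorphic_on ball 0 1"
    and pos: "\<And>z. norm z < 1 \<Longrightarrow> 0 \<le> Re (\<Sum>(v, w)\<leftarrow>L. deriv v z * cnj (deriv w z))"
    and r: "0 \<le> r" "r < 1"
  shows "Re (\<Sum>(v, w)\<leftarrow>L. v 0 * cnj (w 0))
       \<le> Re (cmean (\<lambda>z. \<Sum>(v, w)\<leftarrow>L. v (of_real r * z) * cnj (w (of_real r * z))))"
proof -
  have eq: "(\<Sum>(v, w)\<leftarrow>L. q v w) = (\<Sum>i\<in>{0..<length L}. q (fst (L ! i)) (snd (L ! i)))"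
    for q :: "(complex \<Rightarrow> complex) \<Rightarrow> (complex \<Rightarrow> complex) \<Rightarrow> complex"
    by (simp add: sum_list_sum_nth case_prod_unfold)
  have hol': "fst (L ! i) holomorphic_on ball 0 1" "snd (L ! i) holomorphic_on ball 0 1" if "i \<in> {0..<length L}" for i
    using hol[of "fst (L ! i)" "snd (L ! i)"] that by auto
  show ?thesis unfolding eq
    by (rule submean_hermitian[OF _ hol' _ r]) (use pos in \<open>auto simp: eq\<close>)
qed

text \<open>With \<open>s = \<bar>h\<bar>\<^sup>2 - Re V\<close> the function \<open>\<bar>H\<bar>\<^sup>2 (s\<^sup>2 + c)\<close> is a finite sum of products \<open>v \<sqdot> cnj w\<close>.\<close>

definition hermitian_terms ::
  "real \<Rightarrow> (complex \<Rightarrow> complex) \<Rightarrow> (complex \<Rightarrow> complex) \<Rightarrow> (complex \<Rightarrow> complex) \<Rightarrow>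
   ((complex \<Rightarrow> complex) \<times> (complex \<Rightarrow> complex)) list" where
  "hermitian_terms c h V H =
    [(\<lambda>z. H z * (h z)\<^sup>2, \<lambda>z. H z * (h z)\<^sup>2),
     (\<lambda>z. - (H z * h z * V z), \<lambda>z. H z * h z),
     (\<lambda>z. - (H z * h z), \<lambda>z. H z * h z * V z),
     (\<lambda>z. (1/4) * (H z * (V z)\<^sup>2), H),
     (\<lambda>z. (1/2) * (H z * V z), \<lambda>z. H z * V z),
     (\<lambda>z. (1/4) * H z, \<lambda>z. H z * (V z)\<^sup>2),
     (\<lambda>z. of_real c * H z, H)]"

lemma hermitian_terms_value:
  "(\<Sum>(v, w)\<leftarrow>hermitian_terms c h V H. v z * cnj (w z))
   = of_real ((norm (H z))\<^sup>2 * (((norm (h z))\<^sup>2 - Re (V z))\<^sup>2 + c))"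
proof -
  \<comment> \<open>Conjugates become independent letters, which turns the claim into a polynomial
    identity.\<close>
  define a b d a' b' d' where "a = H z" "b = h z" "d = V z" "a' = cnj (H z)" "b' = cnj (h z)" "d' = cnj (V z)"
  note defs = this
  have R: "complex_of_real (Re (V z)) = (d + d') / 2" by (simp add: defs complex_add_cnj)
  have "(\<Sum>(v, w)\<leftarrow>hermitian_terms c h V H. v z * cnj (w z))
     = a * b\<^sup>2 * (a' * b'\<^sup>2) - a * b * d * (a' * b') - a * b * (a' * b' * d') + (1/4) * (a * d\<^sup>2) * a'
       + (1/2) * (a * d) * (a' * d') + (1/4) * a * (a' * d'\<^sup>2) + of_real c * a * a'"
    by (simp add: hermitian_terms_def defs)
  also have "\<dots> = a * a' * ((b * b' - (d + d') / 2)\<^sup>2 + of_real c)"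
    by (simp add: power2_eq_square field_simps)
  also have "\<dots> = of_real ((norm (H z))\<^sup>2 * (((norm (h z))\<^sup>2 - Re (V z))\<^sup>2 + c))"
    by (simp add: R defs flip: complex_norm_square)
  finally show ?thesis .
qed

text \<open>The right-hand side is a quarter of the Laplacian of |H|^2 (s^2 + c), namely (s^2 +
  c)|H'|^2 + 4 s Re (H' cnj H cnj l) + |H|^2 (2 |l|^2 + 2 s |h'|^2), where l is the derivative of s
  in \<open>z\<close>. The cross term is at least -2 s^2 |H'|^2 - 2 |H|^2 |l|^2. What remains of
  |H'|^2 has the factor c - s^2, and \<open>c = 5 * m\<^sup>2\<close> with
  \<open>s \<le> 2 * m\<close> keeps it at least m^2 \<ge> 1.\<close>

lemma hermitian_terms_laplacian:
  assumes H: "(H has_field_derivative H') (at z)" and h: "(h has_field_derivative h') (at z)"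
    and V: "(V has_field_derivative V') (at z)"
    and m: "m \<ge> 1" and s: "m \<le> (norm (h z))\<^sup>2 - Re (V z)" "(norm (h z))\<^sup>2 - Re (V z) \<le> 2 * m"
  shows "(norm H')\<^sup>2 + (norm (H z))\<^sup>2 * (norm h')\<^sup>2
    \<le> Re (\<Sum>(v, w)\<leftarrow>hermitian_terms (5 * m\<^sup>2) h V H. deriv v z * cnj (deriv w z))"
proof -
  define a b d a' b' d' where "a = H z" "b = h z" "d = V z" "a' = cnj (H z)" "b' = cnj (h z)" "d' = cnj (V z)"
  define p q t p' q' t' where "p = H'" "q = h'" "t = V'" "p' = cnj H'" "q' = cnj h'" "t' = cnj V'"
  note defs = \<open>a = H z\<close> \<open>b = h z\<close> \<open>d = V z\<close> \<open>a' = cnj (H z)\<close> \<open>b' = cnj (h z)\<close> \<open>d' = cnj (V z)\<close>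
    \<open>p = H'\<close> \<open>q = h'\<close> \<open>t = V'\<close> \<open>p' = cnj H'\<close> \<open>q' = cnj h'\<close> \<open>t' = cnj V'\<close>
  note D = DERIV_imp_deriv
  have der:
    "deriv (\<lambda>z. H z * (h z)\<^sup>2) z = p * b\<^sup>2 + a * (2 * b * q)"
    "deriv (\<lambda>z. - (H z * h z * V z)) z = - (p * b * d + a * q * d + a * b * t)"
    "deriv (\<lambda>z. H z * h z * V z) z = p * b * d + a * q * d + a * b * t"
    "deriv (\<lambda>z. H z * h z) z = p * b + a * q"
    "deriv (\<lambda>z. - (H z * h z)) z = - (p * b + a * q)"
    "deriv (\<lambda>z. (1/4) * (H z * (V z)\<^sup>2)) z = (1/4) * (p * d\<^sup>2 + a * (2 * d * t))"
    "deriv (\<lambda>z. H z * (V z)\<^sup>2) z = p * d\<^sup>2 + a * (2 * d * t)"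
    "deriv (\<lambda>z. (1/2) * (H z * V z)) z = (1/2) * (p * d + a * t)"
    "deriv (\<lambda>z. H z * V z) z = p * d + a * t"
    "deriv (\<lambda>z. (1/4) * H z) z = (1/4) * p"
    "deriv (\<lambda>z. of_real (5 * m\<^sup>2) * H z) z = of_real (5 * m\<^sup>2) * p"
    by (rule D, (rule derivative_eq_intros H h V refl)+, simp add: defs field_simps)+
  have der_H: "deriv H z = p" using D[OF H] by (simp add: defs)
  define s where "s = (norm (h z))\<^sup>2 - Re (V z)"
  \<comment> \<open>Differentiating s = h cnj h - (V + cnj V)/2 in \<open>z\<close>, with conjugates
    held fixed, gives this expression.\<close>
  define l where "l = q * b' - t / 2"
  define l' where "l' = q' * b - t' / 2"
  have S: "complex_of_real s = b * b' - (d + d') / 2"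
    by (simp add: s_def defs complex_add_cnj flip: complex_norm_square)
  have "(\<Sum>(v, w)\<leftarrow>hermitian_terms (5 * m\<^sup>2) h V H. deriv v z * cnj (deriv w z))
     = (p * b\<^sup>2 + a * (2 * b * q)) * (p' * b'\<^sup>2 + a' * (2 * b' * q'))
     - (p * b * d + a * q * d + a * b * t) * (p' * b' + a' * q')
     - (p * b + a * q) * (p' * b' * d' + a' * q' * d' + a' * b' * t')
     + (1/4) * (p * d\<^sup>2 + a * (2 * d * t)) * p' + (1/2) * (p * d + a * t) * (p' * d' + a' * t')
     + (1/4) * p * (p' * d'\<^sup>2 + a' * (2 * d' * t')) + of_real (5 * m\<^sup>2) * p * p'"
    unfolding hermitian_terms_def
    by (simp only: list.map sum_list.Cons sum_list.Nil prod.case der der_H) (simp add: defs algebra_simps)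
  also have "\<dots> = (of_real s)\<^sup>2 * p * p' + of_real (5 * m\<^sup>2) * p * p' + 2 * of_real s * (p * a' * l' + a * p' * l)
     + a * a' * (2 * l * l' + 2 * of_real s * q * q')"
    unfolding S l_def l'_def by (simp add: power2_eq_square field_simps)
  also have "\<dots> = of_real (s\<^sup>2 * (norm H')\<^sup>2 + 5 * m\<^sup>2 * (norm H')\<^sup>2 + 4 * s * Re (p * a' * l')
     + (norm (H z))\<^sup>2 * (2 * (norm l)\<^sup>2 + 2 * s * (norm h')\<^sup>2))"
  proof -
    have ll: "l' = cnj l" by (simp add: l_def l'_def defs)
    define R where "R = Re (p * a' * l')"
    have X: "p * a' * l' + a * p' * l = 2 * of_real R"
      using complex_add_cnj[of "p * a' * l'"] by (simp add: ll defs mult_ac R_def del: times_complex.sel)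
    have N: "p * p' = of_real ((norm H')\<^sup>2)" "a * a' = of_real ((norm (H z))\<^sup>2)"
      "q * q' = of_real ((norm h')\<^sup>2)" "l * l' = of_real ((norm l)\<^sup>2)"
      by (simp_all only: complex_norm_square ll defs)
    have "(of_real s)\<^sup>2 * p * p' + of_real (5 * m\<^sup>2) * p * p' + 2 * of_real s * (p * a' * l' + a * p' * l)
        + a * a' * (2 * l * l' + 2 * of_real s * q * q')
      = (of_real s)\<^sup>2 * (p * p') + of_real (5 * m\<^sup>2) * (p * p') + 2 * of_real s * (p * a' * l' + a * p' * l)
        + (a * a') * (2 * (l * l') + 2 * of_real s * (q * q'))"
      by (simp only: mult.assoc)
    then show ?thesis unfolding N X R_def[symmetric] by (simp add: mult_ac)
  qed
  finally have eq: "Re (\<Sum>(v, w)\<leftarrow>hermitian_terms (5 * m\<^sup>2) h V H. deriv v z * cnj (deriv w z))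
     = s\<^sup>2 * (norm H')\<^sup>2 + 5 * m\<^sup>2 * (norm H')\<^sup>2 + 4 * s * Re (p * a' * l')
     + (norm (H z))\<^sup>2 * (2 * (norm l)\<^sup>2 + 2 * s * (norm h')\<^sup>2)"
    by (simp only: Re_complex_of_real)
  have sm: "m \<le> s" "s \<le> 2 * m" using s by (auto simp: s_def)
  have "\<bar>Re (p * a' * l')\<bar> \<le> norm H' * norm (H z) * norm l"
  proof -
    have "norm (p * a' * l') = norm H' * norm (H z) * norm l"
      by (simp add: defs norm_mult l_def l'_def flip: complex_mod_cnj[of "h' * cnj (h z) - V' / 2"])
    then show ?thesis using abs_Re_le_cmod[of "p * a' * l'"] by simp
  qed
  then have "4 * s * (- (norm H' * norm (H z) * norm l)) \<le> 4 * s * Re (p * a' * l')"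
    using sm m by (intro mult_left_mono) auto
  moreover have "0 \<le> (s * norm H' - norm (H z) * norm l)\<^sup>2" by simp
  moreover have "s\<^sup>2 * (norm H')\<^sup>2 \<le> (2 * m)\<^sup>2 * (norm H')\<^sup>2"
    using sm m by (intro mult_right_mono power_mono) auto
  moreover have "1 * (norm H')\<^sup>2 \<le> m\<^sup>2 * (norm H')\<^sup>2"
    using m by (intro mult_right_mono) (auto simp: one_le_power)
  moreover have "1 * ((norm (H z))\<^sup>2 * (norm h')\<^sup>2) \<le> (2 * s) * ((norm (H z))\<^sup>2 * (norm h')\<^sup>2)"
    using sm m by (intro mult_right_mono) auto
  ultimately show ?thesis unfolding eq by (simp add: power2_eq_square algebra_simps)
qed

lemma hermitian_terms_holomorphic:
  assumes "h holomorphic_on A" "V holomorphic_on A" "H holomorphic_on A" "(v, w) \<in> set (hermitian_terms c h V H)"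
  shows "v holomorphic_on A \<and> w holomorphic_on A"
proof -
  have "\<forall>(v, w) \<in> set (hermitian_terms c h V H). v holomorphic_on A \<and> w holomorphic_on A"
    unfolding hermitian_terms_def list.set ball_simps prod.case
    by (intro conjI holomorphic_intros assms TrueI)
  then show ?thesis using assms(4) by blast
qed

lemma BMOA_H2: "f \<in> BMOA \<Longrightarrow> f \<in> H2"
  by (simp add: BMOA_def)

lemma two_mult_le_squares: "2 * x * y \<le> x\<^sup>2 + (y::real)\<^sup>2"
  using zero_le_power2[of "x - y"] unfolding power2_diff by linarith

text \<open>Uchiyama's device, with the polynomial \<open>s\<^sup>2 + 5m\<^sup>2\<close> in place of an exponential: for \<open>F = g E\<close> the function
  \<open>(\<bar>g\<bar>\<^sup>2 + \<bar>E\<bar>\<^sup>2) (s\<^sup>2 + 5m\<^sup>2) - 2 Re (u F cnj h)\<close> is subharmonic.\<close>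

lemma Fefferman_Re:
  assumes hB: "h \<in> BMOA" and m: "m \<ge> 1" and garsia: "\<And>z. norm z < 1 \<Longrightarrow> garsia h z \<le> m"
    and F: "F holomorphic_on ball 0 1" and r: "0 < r" "r < 1" and u: "norm u = 1" and d: "d > 0"
  shows "2 * Re (u * (cmean (\<lambda>z. F (of_real r * z) * cnj (h (of_real r * z))) - F 0 * cnj (h 0)))
       \<le> 9 * m\<^sup>2 * (2 * mean_norm F r + d)"
proof -
  have h: "h holomorphic_on ball 0 1" by (rule H2_holomorphic[OF BMOA_H2[OF hB]])
  have nr: "norm (complex_of_real r) < 1" using r by auto
  obtain W where W: "W holomorphic_on ball 0 1" "\<And>z. norm z < 1 \<Longrightarrow> garsia h z = Re (W z) - (norm (h z))\<^sup>2"
    using garsia_eq[OF BMOA_H2[OF hB]] by blast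
  \<comment> \<open>The shift gives s = 2 m - garsia h, so the bounds 0 and \<open>m\<close> for
    \<open>garsia h\<close> place \<open>s\<close> in the window from \<open>m\<close> to
    \<open>2 * m\<close>.\<close>
  define V where "V z = W z - of_real (2 * m)" for z
  have V: "V holomorphic_on ball 0 1" unfolding V_def by (intro holomorphic_intros W)
  define s where "s z = (norm (h z))\<^sup>2 - Re (V z)" for z
  have s: "m \<le> s z" "s z \<le> 2 * m" if "norm z < 1" for z
    using garsia[OF that] garsia_nonneg[OF BMOA_H2[OF hB] that] W(2)[OF that] by (simp_all add: s_def V_def)
  obtain g E where gE: "g holomorphic_on ball 0 1" "E holomorphic_on ball 0 1" "\<And>z. F z = g z * E z"
    "\<And>z. norm z = 1 \<Longrightarrow> (norm (g (of_real r * z)))\<^sup>2 \<le> norm (F (of_real r * z))"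
    "\<And>z. norm z = 1 \<Longrightarrow> (norm (E (of_real r * z)))\<^sup>2 \<le> norm (F (of_real r * z)) + d"
    by (rule circle_factorization[OF F r d]) auto
  define Q where "Q = hermitian_terms (5 * m\<^sup>2) h V"
  define L where "L = Q g @ Q E @ [(\<lambda>z. - (2 * u) * F z, h)]"
  have val: "(\<Sum>(v, w)\<leftarrow>L. v z * cnj (w z))
      = of_real (((norm (g z))\<^sup>2 + (norm (E z))\<^sup>2) * ((s z)\<^sup>2 + 5 * m\<^sup>2)) - 2 * (u * (F z * cnj (h z)))" for z
    by (simp add: L_def Q_def hermitian_terms_value s_def distrib_right mult.assoc del: of_real_mult of_real_power of_real_diff)
  have "Re (\<Sum>(v, w)\<leftarrow>L. v 0 * cnj (w 0))
       \<le> Re (cmean (\<lambda>z. \<Sum>(v, w)\<leftarrow>L. v (of_real r * z) * cnj (w (of_real r * z))))"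
  proof (rule submean_list)
    fix v w assume "(v, w) \<in> set L"
    then have "(v, w) \<in> set (Q g) \<or> (v, w) \<in> set (Q E) \<or> (v = (\<lambda>z. - (2 * u) * F z) \<and> w = h)"
      by (auto simp: L_def)
    then show "v holomorphic_on ball 0 1 \<and> w holomorphic_on ball 0 1"
      unfolding Q_def using hermitian_terms_holomorphic[OF h V gE(1)] hermitian_terms_holomorphic[OF h V gE(2)]
      by (elim disjE) (auto intro!: holomorphic_intros F h)
  next
    fix z :: complex assume z: "norm z < 1"
    let ?R = "\<lambda>L. Re (\<Sum>(v, w)\<leftarrow>L. deriv v z * cnj (deriv w z))"
    let ?S = "\<lambda>H. (norm (deriv H z))\<^sup>2 + (norm (H z))\<^sup>2 * (norm (deriv h z))\<^sup>2"
    have der: "(f has_field_derivative deriv f z) (at z)" if "f holomorphic_on ball 0 1" for f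
      by (rule holomorphic_derivI[OF that]) (use z in auto)
    have "((\<lambda>z. g z * E z) has_field_derivative (deriv g z * E z + deriv E z * g z)) (at z)"
      by (rule DERIV_mult[OF der[OF gE(1)] der[OF gE(2)]])
    moreover have "F = (\<lambda>z. g z * E z)" using gE(3) by (rule ext)
    ultimately have dF: "deriv F z = deriv g z * E z + deriv E z * g z"
      by (simp only: DERIV_imp_deriv)
    have "deriv (\<lambda>z. - (2 * u) * F z) z = - (2 * u) * deriv F z"
      by (rule DERIV_imp_deriv, rule DERIV_cmult[OF der[OF F]])
    then have "?R L
       = ?R (Q g) + ?R (Q E)
         - 2 * Re (u * deriv F z * cnj (deriv h z))"
      by (simp add: L_def algebra_simps)
    moreover have "?S g \<le> ?R (Q g)"
      unfolding Q_def by (rule hermitian_terms_laplacian[OF der[OF gE(1)] der[OF h] der[OF V] m s[OF z, unfolded s_def]])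
    moreover have "?S E \<le> ?R (Q E)"
      unfolding Q_def by (rule hermitian_terms_laplacian[OF der[OF gE(2)] der[OF h] der[OF V] m s[OF z, unfolded s_def]])
    \<comment> \<open>As F' = g' E + E' g, the product is at most |g'| |E h'| + |E'| |g h'|. By 2 x
      y \<le> x^2 + y^2 these are paid crosswise: |g'|^2 and |g h'|^2 come from \<open>?S g\<close>,
      the other two from \<open>?S E\<close>.\<close>
    moreover have "2 * Re (u * deriv F z * cnj (deriv h z)) \<le> ?S g
        + ?S E"
    proof -
      have "Re (u * deriv F z * cnj (deriv h z)) \<le> norm (deriv F z) * norm (deriv h z)"
        using complex_Re_le_cmod[of "u * deriv F z * cnj (deriv h z)"] u by (simp add: norm_mult)
      also have "\<dots> \<le> (norm (deriv g z) * norm (E z) + norm (deriv E z) * norm (g z)) * norm (deriv h z)"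
        unfolding dF by (intro mult_right_mono norm_triangle_le) (auto simp: norm_mult)
      finally show ?thesis
        using two_mult_le_squares[of "norm (deriv g z)" "norm (E z) * norm (deriv h z)"]
          two_mult_le_squares[of "norm (deriv E z)" "norm (g z) * norm (deriv h z)"]
        unfolding power_mult_distrib by (simp add: algebra_simps)
    qed
    ultimately show "0 \<le> ?R L" by linarith
  qed (use r in auto)
  note sub = this[unfolded val]
  let ?rz = "\<lambda>z. of_real r * z :: complex"
  let ?A = "\<lambda>z. ((norm (g (?rz z)))\<^sup>2 + (norm (E (?rz z)))\<^sup>2) * ((s (?rz z))\<^sup>2 + 5 * m\<^sup>2)"
  have c: "circ_continuous (\<lambda>z. F (?rz z))" "circ_continuous (\<lambda>z. h (?rz z))"
    "circ_continuous (\<lambda>z. g (?rz z))" "circ_continuous (\<lambda>z. E (?rz z))"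
    "circ_continuous (\<lambda>z. V (?rz z))"
    by (intro dilate_continuous_sphere[OF _ nr] F h gE V)+
  let ?m = "cmean (\<lambda>z. F (?rz z) * cnj (h (?rz z)))"
  have cA: "circ_continuous ?A" unfolding s_def by (intro continuous_intros c)
  have "cmean (\<lambda>z. of_real (?A z) - 2 * (u * (F (?rz z) * cnj (h (?rz z)))))
      = of_real (cmean ?A) - 2 * (u * ?m)"
    by (subst cmean_diff, intro continuous_on_of_real cA, intro continuous_intros c, subst cmean_of_real[OF cA],
        subst cmean_cmult, intro continuous_intros c, subst cmean_cmult, intro continuous_intros c, rule refl)
  then have "((norm (g 0))\<^sup>2 + (norm (E 0))\<^sup>2) * ((s 0)\<^sup>2 + 5 * m\<^sup>2) - 2 * Re (u * (F 0 * cnj (h 0)))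
     \<le> cmean ?A - 2 * Re (u * ?m)"
    using sub by (simp del: of_real_mult of_real_power of_real_add)
  then have "2 * Re (u * (?m - F 0 * cnj (h 0)))
    \<le> cmean ?A - ((norm (g 0))\<^sup>2 + (norm (E 0))\<^sup>2) * ((s 0)\<^sup>2 + 5 * m\<^sup>2)"
    by (simp add: right_diff_distrib)
  \<comment> \<open>The subtracted value at the origin is a product of nonnegative factors.\<close>
  also have "\<dots> \<le> cmean ?A" by simp
  also have "\<dots> \<le> cmean (\<lambda>z. 9 * m\<^sup>2 * (2 * norm (F (?rz z)) + d))"
  proof (rule cmean_mono[OF cA])
    show "circ_continuous (\<lambda>z. 9 * m\<^sup>2 * (2 * norm (F (?rz z)) + d))" by (intro continuous_intros c)
    fix z :: complex assume z: "norm z = 1"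
    have "norm (?rz z) < 1" using disk_mult_le[OF nr, of z] z by simp
    then have "(s (?rz z))\<^sup>2 \<le> (2 * m)\<^sup>2" using s[of "?rz z"] m by (intro power_mono) auto
    \<comment> \<open>The constant 9 is (2 m)^2 + 5 m^2 in units of m^2.\<close>
    then have 1: "(s (?rz z))\<^sup>2 + 5 * m\<^sup>2 \<le> 9 * m\<^sup>2" by (simp add: power_mult_distrib)
    have 2: "(norm (g (?rz z)))\<^sup>2 + (norm (E (?rz z)))\<^sup>2 \<le> 2 * norm (F (?rz z)) + d"
      using gE(4,5)[OF z] by simp
    have "?A z \<le> (2 * norm (F (?rz z)) + d) * (9 * m\<^sup>2)" by (rule mult_mono[OF 2 1]) (use d in auto)
    then show "?A z \<le> 9 * m\<^sup>2 * (2 * norm (F (?rz z)) + d)" by (simp add: mult.commute)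
  qed
  also have "\<dots> = 9 * m\<^sup>2 * (2 * cmean (\<lambda>z. norm (F (?rz z))) + d)"
    by (subst cmean_real_cmult, intro continuous_intros c, subst cmean_add, intro continuous_intros c, rule continuous_on_const,
        subst cmean_real_cmult, intro continuous_intros c) simp
  finally show ?thesis .
qed

text \<open>A unimodular \<open>u\<close> turns the real part into a modulus, and the slack of the
  factorization is sent to 0. The term at the origin is bounded by the mean value property.
  \<open>K\<close> is independent of \<open>r\<close>, and both sides refer to the same
  circle.\<close>

lemma Fefferman:
  assumes hB: "h \<in> BMOA"
  obtains K where "K \<ge> 0" "\<And>F r. F holomorphic_on ball 0 1 \<Longrightarrow> 0 \<le> r \<Longrightarrow> r < 1 \<Longrightarrow>
    norm (cmean (\<lambda>z. F (of_real r * z) * cnj (h (of_real r * z)))) \<le> K * mean_norm F r"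
proof -
  obtain m0 where "\<forall>z\<in>ball 0 1. garsia h z \<le> m0"
    using hB by (auto simp: BMOA_def bdd_above_def unit_disk_def)
  then have m0: "garsia h z \<le> m0" if "norm z < 1" for z using that by simp
  \<comment> \<open>The Laplacian estimate uses \<open>m \<ge> 1\<close> to keep its coefficients at
    least 1, so a smaller bound is enlarged.\<close>
  define m where "m = max 1 m0"
  have m: "m \<ge> 1" "\<And>z. norm z < 1 \<Longrightarrow> garsia h z \<le> m" using m0 by (auto simp: m_def le_max_iff_disj)
  show ?thesis
  proof
    show "9 * m\<^sup>2 + norm (h 0) \<ge> 0" by simp
    fix F r assume F: "F holomorphic_on ball 0 1" and r: "0 \<le> r" "r < (1::real)"
    define X where "X = cmean (\<lambda>z. F (of_real r * z) * cnj (h (of_real r * z)))"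
    define B where "B = mean_norm F r"
    have nr: "norm (complex_of_real r) < 1" using r by auto
    have cF: "circ_continuous (\<lambda>z. F (of_real r * z))" by (rule dilate_continuous_sphere[OF F nr])
    have B0: "B \<ge> 0" unfolding B_def by (rule cmean_nonneg) (auto intro!: continuous_intros cF)
    have F0: "norm (F 0) \<le> B"
    proof -
      have "cmean (\<lambda>z. F (of_real r * z) * cnj z ^ 0) = taylor_coeff (\<lambda>z. F (of_real r * z)) 0"
        by (rule cmean_cnj_power[OF dilate_continuous[OF F nr] dilate_holomorphic[OF F]]) (use r in auto)
      then show ?thesis using cmean_norm_le[OF cF] by (simp add: B_def)
    qed
    have "norm (X - F 0 * cnj (h 0)) \<le> 9 * m\<^sup>2 * B"
    \<comment> \<open>The factorization needs a positive radius; at \<open>r = 0\<close> the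
      difference is 0 anyway.\<close>
    proof (cases "r = 0 \<or> X - F 0 * cnj (h 0) = 0")
      case True
      then show ?thesis using B0 by (auto simp: X_def)
    next
      case False
      define Y where "Y = X - F 0 * cnj (h 0)"
      define u where "u = cnj Y / of_real (norm Y)"
      have Y: "Y \<noteq> 0" "r > 0" using False r by (auto simp: Y_def)
      have u: "norm u = 1" using Y by (simp add: u_def norm_divide)
      have "u * Y = of_real (norm Y)"
        using Y complex_norm_square[of Y] by (simp add: u_def power2_eq_square mult.commute divide_simps)
      then have Re: "Re (u * Y) = norm Y" by simp
      have "2 * norm Y \<le> 18 * m\<^sup>2 * B"
      proof (rule field_le_epsilon)
        fix e :: real assume e: "e > 0"
        have "2 * norm Y \<le> 9 * m\<^sup>2 * (2 * B + e / (9 * m\<^sup>2))"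
          using Fefferman_Re[OF hB m F Y(2) r(2) u, of "e / (9 * m\<^sup>2)"] e m(1)
          unfolding X_def[symmetric] B_def[symmetric] Y_def[symmetric] Re by simp
        also have "\<dots> = 18 * m\<^sup>2 * B + e" using m(1) by (simp add: distrib_left)
        finally show "2 * norm Y \<le> 18 * m\<^sup>2 * B + e" .
      qed
      then show ?thesis by (simp add: Y_def mult_ac)
    qed
    moreover have "norm (F 0 * cnj (h 0)) \<le> norm (h 0) * B"
      using mult_left_mono[OF F0, of "norm (h 0)"] by (simp add: norm_mult mult.commute)
    ultimately have "norm X \<le> (9 * m\<^sup>2 + norm (h 0)) * B"
      using norm_triangle_ineq[of "X - F 0 * cnj (h 0)" "F 0 * cnj (h 0)"] by (simp add: distrib_right)
    then show "norm (cmean (\<lambda>z. F (of_real r * z) * cnj (h (of_real r * z))))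
       \<le> (9 * m\<^sup>2 + norm (h 0)) * mean_norm F r"
      by (simp add: X_def B_def)
  qed
qed

section \<open>Convergence of the means\<close>

text \<open>Extended by 0 beyond \<open>n\<close>, so that the mean is a multiplier on the whole
  Taylor series.\<close>

definition cesaro_weight :: "real \<Rightarrow> nat \<Rightarrow> nat \<Rightarrow> real" where
  "cesaro_weight \<alpha> n k = (if k \<le> n then cesaro_number \<alpha> (n - k) / cesaro_number \<alpha> n else 0)"

lemma cesaro_number_Suc: "cesaro_number \<alpha> (Suc n) = cesaro_number \<alpha> n * (1 + \<alpha> / (real n + 1))"
  by (simp add: cesaro_number_def pochhammer_Suc divide_simps) (simp add: algebra_simps)

lemma cesaro_number_mono:
  assumes "\<alpha> > 0" "i \<le> j"
  shows "cesaro_number \<alpha> i \<le> cesaro_number \<alpha> j"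
proof (rule lift_Suc_mono_le[OF _ assms(2)])
  show "cesaro_number \<alpha> n \<le> cesaro_number \<alpha> (Suc n)" for n
    using cesaro_number_pos[OF assms(1), of n] assms(1)
    by (simp add: cesaro_number_Suc mult_le_cancel_left1)
qed

lemma cesaro_weight_bounds:
  assumes "\<alpha> > 0"
  shows "0 \<le> cesaro_weight \<alpha> n k" "cesaro_weight \<alpha> n k \<le> 1"
  using cesaro_number_pos[OF assms] cesaro_number_mono[OF assms]
  by (auto simp: cesaro_weight_def divide_le_eq less_imp_le)

text \<open>At n = j + k the weight is a product of \<open>k\<close> consecutive ratios, each
  tending to 1; writing \<open>n\<close> this way disposes of the indices below
  \<open>k\<close>.\<close>

lemma cesaro_weight_tendsto:
  assumes a: "\<alpha> > 0"
  shows "(\<lambda>n. cesaro_weight \<alpha> n k) \<longlonglongrightarrow> 1"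
proof -
  have "(\<lambda>j. cesaro_number \<alpha> j / cesaro_number \<alpha> (j + k)) \<longlonglongrightarrow> 1"
  proof (induction k)
    case 0
    then show ?case using cesaro_number_pos[OF a] by (simp add: less_imp_neq[symmetric])
  next
    case (Suc k)
    have "(\<lambda>j. cesaro_number \<alpha> (j + k) / cesaro_number \<alpha> (Suc (j + k))) = (\<lambda>j. 1 / (1 + \<alpha> / (real j + real k + 1)))"
      using cesaro_number_pos[OF a] by (simp add: cesaro_number_Suc less_imp_neq[symmetric])
    also have "\<dots> \<longlonglongrightarrow> 1" by real_asymp
    finally have "(\<lambda>j. cesaro_number \<alpha> j / cesaro_number \<alpha> (j + k) * (cesaro_number \<alpha> (j + k) / cesaro_number \<alpha> (Suc (j + k)))) \<longlonglongrightarrow> 1 * 1"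
      by (rule tendsto_mult[OF Suc])
    then show ?case using cesaro_number_pos[OF a] by (simp add: less_imp_neq[symmetric])
  qed
  then have "(\<lambda>j. cesaro_weight \<alpha> (j + k) k) \<longlonglongrightarrow> 1" by (simp add: cesaro_weight_def)
  then show ?thesis by (rule LIMSEQ_offset)
qed

lemma sigma_mean_eq:
  assumes "\<alpha> > 0"
  shows "sigma_mean \<alpha> n g = (\<lambda>z. \<Sum>k\<le>n. (of_real (cesaro_weight \<alpha> n k) * taylor_coeff g k) * z ^ k)"
  unfolding sigma_mean_def by (auto simp: cesaro_weight_def sigma_coeff_eq[OF assms])

lemma sigma_mean_holomorphic: "sigma_mean \<alpha> n g holomorphic_on A"
  unfolding sigma_mean_def by (intro holomorphic_intros)

lemma taylor_coeff_sigma_mean: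
  assumes "\<alpha> > 0"
  shows "taylor_coeff (sigma_mean \<alpha> n g) k = of_real (cesaro_weight \<alpha> n k) * taylor_coeff g k"
  unfolding sigma_mean_eq[OF assms] by (simp only: taylor_coeff_polynomial) (simp add: cesaro_weight_def)

text \<open>Division by \<open>cesaro_number \<alpha> n\<close> cancels the growth of the kernel
  norm. The order of quantifiers is the point: \<open>C\<close> is fixed before \<open>n\<close> and
  \<open>f\<close>.\<close>

lemma sigma_mean_convolution:
  assumes a: "\<alpha> > 0"
  obtains C where "\<And>n f. f holomorphic_on ball 0 1 \<Longrightarrow> \<exists>\<kappa>. convolution \<kappa> C f (sigma_mean \<alpha> n f)"
proof -
  obtain m where m: "real m > 1 + \<alpha>" using reals_Archimedean2 by blast
  obtain C where C: "\<And>n. cmean (\<lambda>z. norm (cesaro_kernel \<alpha> m (Suc n) z)) \<le> C * cesaro_number \<alpha> n"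
    by (rule cesaro_kernel_L1[OF a m]) blast
  have "\<exists>\<kappa>. convolution \<kappa> C f (sigma_mean \<alpha> n f)" if f: "f holomorphic_on ball 0 1" for n f
  proof (rule exI, rule convolution.intro)
    let ?G = "cesaro_kernel \<alpha> m (Suc n)" and ?A = "complex_of_real (1 / cesaro_number \<alpha> n)"
    let ?\<kappa> = "\<lambda>u. ?A * (?G u * cnj u ^ n)"
    have cG: "circ_continuous ?G"
      by (rule continuous_on_subset[OF cesaro_kernel_continuous[OF m]]) auto
    show "circ_continuous ?\<kappa>" by (intro continuous_intros cG)
    have "cmean (\<lambda>u. norm (?\<kappa> u)) = cmean (\<lambda>u. (1 / cesaro_number \<alpha> n) * norm (?G u))"
      using cesaro_number_pos[OF a, of n] by (intro cmean_cong) (simp add: norm_mult norm_power norm_divide)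
    also have "\<dots> = (1 / cesaro_number \<alpha> n) * cmean (\<lambda>u. norm (?G u))"
      by (intro cmean_real_cmult continuous_intros cG)
    also have "\<dots> \<le> (1 / cesaro_number \<alpha> n) * (C * cesaro_number \<alpha> n)"
      using cesaro_number_pos[OF a, of n] by (intro mult_left_mono C) auto
    finally show "cmean (\<lambda>u. norm (?\<kappa> u)) \<le> C" using cesaro_number_pos[OF a, of n] by simp
    fix w :: complex assume w: "norm w < 1"
    have "cmean (\<lambda>u. f (w * u) * ?\<kappa> u) = cmean (\<lambda>u. ?A * (f (w * u) * (?G u * cnj u ^ n)))"
      by (simp add: mult_ac)
    also have "\<dots> = ?A * (of_real (cesaro_number \<alpha> n) * sigma_mean \<alpha> n f w)"
      unfolding cesaro_kernel_reproduces[OF a m f w]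
      by (intro cmean_cmult continuous_intros cG dilate_continuous_sphere[OF f w])
    finally show "sigma_mean \<alpha> n f w = cmean (\<lambda>u. f (w * u) * ?\<kappa> u)"
      using cesaro_number_pos[OF a, of n] by simp
  qed (fact f sigma_mean_holomorphic)+
  then show ?thesis using that by blast
qed

text \<open>\<open>H1_norm\<close> is a supremum, so its bounds can be used only after membership is
  known. The mean is a polynomial, hence bounded on the closed disk.\<close>

lemma sigma_mean_H1:
  assumes "f \<in> H1"
  shows "(\<lambda>z. sigma_mean \<alpha> n f z - f z) \<in> H1" "sigma_mean \<alpha> n f \<in> H1"
proof -
  note hf = H1_holomorphic[OF assms]
  let ?s = "sigma_mean \<alpha> n f"
  have hs: "?s holomorphic_on ball 0 1" by (rule sigma_mean_holomorphic)
  have "continuous_on (cball 0 1) ?s"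
    by (rule holomorphic_on_imp_continuous_on) (rule sigma_mean_holomorphic)
  then have "bounded (?s ` cball 0 1)" by (intro compact_imp_bounded compact_continuous_image) auto
  then obtain B where "\<forall>z\<in>cball 0 1. norm (?s z) \<le> B" by (auto simp: bounded_iff)
  then have B: "norm (?s z) \<le> B" if "norm z \<le> 1" for z using that by simp
  have cs: "circ_continuous (\<lambda>z. ?s (of_real s * z))" "circ_continuous (\<lambda>z. f (of_real s * z))"
    and le: "cmean (\<lambda>z. norm (?s (of_real s * z))) \<le> B" if s: "0 \<le> s" "s < 1" for s
  proof -
    show c: "circ_continuous (\<lambda>z. ?s (of_real s * z))" "circ_continuous (\<lambda>z. f (of_real s * z))"
      using s by (auto intro!: dilate_continuous_sphere hf hs)
    have "cmean (\<lambda>z. norm (?s (of_real s * z))) \<le> cmean (\<lambda>_. B)"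
      by (intro cmean_mono continuous_intros c B) (use s in \<open>simp add: norm_mult\<close>)
    then show "cmean (\<lambda>z. norm (?s (of_real s * z))) \<le> B" by simp
  qed
  show "?s \<in> H1" by (rule H1_normI(1)[OF hs le])
  show "(\<lambda>z. ?s z - f z) \<in> H1"
  proof (rule H1_normI(1))
    show "(\<lambda>z. ?s z - f z) holomorphic_on ball 0 1" by (intro holomorphic_intros hs hf)
    fix s :: real assume s: "0 \<le> s" "s < 1"
    have "cmean (\<lambda>z. norm (?s (of_real s * z) - f (of_real s * z)))
        \<le> cmean (\<lambda>z. norm (?s (of_real s * z)) + norm (f (of_real s * z)))"
      by (intro cmean_mono continuous_intros cs s norm_triangle_ineq4)
    also have "\<dots> = cmean (\<lambda>z. norm (?s (of_real s * z))) + mean_norm f s"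
      by (intro cmean_add continuous_intros cs s)
    also have "\<dots> \<le> B + H1_norm f" by (intro add_mono le H1_mean_le assms s)
    finally show "cmean (\<lambda>z. norm (?s (of_real s * z) - f (of_real s * z))) \<le> B + H1_norm f" .
  qed
qed

text \<open>Uniform boundedness plus convergence on a dense set: the mean of g - p costs
  \<open>C * d\<close>, the step from p back to g costs \<open>d\<close>, together
  \<open>e / 2\<close>; the polynomial itself takes the other half.\<close>

lemma sigma_mean_tendsto_H1:
  assumes a: "\<alpha> > 0" and gH: "g \<in> H1"
  shows "(\<lambda>n. H1_norm (\<lambda>z. sigma_mean \<alpha> n g z - g z)) \<longlonglongrightarrow> 0"
proof (rule tendstoI)
  fix e :: real assume e: "e > 0"
  note hg = H1_holomorphic[OF gH]
  obtain C where C: "\<And>n f. f holomorphic_on ball 0 1 \<Longrightarrow> \<exists>\<kappa>. convolution \<kappa> C f (sigma_mean \<alpha> n f)"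
    by (rule sigma_mean_convolution[OF a]) blast
  have C0: "C \<ge> 0" using C[OF hg, of 0] convolution.C_nonneg by blast
  define d where "d = e / (2 * (C + 1))"
  have d: "d > 0" "(C + 1) * d = e / 2" using e C0 by (auto simp: d_def field_simps)
  obtain p where p: "\<And>s. 0 \<le> s \<Longrightarrow> s < 1 \<Longrightarrow> cmean (\<lambda>z. norm (g (of_real s * z) - poly p (of_real s * z))) \<le> d"
    by (rule mean_poly_approx[OF hg H1_mean_le[OF gH] d(1)]) auto
  let ?N = "Polynomial.degree p"
  \<comment> \<open>Once \<open>n\<close> reaches the degree, this bounds the error for
    \<open>p\<close> on the whole closed disk; as a finite sum it tends to 0.\<close>
  define \<epsilon> where "\<epsilon> n = (\<Sum>k\<le>?N. norm (poly.coeff p k) * \<bar>cesaro_weight \<alpha> n k - 1\<bar>)" for n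
  have "\<epsilon> \<longlonglongrightarrow> (\<Sum>k\<le>?N. norm (poly.coeff p k) * \<bar>1 - 1\<bar>)"
    unfolding \<epsilon>_def by (intro tendsto_intros cesaro_weight_tendsto a)
  then have "\<forall>\<^sub>F n in sequentially. \<epsilon> n < e / 2" using e by (intro order_tendstoD) auto
  moreover have "\<forall>\<^sub>F n in sequentially. n \<ge> ?N" by (rule eventually_ge_at_top)
  ultimately show "\<forall>\<^sub>F n in sequentially. dist (H1_norm (\<lambda>z. sigma_mean \<alpha> n g z - g z)) 0 < e"
  proof eventually_elim
    case (elim n)
    let ?gp = "\<lambda>z. g z - poly p z"
    let ?sp = "sigma_mean \<alpha> n (poly p)" and ?sd = "sigma_mean \<alpha> n ?gp" and ?sg = "sigma_mean \<alpha> n g"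
      and ?w = "cesaro_weight \<alpha> n" and ?b = "poly.coeff p"
    have hp: "poly p holomorphic_on ball 0 1" and hgp: "?gp holomorphic_on ball 0 1"
      by (intro holomorphic_intros hg)+
    obtain \<kappa> where "convolution \<kappa> C ?gp (?sd)" using C[OF hgp] by blast
    then interpret convolution \<kappa> C ?gp "?sd" .
    have lin: "?sd z = ?sg z - ?sp z" for z
      unfolding sigma_mean_eq[OF a] taylor_coeff_diff[OF hg hp]
      by (simp add: right_diff_distrib left_diff_distrib sum_subtractf)
    have pol: "norm (?sp z - poly p z) \<le> \<epsilon> n" if z: "norm z \<le> 1" for z
    proof -
      have "?sp z = (\<Sum>k\<le>?N. (of_real (?w k) * ?b k) * z ^ k)"
        unfolding sigma_mean_eq[OF a] taylor_coeff_poly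
        by (rule sum.mono_neutral_right) (use elim(2) in \<open>auto simp: coeff_eq_0\<close>)
      then have "?sp z - poly p z = (\<Sum>k\<le>?N. of_real (?w k - 1) * ?b k * z ^ k)"
        by (simp add: poly_altdef algebra_simps flip: sum_subtractf)
      also have "norm \<dots> \<le> (\<Sum>k\<le>?N. norm (?b k) * \<bar>?w k - 1\<bar>)"
      proof (rule sum_norm_le)
        fix k
        have "\<bar>?w k - 1\<bar> * norm (?b k) * norm z ^ k \<le> \<bar>?w k - 1\<bar> * norm (?b k) * 1"
          using z by (intro mult_left_mono power_le_one) auto
        then show "norm (of_real (?w k - 1) * ?b k * z ^ k) \<le> norm (?b k) * \<bar>?w k - 1\<bar>"
          by (simp add: norm_mult norm_power mult_ac del: of_real_diff)
      qed
      finally show ?thesis by (simp add: \<epsilon>_def)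
    qed
    have "H1_norm (\<lambda>z. ?sg z - g z) \<le> C * d + \<epsilon> n + d"
    proof (rule H1_normI(2))
      show "(\<lambda>z. ?sg z - g z) holomorphic_on ball 0 1"
        by (intro holomorphic_intros sigma_mean_holomorphic hg)
      fix s :: real assume s: "0 \<le> s" "s < 1"
      have ns: "norm (complex_of_real s) < 1" using s by auto
      let ?z = "\<lambda>z. of_real s * z :: complex"
      have c: "circ_continuous (\<lambda>z. g (?z z))" "circ_continuous (\<lambda>z. poly p (?z z))"
        "circ_continuous (\<lambda>z. ?sg (?z z))" "circ_continuous (\<lambda>z. ?sd (?z z))"
        by (intro dilate_continuous_sphere[OF _ ns] hg hp sigma_mean_holomorphic)+
      have "cmean (\<lambda>z. norm (?sg (?z z) - g (?z z)))
          \<le> cmean (\<lambda>z. norm (?sd (?z z)) + \<epsilon> n + norm (g (?z z) - poly p (?z z)))"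
      proof (rule cmean_mono)
        fix z :: complex assume z: "norm z = 1"
        have "norm (?z z) \<le> 1" using disk_mult_le[OF ns, of z] z by simp
        from pol[OF this] show "norm (?sg (?z z) - g (?z z))
            \<le> norm (?sd (?z z)) + \<epsilon> n + norm (g (?z z) - poly p (?z z))"
          unfolding lin
          using norm_triangle_ineq4[of "(?sg (?z z) - ?sp (?z z)) + (?sp (?z z) - poly p (?z z))" "g (?z z) - poly p (?z z)"]
            norm_triangle_ineq[of "?sg (?z z) - ?sp (?z z)" "?sp (?z z) - poly p (?z z)"]
          by simp
      qed (intro continuous_intros c)+
      also have "\<dots> = cmean (\<lambda>z. norm (?sd (?z z))) + \<epsilon> n + cmean (\<lambda>z. norm (g (?z z) - poly p (?z z)))"
        by (subst cmean_add, intro continuous_intros c, intro continuous_intros c,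
            subst cmean_add, intro continuous_intros c, rule continuous_on_const) simp
      also have "\<dots> \<le> C * d + \<epsilon> n + d"
        by (intro add_mono mean_le p s order_refl)
      finally show "cmean (\<lambda>z. norm (?sg (?z z) - g (?z z))) \<le> C * d + \<epsilon> n + d" .
    qed
    also have "\<dots> = e / 2 + \<epsilon> n" using d(2) by (simp add: distrib_right)
    also have "\<dots> < e" using elim(1) by simp
    finally show ?case using H1_norm_nonneg[OF sigma_mean_H1(1)[OF gH]] by (simp add: dist_real_def)
  qed
qed

section \<open>The duality pairing at radius below 1\<close>

lemma cnj_cnj_holomorphic:
  assumes "f holomorphic_on ball 0 1"
  shows "(\<lambda>z. cnj (f (cnj z))) holomorphic_on ball 0 1"
proof -
  have "cnj ` ball 0 1 = ball (0::complex) 1"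
  proof (intro equalityI subsetI)
    fix z :: complex assume "z \<in> ball 0 1"
    then have "cnj z \<in> ball 0 1" "z = cnj (cnj z)" by simp_all
    then show "z \<in> cnj ` ball 0 1" by blast
  qed auto
  then have "cnj \<circ> f \<circ> cnj holomorphic_on ball 0 1"
    using assms by (intro holomorphic_on_compose_cnj_cnj) auto
  then show ?thesis by (simp add: o_def)
qed

lemma continuous_on_sphere_cnj:
  assumes "circ_continuous F"
  shows "circ_continuous (\<lambda>z. F (cnj z))"
  by (rule continuous_on_compose2[OF assms]) (auto intro!: continuous_intros)

definition radial_pair :: "real \<Rightarrow> (complex \<Rightarrow> complex) \<Rightarrow> (complex \<Rightarrow> complex) \<Rightarrow> complex" where
  "radial_pair s g h = cmean (\<lambda>z. g (of_real s * z) * h (of_real s * cnj z))"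

lemma dual_pair_eq: "dual_pair g h = Lim (at_left 1) (\<lambda>s. radial_pair s g h)"
  by (simp add: dual_pair_def radial_pair_def cmean_def cis_cnj scaleR_conv_of_real)

lemma radial_pair_continuous:
  assumes "g holomorphic_on ball 0 1" "h holomorphic_on ball 0 1" "0 \<le> s" "s < 1"
  shows "circ_continuous (\<lambda>z. g (of_real s * z) * h (of_real s * cnj z))"
proof -
  have "norm (complex_of_real s) < 1" using assms by simp
  then show ?thesis
    using continuous_on_sphere_cnj[OF dilate_continuous_sphere[OF assms(2)], of "of_real s"]
    by (intro continuous_on_mult dilate_continuous_sphere[OF assms(1)]) auto
qed

lemma radial_pair_sums:
  assumes g: "g holomorphic_on ball 0 1" and h: "h holomorphic_on ball 0 1" and s: "0 \<le> s" "s < 1"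
  shows "(\<lambda>k. taylor_coeff g k * taylor_coeff h k * of_real (s ^ (2 * k))) sums radial_pair s g h"
proof -
  let ?h = "\<lambda>z. cnj (h (cnj z))"
  have hh: "?h holomorphic_on ball 0 1" by (rule cnj_cnj_holomorphic[OF h])
  have "taylor_coeff ?h k = cnj (taylor_coeff h k)" for k
  proof -
    \<comment> \<open>Any dilation factor between 0 and 1 would do: it makes the functions
      continuous on the closed disk, as the coefficient formula requires.\<close>
    have n: "norm (1/2 :: complex) < 1" "norm (1/2 :: complex) \<le> 1" by simp_all
    have c: "circ_continuous (\<lambda>z. h ((1/2) * z) * cnj z ^ k)"
      by (intro continuous_intros dilate_continuous_sphere[OF h n(1)])
    have "(1/2) ^ k * taylor_coeff ?h k = cmean (\<lambda>z. ?h ((1/2) * z) * cnj z ^ k)"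
      by (simp only: cmean_cnj_power[OF dilate_continuous[OF hh n(1)] dilate_holomorphic[OF hh n(2)]] taylor_coeff_dilate[OF hh n(2)])
    also have "\<dots> = cmean (\<lambda>z. cnj (h ((1/2) * cnj z) * cnj (cnj z) ^ k))" by simp
    also have "\<dots> = cmean (\<lambda>z. cnj (h ((1/2) * z) * cnj z ^ k))"
      by (rule cmean_reflect)
    also have "\<dots> = cnj (cmean (\<lambda>z. h ((1/2) * z) * cnj z ^ k))" by (rule cmean_cnj[OF c])
    also have "\<dots> = cnj ((1/2) ^ k * taylor_coeff h k)"
      by (simp only: cmean_cnj_power[OF dilate_continuous[OF h n(1)] dilate_holomorphic[OF h n(2)]] taylor_coeff_dilate[OF h n(2)])
    finally show ?thesis by simp
  qed
  then show ?thesis using cmean_Parseval[OF g hh s] by (simp add: radial_pair_def)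
qed

text \<open>The pairing is bilinear, the duality inequality sesquilinear. Replacing \<open>g\<close>
  by z -> cnj (g (cnj z)) keeps holomorphy and circle means and turns the pairing into its
  conjugate.\<close>

lemma radial_pair_bound:
  assumes h: "h \<in> BMOA"
  obtains K where "K \<ge> 0" "\<And>g s. g \<in> H1 \<Longrightarrow> 0 \<le> s \<Longrightarrow> s < 1 \<Longrightarrow> norm (radial_pair s g h) \<le> K * H1_norm g"
proof -
  obtain K where K: "K \<ge> 0" "\<And>F r. F holomorphic_on ball 0 1 \<Longrightarrow> 0 \<le> r \<Longrightarrow> r < 1 \<Longrightarrow>
    norm (cmean (\<lambda>z. F (of_real r * z) * cnj (h (of_real r * z)))) \<le> K * mean_norm F r"
    using Fefferman[OF h] by blast
  have hh: "h holomorphic_on ball 0 1" by (rule H2_holomorphic[OF BMOA_H2[OF h]])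
  have "norm (radial_pair s g h) \<le> K * H1_norm g" if g: "g \<in> H1" and s: "0 \<le> s" "s < 1" for g s
  proof -
    note hg = H1_holomorphic[OF g]
    let ?F = "\<lambda>z. cnj (g (cnj z))"
    have 1: "radial_pair s g h = cmean (\<lambda>z. g (of_real s * cnj z) * h (of_real s * z))"
      unfolding radial_pair_def
      using cmean_reflect[of "\<lambda>z. g (of_real s * z) * h (of_real s * cnj z)"] by simp
    have 2: "cmean (\<lambda>z. ?F (of_real s * z) * cnj (h (of_real s * z))) = cnj (cmean (\<lambda>z. g (of_real s * cnj z) * h (of_real s * z)))"
      using cmean_cnj[OF continuous_on_sphere_cnj[OF radial_pair_continuous[OF hg hh s]]] by simp
    have "norm (radial_pair s g h) = norm (cmean (\<lambda>z. ?F (of_real s * z) * cnj (h (of_real s * z))))"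
      unfolding 1 2 complex_mod_cnj ..
    also have "\<dots> \<le> K * cmean (\<lambda>z. norm (?F (of_real s * z)))"
      by (rule K(2)[OF cnj_cnj_holomorphic[OF hg] s])
    also have "cmean (\<lambda>z. norm (?F (of_real s * z))) = mean_norm g s"
      using cmean_reflect[of "\<lambda>z. norm (g (of_real s * z))"] by simp
    also have "K * \<dots> \<le> K * H1_norm g" by (intro mult_left_mono H1_mean_le g s K)
    finally show ?thesis .
  qed
  with K(1) show ?thesis using that by blast
qed

text \<open>The means are symmetric for the pairing: applied to \<open>g\<close> or to
  \<open>h\<close>, they give the same finite sum at each radius. As they converge on
  \<open>g\<close> in norm, replacing \<open>g\<close> by its mean changes the radial pairing by at
  most \<open>\<eta> n\<close> at every radius, which permits interchanging the limits in
  \<open>n\<close> and \<open>s\<close>.\<close>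

lemma sigma_mean_dual_pair_tendsto:
  assumes a: "\<alpha> > 0" and h: "h \<in> BMOA" and g: "g \<in> H1"
  shows "(\<lambda>n. dual_pair g (sigma_mean \<alpha> n h)) \<longlonglongrightarrow> dual_pair g h"
proof -
  note hg = H1_holomorphic[OF g] and hh = H2_holomorphic[OF BMOA_H2[OF h]]
  obtain K where K: "K \<ge> 0" "\<And>g s. g \<in> H1 \<Longrightarrow> 0 \<le> s \<Longrightarrow> s < 1 \<Longrightarrow> norm (radial_pair s g h) \<le> K * H1_norm g"
    using radial_pair_bound[OF h] by blast
  define \<eta> where "\<eta> n = K * H1_norm (\<lambda>z. sigma_mean \<alpha> n g z - g z)" for n
  let ?c = "\<lambda>n k. complex_of_real (cesaro_weight \<alpha> n k) * taylor_coeff g k * taylor_coeff h k"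
  have "\<eta> \<longlonglongrightarrow> K * 0" unfolding \<eta>_def by (intro tendsto_intros sigma_mean_tendsto_H1 a g)
  then have \<eta>: "\<eta> \<longlonglongrightarrow> 0" by simp
  define L where "L n = (\<Sum>k\<le>n. ?c n k)" for n
  have fin: "radial_pair s (sigma_mean \<alpha> n g) h = (\<Sum>k\<le>n. ?c n k * of_real (s ^ (2 * k)))"
    "radial_pair s g (sigma_mean \<alpha> n h) = (\<Sum>k\<le>n. ?c n k * of_real (s ^ (2 * k)))"
    if s: "0 \<le> s" "s < 1" for s n
  proof -
    let ?t = "\<lambda>k. ?c n k * of_real (s ^ (2 * k))"
    have t: "?t sums (\<Sum>k\<le>n. ?t k)" by (rule sums_finite) (auto simp: cesaro_weight_def)
    show "radial_pair s (sigma_mean \<alpha> n g) h = (\<Sum>k\<le>n. ?t k)"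
      using radial_pair_sums[OF sigma_mean_holomorphic[of \<alpha> n g] hh s]
      by (intro sums_unique2[OF _ t]) (simp add: taylor_coeff_sigma_mean[OF a])
    show "radial_pair s g (sigma_mean \<alpha> n h) = (\<Sum>k\<le>n. ?t k)"
      using radial_pair_sums[OF hg sigma_mean_holomorphic[of \<alpha> n h] s]
      by (intro sums_unique2[OF _ t]) (simp add: taylor_coeff_sigma_mean[OF a] mult_ac)
  qed
  have lim: "((\<lambda>s. \<Sum>k\<le>n. ?c n k * of_real (s ^ (2 * k))) \<longlongrightarrow> L n) (at_left 1)" for n
  proof -
    have "((\<lambda>s. \<Sum>k\<le>n. ?c n k * of_real (s ^ (2 * k))) \<longlongrightarrow>
       (\<Sum>k\<le>n. ?c n k * of_real (1 ^ (2 * k)))) (at_left 1)"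
      by (intro tendsto_intros)
    then show ?thesis by (simp add: L_def)
  qed
  let ?r = "\<lambda>n s. radial_pair s (sigma_mean \<alpha> n g) h"
  have lim1: "((\<lambda>s. ?r n s) \<longlongrightarrow> L n) (at_left 1)" for n
    by (rule Lim_transform_eventually[OF lim eventually_mono[OF eventually_at_left_1]]) (simp add: fin)
  have "((\<lambda>s. radial_pair s g (sigma_mean \<alpha> n h)) \<longlongrightarrow> L n) (at_left 1)" for n
    by (rule Lim_transform_eventually[OF lim eventually_mono[OF eventually_at_left_1]]) (simp add: fin)
  then have dual: "dual_pair g (sigma_mean \<alpha> n h) = L n" for n
    unfolding dual_pair_eq by (intro tendsto_Lim) simp_all
  have close: "norm (?r n s - radial_pair s g h) \<le> \<eta> n" if s: "0 < s" "s < 1" for s n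
  proof -
    have "radial_pair s (\<lambda>z. sigma_mean \<alpha> n g z - g z) h = ?r n s - radial_pair s g h"
      unfolding radial_pair_def left_diff_distrib
      by (intro cmean_diff radial_pair_continuous sigma_mean_holomorphic hg hh) (use s in auto)
    then show ?thesis using K(2)[OF sigma_mean_H1(1)[OF g], of s \<alpha> n] s by (simp add: \<eta>_def)
  qed
  \<comment> \<open>Comparing two means with each other eliminates the radial pairing of
    \<open>g\<close> itself, whose limit is not yet known to exist.\<close>
  have diff: "norm (L n - L m) \<le> \<eta> n + \<eta> m" for n m
  proof (rule tendsto_upperbound[OF tendsto_norm[OF tendsto_diff[OF lim1 lim1]] eventually_mono[OF eventually_at_left_1]])
    fix s :: real assume s: "0 < s \<and> s < 1"
    have "?r n s - ?r m s
       = (?r n s - radial_pair s g h) - (?r m s - radial_pair s g h)"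
      by simp
    then show "norm (?r n s - ?r m s) \<le> \<eta> n + \<eta> m"
      using norm_triangle_ineq4 close[of s n] close[of s m] s by (smt (verit))
  qed simp
  have "Cauchy L"
  proof (rule metric_CauchyI)
    fix e :: real assume "e > 0"
    then have "\<forall>\<^sub>F n in sequentially. \<eta> n < e / 2" using \<eta> by (intro order_tendstoD) auto
    then obtain N where N: "\<And>n. n \<ge> N \<Longrightarrow> \<eta> n < e / 2" by (auto simp: eventually_sequentially)
    show "\<exists>N. \<forall>m\<ge>N. \<forall>n\<ge>N. dist (L m) (L n) < e"
    proof (intro exI allI impI)
      fix m n assume "m \<ge> N" "n \<ge> N"
      then show "dist (L m) (L n) < e" using diff[of m n] N[of m] N[of n] by (simp add: dist_norm)
    qed
  qed
  then obtain l where l: "L \<longlonglongrightarrow> l" using Cauchy_convergent_iff convergent_def by blast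
  \<comment> \<open>This is the existence of the limit behind \<open>dual_pair g h\<close>: one
    \<open>n\<close> with small errors is fixed, then \<open>s\<close> is taken close to 1 for
    it.\<close>
  have "((\<lambda>s. radial_pair s g h) \<longlongrightarrow> l) (at_left 1)"
  proof (rule tendstoI)
    fix e :: real assume e: "e > 0"
    have "\<forall>\<^sub>F n in sequentially. \<eta> n < e / 3" using \<eta> e by (intro order_tendstoD) auto
    moreover have "\<forall>\<^sub>F n in sequentially. dist (L n) l < e / 3" using l e by (intro tendstoD) auto
    ultimately have "\<forall>\<^sub>F n in sequentially. \<eta> n < e / 3 \<and> dist (L n) l < e / 3" by (rule eventually_conj)
    then obtain n where n: "\<eta> n < e / 3" "dist (L n) l < e / 3" by (auto simp: eventually_sequentially)
    have "\<forall>\<^sub>F s in at_left 1. dist (?r n s) (L n) < e / 3"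
      using lim1 e by (intro tendstoD) auto
    with eventually_at_left_1 show "\<forall>\<^sub>F s in at_left 1. dist (radial_pair s g h) l < e"
    proof eventually_elim
      case (elim s)
      have "dist (radial_pair s g h) l \<le> dist (?r n s) (radial_pair s g h)
          + dist (?r n s) (L n) + dist (L n) l"
        by (smt (verit) dist_triangle dist_commute)
      moreover have "dist (?r n s) (radial_pair s g h) < e / 3"
        using close[of s n] elim(1) n(1) by (simp add: dist_norm)
      ultimately show ?case using elim(2) n(2) by linarith
    qed
  qed
  then have "dual_pair g h = l" unfolding dual_pair_eq by (intro tendsto_Lim) simp_all
  then show ?thesis using l by (simp add: dual)
qed

text \<open>The splitting radius \<open>R\<close> depends on \<open>f\<close> and \<open>e\<close>
  but not on \<open>n\<close>, so the factor (1 + R)/(1 - R) stays constant while the mean squares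
  of the differences tend to 0.\<close>

lemma sigma_mean_tendsto_BMOA:
  assumes a: "\<alpha> > 0" and f: "f \<in> VMOA"
  shows "(\<lambda>n. BMOA_norm (\<lambda>z. sigma_mean \<alpha> n f z - f z)) \<longlonglongrightarrow> 0"
proof (rule tendstoI)
  fix e :: real assume e: "e > 0"
  have fH: "f \<in> H2" using f by (simp add: VMOA_def BMOA_H2)
  note hf = H2_holomorphic[OF fH]
  obtain M where M: "\<And>s. 0 \<le> s \<Longrightarrow> s < 1 \<Longrightarrow> mean_square f s \<le> M"
    using H2_bound[OF fH] by blast
  let ?a = "\<lambda>k. (norm (taylor_coeff f k))\<^sup>2"
  have sm: "summable ?a" by (rule summable_taylor_coeff_square[OF hf M])
  \<comment> \<open>The squared multiplier of the difference between mean and function. It lies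
    between 0 and 1 and tends to 0 for each \<open>k\<close>, so the squared Taylor coefficients of
    \<open>f\<close> dominate.\<close>
  define w where "w n k = (cesaro_weight \<alpha> n k - 1)\<^sup>2" for n k
  have w: "0 \<le> w n k" "w n k \<le> 1" for n k
    using cesaro_weight_bounds[OF a, of n k] by (auto simp: w_def power_le_one_iff abs_square_le_1)
  have sH: "sigma_mean \<alpha> n f \<in> H2" for n
  proof (rule H2_I[OF sigma_mean_holomorphic])
    fix s :: real assume s: "0 \<le> s" "s < 1"
    show "cmean (\<lambda>z. (norm (sigma_mean \<alpha> n f (of_real s * z)))\<^sup>2) \<le> suminf ?a"
    proof (rule mean_square_le_suminf[OF sigma_mean_holomorphic sm _ s])
      fix k
      show "(norm (taylor_coeff (sigma_mean \<alpha> n f) k))\<^sup>2 \<le> ?a k"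
        using cesaro_weight_bounds[OF a, of n k]
        by (intro power_mono) (auto simp: taylor_coeff_sigma_mean[OF a] norm_mult mult_left_le_one_le)
    qed
  qed
  define D where "D n z = sigma_mean \<alpha> n f z - f z" for n z
  have DH: "D n \<in> H2" for n unfolding D_def[abs_def] by (rule H2_diff[OF sH fH])
  have sw: "summable (\<lambda>k. w n k * ?a k)" for n
    by (rule summable_comparison_test[OF _ sm]) (use w in \<open>auto simp: abs_mult mult_left_le_one_le\<close>)
  have D_mean: "cmean (\<lambda>z. (norm (D n (of_real s * z)))\<^sup>2) \<le> (\<Sum>k. w n k * ?a k)" if s: "0 \<le> s" "s < 1" for n s
  proof (rule mean_square_le_suminf[OF H2_holomorphic[OF DH] sw _ s])
    fix k
    have "taylor_coeff (D n) k = of_real (cesaro_weight \<alpha> n k - 1) * taylor_coeff f k"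
      unfolding D_def[abs_def] taylor_coeff_diff[OF sigma_mean_holomorphic hf]
      by (simp add: taylor_coeff_sigma_mean[OF a] algebra_simps)
    then show "(norm (taylor_coeff (D n) k))\<^sup>2 \<le> w n k * ?a k"
      by (simp add: norm_mult power_mult_distrib w_def del: of_real_diff)
  qed
  have D_lim: "(\<lambda>n. \<Sum>k. w n k * ?a k) \<longlonglongrightarrow> 0"
  proof -
    have lim: "(\<lambda>n. w n k * ?a k) \<longlonglongrightarrow> 0" for k
    proof -
      have "(\<lambda>n. w n k * ?a k) \<longlonglongrightarrow> (1 - 1)\<^sup>2 * ?a k"
        unfolding w_def by (intro tendsto_intros cesaro_weight_tendsto a)
      then show ?thesis by simp
    qed
    have bd: "\<forall>\<^sub>F (k, n) in at_top \<times>\<^sub>F sequentially. norm (w n k * ?a k) \<le> ?a k"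
      by (rule always_eventually) (use w in \<open>auto simp: abs_mult mult_left_le_one_le\<close>)
    show ?thesis using tannerys_theorem[OF lim bd sm] by simp
  qed
  obtain C where C: "\<And>n f. f holomorphic_on ball 0 1 \<Longrightarrow> \<exists>\<kappa>. convolution \<kappa> C f (sigma_mean \<alpha> n f)"
    by (rule sigma_mean_convolution[OF a]) blast
  \<comment> \<open>Solves 2 C^2 d + 2 d = (e/2)^2; the factors 2 come from
    \<open>garsia_diff_le\<close>, the square from the root in \<open>BMOA_norm\<close>.\<close>
  define d where "d = (e / 2)\<^sup>2 / (2 * (C * C + 1))"
  have CC: "C * C + 1 > 0" by (simp add: add_nonneg_pos)
  have "2 * (C * C * d) + 2 * d = d * (2 * (C * C + 1))" by (simp add: algebra_simps)
  also have "\<dots> = (e / 2)\<^sup>2" using CC by (simp add: d_def)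
  finally have d: "d > 0" "2 * (C * C * d) + 2 * d = (e / 2)\<^sup>2"
    using e CC by (auto simp: d_def)
  obtain R0 where "R0 < 1" "\<forall>z. R0 < norm z \<and> norm z < 1 \<longrightarrow> \<bar>garsia f z\<bar> < d"
    using f d(1) by (auto simp: VMOA_def)
  \<comment> \<open>\<open>R0\<close> may be negative and is then raised to 0.\<close>
  then obtain R where R: "0 \<le> R" "R < 1" "\<And>z. R < norm z \<Longrightarrow> norm z < 1 \<Longrightarrow> \<bar>garsia f z\<bar> < d"
    by (metis max.strict_boundedE max_def linorder_not_less max.cobounded2 zero_less_one)
  have "(\<lambda>n. (1 + R) / (1 - R) * (\<Sum>k. w n k * ?a k)) \<longlonglongrightarrow> (1 + R) / (1 - R) * 0"
    by (intro tendsto_mult tendsto_const D_lim)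
  then have "\<forall>\<^sub>F n in sequentially. (1 + R) / (1 - R) * (\<Sum>k. w n k * ?a k) < (e / 2)\<^sup>2"
    using e by (intro order_tendstoD) auto
  then show "\<forall>\<^sub>F n in sequentially. dist (BMOA_norm (\<lambda>z. sigma_mean \<alpha> n f z - f z)) 0 < e"
  proof eventually_elim
    case (elim n)
    have le: "garsia (D n) z \<le> (e / 2)\<^sup>2" if z: "norm z < 1" for z
    proof (cases "R < norm z")
      case True
      obtain \<kappa> where "convolution \<kappa> C f (sigma_mean \<alpha> n f)" using C[OF hf] by blast
      then interpret convolution \<kappa> C f "sigma_mean \<alpha> n f" .
      have "garsia (sigma_mean \<alpha> n f) z \<le> C * C * d"
      proof (rule garsia_le[OF fH sH z])
        fix u :: complex assume "norm u = norm z"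
        then show "garsia f u \<le> d" using R(3)[of u] True z by simp
      qed
      moreover have "garsia f z \<le> d" using R(3)[OF True z] by simp
      moreover have "garsia (D n) z \<le> 2 * garsia (sigma_mean \<alpha> n f) z + 2 * garsia f z"
        unfolding D_def[abs_def] by (rule garsia_diff_le[OF sH fH z])
      ultimately show ?thesis using d(2) by linarith
    next
      case False
      have S0: "0 \<le> (\<Sum>k. w n k * ?a k)" using w by (intro suminf_nonneg sw) auto
      have "garsia (D n) z \<le> (1 + norm z) / (1 - norm z) * (\<Sum>k. w n k * ?a k)"
        by (rule garsia_le_mean_square[OF DH z D_mean])
      also have "\<dots> \<le> (1 + R) / (1 - R) * (\<Sum>k. w n k * ?a k)"
        using False R(1,2) by (intro mult_right_mono S0 frac_le) auto
      finally show ?thesis using elim by simp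
    qed
    have sq: "sqrt (garsia (D n) z) \<le> e / 2" if "z \<in> unit_disk" for z
      using le[of z] that e by (intro real_le_lsqrt) (auto simp: unit_disk_def)
    have ne: "unit_disk \<noteq> {}" "0 \<in> unit_disk" by (auto simp: unit_disk_def)
    \<comment> \<open>The weight at index 0 is 1, so the means preserve the constant term.\<close>
    have "norm (D n 0) = 0"
      using cesaro_number_pos[OF a, of n] taylor_coeff_sigma_mean[OF a, of n f 0]
      by (simp add: D_def cesaro_weight_def)
    moreover have "(SUP z\<in>unit_disk. sqrt (garsia (D n) z)) \<le> e / 2"
      by (rule cSUP_least[OF ne(1) sq])
    \<comment> \<open>This lower bound shows that the norm is nonnegative, so that its distance to 0
      is the norm itself.\<close>
    moreover have "sqrt (garsia (D n) 0) \<le> (SUP z\<in>unit_disk. sqrt (garsia (D n) z))"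
      by (rule cSUP_upper[OF ne(2)]) (use sq in \<open>auto intro!: bdd_aboveI[of _ "e / 2"]\<close>)
    moreover have "0 \<le> sqrt (garsia (D n) 0)" using garsia_nonneg[OF DH, of 0] by simp
    ultimately have "0 \<le> BMOA_norm (D n)" "BMOA_norm (D n) \<le> e / 2" unfolding BMOA_norm_def by linarith+
    then show ?case using e by (simp add: D_def[abs_def] dist_real_def)
  qed
qed

theorem theorem5p3:
  fixes \<alpha> :: real
  assumes "\<alpha> > 0"
  shows "(\<forall>g\<in>H1. (\<lambda>n. H1_norm (\<lambda>z. sigma_mean \<alpha> n g z - g z)) \<longlonglongrightarrow> 0)
       \<and> (\<forall>h\<in>BMOA. \<forall>g\<in>H1. (\<lambda>n. dual_pair g (sigma_mean \<alpha> n h)) \<longlonglongrightarrow> dual_pair g h)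
       \<and> (\<forall>f\<in>VMOA. (\<lambda>n. BMOA_norm (\<lambda>z. sigma_mean \<alpha> n f z - f z)) \<longlonglongrightarrow> 0)"
  using sigma_mean_tendsto_H1[OF assms] sigma_mean_dual_pair_tendsto[OF assms]
    sigma_mean_tendsto_BMOA[OF assms] by blast

end
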